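(* For each integer $k\ge 0$, as $n\to\infty$, $$u_{2k}(n)\sim\frac{e^{\pi\sqrt{\frac{2n}{3}}}}{8\cdot 6^{1/4}n^{3/4}}(2k-1)!!\left(\frac{6n}{\pi^2}\right)^{\frac k2},$$ where $u_{2k}(n):=\sum_{m\in\mathbb Z}m^{2k}u(m,n)$.
   Context: A strongly unimodal sequence of size $n$ is a finite sequence of positive integers $\{a_j\}_{j=1}^s$ with $a_1<\dots<a_k>\dots>a_s$ for some $k$ and $\sum a_j=n$; its rank is $s-2k+1$; $u(m,n)$ is the number of such sequences of size $n$ and rank $m$. $(2k-1)!!=1\cdot3\cdots(2k-1)$, with $(-1)!!=1$. *)

theory Defs
  imports "HOL-Analysis.Analysis" "HOL-Library.Landau_Symbols"
begin

text \<open>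
  A sequence \<open>a\<^sub>1, \<dots>, a\<^sub>s\<close> is a list, and the peak position \<open>k\<close> is 1-based, so that
  \<open>take k a\<close> is \<open>a\<^sub>1, \<dots>, a\<^sub>k\<close> and \<open>drop (k - 1) a\<close> is \<open>a\<^sub>k, \<dots>, a\<^sub>s\<close>.
\<close>

definition strongly_unimodal_at :: "nat \<Rightarrow> nat list \<Rightarrow> bool" where
  "strongly_unimodal_at k a \<longleftrightarrow>
     1 \<le> k \<and> k \<le> length a \<and> (\<forall>x \<in> set a. 0 < x) \<and>
     sorted_wrt (<) (take k a) \<and> sorted_wrt (>) (drop (k - 1) a)"

text \<open>The peak position of a sequence is unique, so each sequence has exactly one rank.\<close>

definition u :: "int \<Rightarrow> nat \<Rightarrow> nat" where
  "u m n = card {a. sum_list a = n \<and>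
     (\<exists>k. strongly_unimodal_at k a \<and> int (length a) - 2 * int k + 1 = m)}"

text \<open>For fixed \<open>n\<close> only finitely many \<open>u m n\<close> are nonzero, so the infinite sum is a finite one.\<close>

definition u_moment :: "nat \<Rightarrow> nat \<Rightarrow> real" where
  "u_moment r n = (\<Sum>\<^sub>\<infinity>m::int. of_int m ^ r * real (u m n))"

text \<open>\<open>odd_double_fact k\<close> is \<open>(2k - 1)!!\<close>; the empty product gives \<open>(-1)!! = 1\<close>.\<close>

definition odd_double_fact :: "nat \<Rightarrow> nat" where
  "odd_double_fact k = (\<Prod>j = 1..k. 2 * j - 1)"

end

theory Submission
  imports Defs "HOL-Complex_Analysis.Complex_Analysis" "HOL-Probability.Sinc_Integral"
    "HOL-Real_Asymp.Real_Asymp"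
begin

text \<open>
  A strongly unimodal sequence is a peak \<open>c\<close> with two sets \<open>A\<close>, \<open>B\<close> of smaller parts. Removing the largest
  part of a pair \<open>(A, B)\<close> of finite sets of positive integers with \<open>\<Sum>A + \<Sum>B = n\<close> leaves such a triple,
  unless the largest part is in both sets; since raising the peak is injective, the exceptional
  pairs are no more numerous than the increment of the counting function in \<open>n\<close>. So each rank
  moment is asymptotically half of the corresponding moment of \<open>card B - card A\<close> over pairs. The
  pairs have the product generating function \<open>\<Prod>j. (1 + w * q ^ j) * (1 + q ^ j / w)\<close>. With \<open>q = exp (- t)\<close>,
  \<open>t = pi / sqrt (6 * n)\<close> and \<open>w = exp (s * sqrt t)\<close>, the Fourier integral for its \<open>n\<close>-th coefficient
  converges, by dominated convergence, to a Gaussian integral times \<open>exp (s\<^sup>2 / 2)\<close>, uniformly bounded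
  for \<open>cmod s \<le> 1\<close>. Cauchy's formula for the \<open>2 * k\<close>-th derivative at \<open>s = 0\<close> then gives the moments,
  with \<open>(2 * k - 1)!!\<close> as the derivative of \<open>exp (s\<^sup>2 / 2)\<close>.
\<close>

section \<open>Sequences as triples\<close>

text \<open>Counting sequences directly would give a sum of products, because the peak bounds both
  flanks; pairs of sets give one product, at the cost of the twin-peak triples and of rank shifts by
  one. That no modular transformation is needed is due to the logarithm of the product being a sum
  of \<open>ln (1 + exp (- z))\<close> over the multiples of one point: comparison with the integral
  gives its size up to \<open>o(1)\<close> as the point tends to 0 inside a sector. Outside the
  sector only an upper bound is needed, and one elementary inequality covers the whole range
  \<open>\<bar>\<theta>\<bar> \<le> pi\<close>, so arcs are never separated. The scales come from
  the product. Giving each part \<open>j\<close> the weight \<open>exp (- j * t)\<close> makes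
  \<open>card B - card A\<close> have variance about \<open>1 / t\<close>, hence the factor
  \<open>sqrt t\<close> in front of \<open>s\<close>. The exponent
  \<open>pi\<^sup>2 / (6 * t)\<close> has second derivative of order \<open>t ^ (- 3)\<close>, hence
  a peak of width \<open>t powr (3 / 2)\<close> in the angle. Complex \<open>s\<close> is essential:
  Cauchy's formula turns bounds on a complex disc into limits of derivatives, so no moment has to be
  estimated separately.\<close>

text \<open>The triple \<open>(c, A, B)\<close> encodes the sequence with peak \<open>c\<close> whose entries before and after
  the peak form the sets \<open>A\<close> and \<open>B\<close>; its rank is \<open>card B - card A\<close>.\<close>

definition peak_triples :: "nat \<Rightarrow> (nat \<times> nat set \<times> nat set) set" where
  "peak_triples n = {(c, A, B). 1 \<le> c \<and> A \<subseteq> {1..<c} \<and> B \<subseteq> {1..<c} \<and> \<Sum>A + \<Sum>B + c = n}"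

definition twin_peak_triples :: "nat \<Rightarrow> (nat \<times> nat set \<times> nat set) set" where
  "twin_peak_triples n = {(c, A, B). 1 \<le> c \<and> A \<subseteq> {1..<c} \<and> B \<subseteq> {1..<c} \<and> \<Sum>A + \<Sum>B + 2 * c = n}"

definition distinct_pairs :: "nat \<Rightarrow> (nat set \<times> nat set) set" where
  "distinct_pairs n = {(A, B). A \<subseteq> {1..n} \<and> B \<subseteq> {1..n} \<and> \<Sum>A + \<Sum>B = n}"

definition excess :: "nat set \<times> nat set \<Rightarrow> int" where
  "excess p = int (card (snd p)) - int (card (fst p))"

lemma finite_peak_triples [simp]: "finite (peak_triples n)"
proof -
  have "peak_triples n \<subseteq> {..n} \<times> Pow {..n} \<times> Pow {..n}"
    unfolding peak_triples_def by fastforce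
  then show ?thesis by (rule finite_subset) auto
qed

lemma finite_twin_peak_triples [simp]: "finite (twin_peak_triples n)"
proof -
  have "twin_peak_triples n \<subseteq> {..n} \<times> Pow {..n} \<times> Pow {..n}"
    unfolding twin_peak_triples_def by fastforce
  then show ?thesis by (rule finite_subset) auto
qed

lemma finite_distinct_pairs [simp]: "finite (distinct_pairs n)"
proof -
  have "distinct_pairs n \<subseteq> Pow {..n} \<times> Pow {..n}"
    unfolding distinct_pairs_def by fastforce
  then show ?thesis by (rule finite_subset) auto
qed

section \<open>The bijection between sequences and triples\<close>

definition triple_list :: "nat \<times> nat set \<times> nat set \<Rightarrow> nat list" where
  "triple_list = (\<lambda>(c, A, B). sorted_list_of_set A @ c # rev (sorted_list_of_set B))"

lemma sum_list_sorted_list_of_set: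
  "finite A \<Longrightarrow> sum_list (sorted_list_of_set A) = \<Sum>A" for A :: "nat set"
  by (metis distinct_sorted_list_of_set distinct_sum_list_conv_Sum set_sorted_list_of_set)

text \<open>The peak exceeds every other entry, so it is the maximum and occurs once; cutting the
  list there recovers both sets.\<close>

lemma inj_on_triple_list: "inj_on triple_list (peak_triples n)"
proof -
  let ?f = "\<lambda>a. (Max (set a), set (takeWhile (\<lambda>x. x \<noteq> Max (set a)) a),
      set (tl (dropWhile (\<lambda>x. x \<noteq> Max (set a)) a)))"
  have key: "(c, A, B) = ?f a"
    if "(c, A, B) \<in> peak_triples n" "a = triple_list (c, A, B)" for c A B a
  proof -
    from that have A: "A \<subseteq> {1..<c}" and B: "B \<subseteq> {1..<c}" by (auto simp: peak_triples_def)
    have fin: "finite A" "finite B" using A B finite_subset by blast+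
    have a: "a = sorted_list_of_set A @ c # rev (sorted_list_of_set B)"
      using that by (simp add: triple_list_def)
    have "set a = insert c (A \<union> B)" using fin a by auto
    then have M: "Max (set a) = c" using A B fin by (intro Max_eqI) auto
    have ne: "x \<noteq> c" if "x \<in> set (sorted_list_of_set A)" for x using that A fin by auto
    show ?thesis unfolding M using fin ne
      by (auto simp: a takeWhile_append dropWhile_append)
  qed
  then have "?f (triple_list x) = x" if "x \<in> peak_triples n" for x
    using that by (metis surj_pair)
  then show ?thesis by (rule inj_on_inverseI)
qed

text \<open>Uniqueness of the peak position: a wrong \<open>k\<close> puts the largest entry
  \<open>c\<close> strictly inside the decreasing or the increasing part, where its neighbour at
  position \<open>k\<close> would have to exceed it.\<close>

lemma triple_list_unimodal:
  assumes "(c, A, B) \<in> peak_triples n"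
  shows "sum_list (triple_list (c, A, B)) = n"
    "strongly_unimodal_at k (triple_list (c, A, B)) \<longleftrightarrow> k = card A + 1"
    "length (triple_list (c, A, B)) = card A + card B + 1"
proof -
  from assms have A: "A \<subseteq> {1..<c}" and B: "B \<subseteq> {1..<c}" and c: "1 \<le> c" and s: "\<Sum>A + \<Sum>B + c = n"
    by (auto simp: peak_triples_def)
  have fin: "finite A" "finite B" using A B finite_subset by blast+
  let ?a = "sorted_list_of_set A" and ?b = "rev (sorted_list_of_set B)"
  have l: "triple_list (c, A, B) = ?a @ c # ?b" by (simp add: triple_list_def)
  show "sum_list (triple_list (c, A, B)) = n" 
    using s fin by (simp add: l sum_list_sorted_list_of_set sum_list_rev)
  show len: "length (triple_list (c, A, B)) = card A + card B + 1"
    by (simp add: l)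
  have la: "length ?a = card A" by simp
  have incr: "sorted_wrt (<) (?a @ [c])" 
    using A fin by (auto simp: sorted_wrt_append)
  have decr: "sorted_wrt (>) (c # ?b)"
    using B fin by (auto simp: sorted_wrt_rev)
  show "strongly_unimodal_at k (triple_list (c, A, B)) \<longleftrightarrow> k = card A + 1"
  proof
    assume "k = card A + 1"
    then show "strongly_unimodal_at k (triple_list (c, A, B))"
      using incr decr A B fin c unfolding strongly_unimodal_at_def l by (auto simp: la)
  next
    assume su: "strongly_unimodal_at k (triple_list (c, A, B))"
    define L where "L = triple_list (c, A, B)"
    have k: "1 \<le> k" "k \<le> length L" "sorted_wrt (<) (take k L)" "sorted_wrt (>) (drop (k - 1) L)"
      using su by (auto simp: strongly_unimodal_at_def L_def)
    have Lc: "L ! card A = c" by (simp add: L_def l nth_append)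
    have less: "i < length L \<Longrightarrow> i \<noteq> card A \<Longrightarrow> L ! i < c" for i
      using A B fin nth_mem[of i ?a] nth_mem[of "i - card A - 1" ?b]
      by (auto simp: L_def l nth_append nth_Cons' subset_iff)
    have lenL: "length L = card A + card B + 1" using len L_def by simp
    show "k = card A + 1"
    proof (rule ccontr)
      assume ne: "k \<noteq> card A + 1"
      then consider "k - 1 < card A" | "card A < k - 1" using k(1) by linarith
      then show False
      proof cases
        case 1
        have "drop (k-1) L ! 0 > drop (k-1) L ! (card A - (k-1))"
          using k(4) 1 lenL by (intro sorted_wrt_nth_less[OF k(4)]) auto
        then have "L ! (k - 1) > c" using 1 lenL Lc k by (simp add: nth_drop)
        moreover have "L ! (k-1) < c" using less[of "k-1"] k 1 by simp
        ultimately show False by simp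
      next
        case 2
        have "take k L ! (card A) < take k L ! (k - 1)"
          using k 2 lenL by (intro sorted_wrt_nth_less[OF k(3)]) auto
        then have "c < L ! (k - 1)" using 2 k lenL Lc by simp
        moreover have "L ! (k-1) < c" using less[of "k-1"] k 2 by simp
        ultimately show False by simp
      qed
    qed
  qed
qed

text \<open>A strictly monotone list is determined by the set of its entries, so storing the two
  flanks as sets loses nothing.\<close>

lemma unimodal_triple_list:
  assumes "strongly_unimodal_at k a" "sum_list a = n"
  shows "\<exists>x \<in> peak_triples n. a = triple_list x"
proof -
  have k: "1 \<le> k" "k \<le> length a" "sorted_wrt (<) (take k a)" "sorted_wrt (>) (drop (k - 1) a)"
    and pos: "\<forall>x \<in> set a. 0 < x"
    using assms by (auto simp: strongly_unimodal_at_def)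
  define c where "c = a ! (k - 1)"
  let ?A = "take (k-1) a" and ?B = "drop k a"
  have tk: "take k a = ?A @ [c]" using k unfolding c_def
    by (metis Suc_diff_1 Suc_le_eq less_le_trans take_Suc_conv_app_nth zero_less_one diff_less le_trans)
  have dk: "drop (k-1) a = c # ?B" using k unfolding c_def
    by (metis Cons_nth_drop_Suc Suc_diff_1 Suc_le_eq diff_less less_le_trans zero_less_one)
  have a: "a = ?A @ c # ?B" by (metis append_take_drop_id dk)
  have sA: "sorted_wrt (<) ?A" "\<forall>x\<in>set ?A. x < c" using k(3) unfolding tk by (auto simp: sorted_wrt_append)
  have sB: "sorted_wrt (>) ?B" "\<forall>x\<in>set ?B. x < c" using k(4) unfolding dk by auto
  have lA: "sorted_list_of_set (set ?A) = ?A"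
    using sA(1) sorted_list_of_set.idem_if_sorted_distinct strict_sorted_iff by blast
  have "sorted_wrt (<) (rev ?B)" using sB(1) by (simp add: sorted_wrt_rev)
  then have "sorted_list_of_set (set (rev ?B)) = rev ?B"
    using sorted_list_of_set.idem_if_sorted_distinct strict_sorted_iff by blast
  then have lB: "rev (sorted_list_of_set (set ?B)) = ?B" by simp
  have *: "a = triple_list (c, set ?A, set ?B)" unfolding triple_list_def using a lA lB by simp
  have c0: "c > 0" using pos a by (metis in_set_conv_decomp)
  have SA: "\<Sum>(set ?A) = sum_list ?A" using sum_list_sorted_list_of_set[of "set ?A"] lA by simp
  have SB: "\<Sum>(set ?B) = sum_list ?B" using sum_list_sorted_list_of_set[of "set ?B"] lB
    by (metis List.finite_set sum_list_rev)
  have "sum_list a = sum_list ?A + c + sum_list ?B" by (subst a) simp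
  then have "(c, set ?A, set ?B) \<in> peak_triples n"
    unfolding peak_triples_def using sA sB c0 SA SB assms pos
    by (auto simp: Suc_le_eq dest: in_set_takeD in_set_dropD)
  with * show ?thesis by blast
qed

lemma u_eq_card: "u m n = card {x \<in> peak_triples n. excess (snd x) = m}"
proof -
  have "bij_betw triple_list {x \<in> peak_triples n. excess (snd x) = m}
     {a. sum_list a = n \<and> (\<exists>k. strongly_unimodal_at k a \<and> int (length a) - 2 * int k + 1 = m)}"
    unfolding bij_betw_def
  proof
    show "inj_on triple_list {x \<in> peak_triples n. excess (snd x) = m}"
      using inj_on_triple_list by (rule inj_on_subset) auto
    have 1: "sum_list (triple_list x) = n \<and> (\<exists>k. strongly_unimodal_at k (triple_list x)
         \<and> int (length (triple_list x)) - 2 * int k + 1 = m)"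
      if "x \<in> peak_triples n" "excess (snd x) = m" for x
      using that by (cases x) (auto simp: triple_list_unimodal excess_def)
    have 2: "a \<in> triple_list ` {x \<in> peak_triples n. excess (snd x) = m}"
      if h: "sum_list a = n" "strongly_unimodal_at k a" "int (length a) - 2 * int k + 1 = m" for a k
    proof -
      obtain x where x: "x \<in> peak_triples n" "a = triple_list x"
        using unimodal_triple_list[OF h(2,1)] by blast
      obtain c A B where "x = (c, A, B)" by (cases x)
      then have "excess (snd x) = m"
        using h x triple_list_unimodal[of c A B n] by (auto simp: excess_def)
      with x show ?thesis by blast
    qed
    show "triple_list ` {x \<in> peak_triples n. excess (snd x) = m}
       = {a. sum_list a = n \<and> (\<exists>k. strongly_unimodal_at k a \<and> int (length a) - 2 * int k + 1 = m)}"
      using 1 2 by blast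
  qed
  from bij_betw_same_card[OF this] show ?thesis by (simp add: u_def)
qed

lemma u_moment_eq: "u_moment r n = (\<Sum>x\<in>peak_triples n. real_of_int (excess (snd x)) ^ r)"
proof -
  let ?e = "\<lambda>x. excess (snd x)"
  let ?M = "?e ` peak_triples n"
  \<comment> \<open>Ranks that no triple attains contribute 0, which reduces the infinite sum to the
    finite set of attained ranks.\<close>
  have "u_moment r n = (\<Sum>\<^sub>\<infinity>m\<in>?M. of_int m ^ r * real (u m n))"
    unfolding u_moment_def
  proof (intro infsum_cong_neutral)
    fix m assume "m \<in> UNIV - ?M"
    then have "{x \<in> peak_triples n. ?e x = m} = {}" by blast
    then show "of_int m ^ r * real (u m n) = 0" by (simp add: u_eq_card)
  qed auto
  also have "\<dots> = (\<Sum>m\<in>?M. of_int m ^ r * real (u m n))" by (rule infsum_finite) auto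
  also have "\<dots> = (\<Sum>m\<in>?M. \<Sum>x\<in>{x \<in> peak_triples n. ?e x = m}. real_of_int (?e x) ^ r)"
    by (intro sum.cong) (auto simp: u_eq_card)
  also have "\<dots> = (\<Sum>x\<in>peak_triples n. real_of_int (?e x) ^ r)"
    by (rule sum.group) auto
  finally show ?thesis .
qed

section \<open>Removing the largest part of a pair, and raising the peak of a triple\<close>

text \<open>Remove the largest element of \<open>A \<union> B\<close>: it belongs to \<open>A\<close> only, to \<open>B\<close> only, or to both.\<close>

lemma sum_distinct_pairs:
  fixes f :: "int \<Rightarrow> real"
  assumes n: "0 < n"
  shows "(\<Sum>p\<in>distinct_pairs n. f (excess p)) =
    (\<Sum>x\<in>peak_triples n. f (excess (snd x) + 1) + f (excess (snd x) - 1)) +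
    (\<Sum>x\<in>twin_peak_triples n. f (excess (snd x)))"
proof -
  \<comment> \<open>One left inverse serves all three insertions: delete the maximum of the union
    from both sets.\<close>
  define g where "g = (\<lambda>(A, B). let M = Max (A \<union> B) in (M, A - {M}, B - {M :: nat}))"
  define hl hr hb :: "nat \<times> nat set \<times> nat set \<Rightarrow> nat set \<times> nat set"
    where "hl = (\<lambda>(c, A, B). (insert c A, B))" and "hr = (\<lambda>(c, A, B). (A, insert c B))"
      and "hb = (\<lambda>(c, A, B). (insert c A, insert c B))"
  have fin: "finite A" if "A \<subseteq> {1..<c}" for A and c :: nat using that finite_subset by blast
  have M: "Max (insert c (A \<union> B)) = c" if "A \<subseteq> {1..<c}" "B \<subseteq> {1..<c}" for A B and c :: nat
    using that fin by (intro Max_eqI) auto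
  have M': "Max (insert c A \<union> B) = c" "Max (A \<union> insert c B) = c" "Max (insert c A \<union> insert c B) = c"
    if "A \<subseteq> {1..<c}" "B \<subseteq> {1..<c}" for A B and c :: nat
    using M[OF that] by (simp_all add: Un_commute Un_left_commute)
  have notin: "c \<notin> A" if "A \<subseteq> {1..<c}" for A and c :: nat using that by auto
  have g: "g (hl x) = x" "g (hr x) = x" if "x \<in> peak_triples n" for x
  proof -
    obtain c A B where x: "x = (c, A, B)" "A \<subseteq> {1..<c}" "B \<subseteq> {1..<c}"
      using \<open>x \<in> peak_triples n\<close> by (auto simp: peak_triples_def)
    show "g (hl x) = x" "g (hr x) = x"
      using M'[OF x(2,3)] notin[OF x(2)] notin[OF x(3)] by (simp_all add: g_def hl_def hr_def Let_def x(1))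
  qed
  have gb: "g (hb x) = x" if "x \<in> twin_peak_triples n" for x
  proof -
    obtain c A B where x: "x = (c, A, B)" "A \<subseteq> {1..<c}" "B \<subseteq> {1..<c}"
      using \<open>x \<in> twin_peak_triples n\<close> by (auto simp: twin_peak_triples_def)
    show "g (hb x) = x"
      using M'[OF x(2,3)] notin[OF x(2)] notin[OF x(3)] by (simp_all add: g_def hb_def Let_def x(1))
  qed
  have inj: "inj_on hl (peak_triples n)" "inj_on hr (peak_triples n)" "inj_on hb (twin_peak_triples n)"
    by (metis g gb inj_onI)+
  have sl: "Max (fst p \<union> snd p) \<in> fst p \<and> Max (fst p \<union> snd p) \<notin> snd p" if "p \<in> hl ` peak_triples n" for p
    using that by (auto simp: hl_def peak_triples_def M' dest: notin simp del: One_nat_def Un_insert_left Un_insert_right)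
  have sr: "Max (fst p \<union> snd p) \<notin> fst p \<and> Max (fst p \<union> snd p) \<in> snd p" if "p \<in> hr ` peak_triples n" for p
    using that by (auto simp: hr_def peak_triples_def M' dest: notin simp del: One_nat_def Un_insert_left Un_insert_right)
  have sb: "Max (fst p \<union> snd p) \<in> fst p \<and> Max (fst p \<union> snd p) \<in> snd p" if "p \<in> hb ` twin_peak_triples n" for p
    using that by (auto simp: hb_def twin_peak_triples_def M' dest: notin simp del: One_nat_def Un_insert_left Un_insert_right)
  have disj: "hl ` peak_triples n \<inter> hr ` peak_triples n = {}"
     "(hl ` peak_triples n \<union> hr ` peak_triples n) \<inter> hb ` twin_peak_triples n = {}"
    using sl sr sb by blast+
  have sub: "A \<subseteq> {1..n}" if "A \<subseteq> {1..<c}" "c \<le> n" for A and c :: nat using that by fastforce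
  have "distinct_pairs n \<subseteq> hl ` peak_triples n \<union> hr ` peak_triples n \<union> hb ` twin_peak_triples n"
  proof
    fix p assume p: "p \<in> distinct_pairs n"
    obtain A B where AB: "p = (A, B)" by (cases p)
    from p AB have A: "A \<subseteq> {1..n}" and B: "B \<subseteq> {1..n}" and s: "\<Sum>A + \<Sum>B = n"
      by (auto simp: distinct_pairs_def)
    have fin': "finite A" "finite B" using A B finite_subset by blast+
    define M where "M = Max (A \<union> B)"
    \<comment> \<open>Positivity of \<open>n\<close> enters here: the pair of empty sets has no
      largest element.\<close>
    have "A \<union> B \<noteq> {}" using s n by auto
    then have Min: "M \<in> A \<union> B" unfolding M_def using fin' by (intro Max_in) auto
    have Mge: "x \<le> M" if "x \<in> A \<union> B" for x unfolding M_def using fin' that by (intro Max_ge) auto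
    let ?A = "A - {M}" and ?B = "B - {M}"
    have AM: "?A \<subseteq> {1..<M}" using A Mge by (auto simp: less_le)
    have BM: "?B \<subseteq> {1..<M}" using B Mge by (auto simp: less_le)
    have M1: "1 \<le> M" using Min A B by auto
    have sA: "M \<in> A \<Longrightarrow> \<Sum>A = M + \<Sum>?A" and sB: "M \<in> B \<Longrightarrow> \<Sum>B = M + \<Sum>?B"
      using fin' by (auto simp: sum.remove)
    consider "M \<in> A" "M \<notin> B" | "M \<notin> A" "M \<in> B" | "M \<in> A" "M \<in> B" using Min by blast
    then show "p \<in> hl ` peak_triples n \<union> hr ` peak_triples n \<union> hb ` twin_peak_triples n"
    proof cases
      case 1
      then have "(M, ?A, ?B) \<in> peak_triples n" "p = hl (M, ?A, ?B)"
        using AM BM M1 s sA by (auto simp: peak_triples_def AB hl_def insert_absorb)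
      then show ?thesis by blast
    next
      case 2
      then have "(M, ?A, ?B) \<in> peak_triples n" "p = hr (M, ?A, ?B)"
        using AM BM M1 s sB by (auto simp: peak_triples_def AB hr_def insert_absorb)
      then show ?thesis by blast
    next
      case 3
      then have "(M, ?A, ?B) \<in> twin_peak_triples n" "p = hb (M, ?A, ?B)"
        using AM BM M1 s sA sB by (auto simp: twin_peak_triples_def AB hb_def insert_absorb)
      then show ?thesis by blast
    qed
  qed
  moreover have "hl ` peak_triples n \<subseteq> distinct_pairs n" "hr ` peak_triples n \<subseteq> distinct_pairs n"
    "hb ` twin_peak_triples n \<subseteq> distinct_pairs n"
  proof -
    have ins: "\<Sum>(insert c A) = c + \<Sum>A" if "A \<subseteq> {1..<c}" for A and c :: nat
      using fin[OF that] notin[OF that] by simp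
    have si: "insert c A \<subseteq> {1..n}" if "A \<subseteq> {1..<c}" "c \<le> n" "1 \<le> c" for A and c :: nat
      using sub[OF that(1,2)] that by auto
    have "hl x \<in> distinct_pairs n \<and> hr x \<in> distinct_pairs n" if px: "x \<in> peak_triples n" for x
    proof -
      obtain c A B where x: "x = (c, A, B)" "A \<subseteq> {1..<c}" "B \<subseteq> {1..<c}" "1 \<le> c" "\<Sum>A + \<Sum>B + c = n"
        using px by (auto simp: peak_triples_def)
      then have "c \<le> n" by simp
      show ?thesis using ins[OF x(2)] ins[OF x(3)] si[OF x(2) \<open>c \<le> n\<close> x(4)] si[OF x(3) \<open>c \<le> n\<close> x(4)]
          sub[OF x(2) \<open>c \<le> n\<close>] sub[OF x(3) \<open>c \<le> n\<close>] x(5)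
        by (simp add: x(1) hl_def hr_def distinct_pairs_def)
    qed
    moreover have "hb x \<in> distinct_pairs n" if px: "x \<in> twin_peak_triples n" for x
    proof -
      obtain c A B where x: "x = (c, A, B)" "A \<subseteq> {1..<c}" "B \<subseteq> {1..<c}" "1 \<le> c" "\<Sum>A + \<Sum>B + 2 * c = n"
        using px by (auto simp: twin_peak_triples_def)
      then have "c \<le> n" by simp
      show ?thesis using ins[OF x(2)] ins[OF x(3)] si[OF x(2) \<open>c \<le> n\<close> x(4)] si[OF x(3) \<open>c \<le> n\<close> x(4)] x(5)
        by (simp add: x(1) hb_def distinct_pairs_def)
    qed
    ultimately show "hl ` peak_triples n \<subseteq> distinct_pairs n" "hr ` peak_triples n \<subseteq> distinct_pairs n"
      "hb ` twin_peak_triples n \<subseteq> distinct_pairs n" by blast+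
  qed
  ultimately have D: "distinct_pairs n = hl ` peak_triples n \<union> hr ` peak_triples n \<union> hb ` twin_peak_triples n"
    by blast
  have e: "excess (hl x) = excess (snd x) - 1" "excess (hr x) = excess (snd x) + 1" if "x \<in> peak_triples n" for x
    using that by (auto simp: hl_def hr_def peak_triples_def excess_def fin notin simp del: One_nat_def)
  have eb: "excess (hb x) = excess (snd x)" if "x \<in> twin_peak_triples n" for x
    using that by (auto simp: hb_def twin_peak_triples_def excess_def fin notin simp del: One_nat_def)
  show ?thesis
    unfolding D using disj e eb
    by (simp add: sum.union_disjoint sum.reindex inj sum.distrib)
qed

text \<open>Raise the peak by one; if both sets of a twin-peak triple contain \<open>c\<close>, raise one of the two.
  The remaining triples, with \<open>c - 1\<close> in both sets, are dropped, hence the inequality.\<close>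

lemma sum_peak_triples_Suc_ge:
  fixes f :: "int \<Rightarrow> real"
  assumes f: "\<And>m. 0 \<le> f m" 
  shows "(\<Sum>x\<in>peak_triples n. f (excess (snd x))) +
    (\<Sum>x\<in>twin_peak_triples n. f (excess (snd x) + 1) + f (excess (snd x) - 1))
    \<le> (\<Sum>x\<in>peak_triples (Suc n). f (excess (snd x)))"
proof -
  \<comment> \<open>Again one left inverse for all three maps: lower the peak by one and delete the
    lowered value from both sets.\<close>
  define g where "g = (\<lambda>(c, A, B). (c - 1, A - {c - 1}, B - {c - 1 :: nat}))"
  define h hl hr :: "nat \<times> nat set \<times> nat set \<Rightarrow> nat \<times> nat set \<times> nat set"
    where "h = (\<lambda>(c, A, B). (Suc c, A, B))" and "hl = (\<lambda>(c, A, B). (Suc c, insert c A, B))"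
      and "hr = (\<lambda>(c, A, B). (Suc c, A, insert c B))"
  have fin: "finite A" if "A \<subseteq> {1..<c}" for A and c :: nat using that finite_subset by blast
  have notin: "c \<notin> A" if "A \<subseteq> {1..<c}" for A and c :: nat using that by auto
  have g: "g (h x) = x" if "x \<in> peak_triples n" for x
    using that by (auto simp: g_def h_def peak_triples_def)
  have g': "g (hl x) = x" "g (hr x) = x" if "x \<in> twin_peak_triples n" for x
    using that by (auto simp: g_def hl_def hr_def twin_peak_triples_def)
  have inj: "inj_on h (peak_triples n)" "inj_on hl (twin_peak_triples n)" "inj_on hr (twin_peak_triples n)"
    by (metis g g' inj_onI)+
  \<comment> \<open>For a peak \<open>Suc c\<close> in the image, the three maps differ in where
    \<open>c\<close> lies: in neither set, in the first only, or in the second only.\<close>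
  have disj: "h ` peak_triples n \<inter> hl ` twin_peak_triples n = {}"
    "(h ` peak_triples n \<union> hl ` twin_peak_triples n) \<inter> hr ` twin_peak_triples n = {}"
    by (auto simp: h_def hl_def hr_def peak_triples_def twin_peak_triples_def dest: notin simp del: One_nat_def)
  have sub: "A \<subseteq> {1..<Suc c}" if "A \<subseteq> {1..<c}" for A and c :: nat using that by fastforce
  have "h x \<in> peak_triples (Suc n)" if "x \<in> peak_triples n" for x
    using that sub by (auto simp: h_def peak_triples_def)
  moreover have "hl x \<in> peak_triples (Suc n)" "hr x \<in> peak_triples (Suc n)" if "x \<in> twin_peak_triples n" for x
    using that sub by (auto simp: hl_def hr_def peak_triples_def twin_peak_triples_def fin notin simp del: One_nat_def)
  ultimately have S: "h ` peak_triples n \<union> hl ` twin_peak_triples n \<union> hr ` twin_peak_triples n \<subseteq> peak_triples (Suc n)"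
    by blast
  have e: "excess (snd (h x)) = excess (snd x)" for x by (simp add: h_def case_prod_unfold)
  have e': "excess (snd (hl x)) = excess (snd x) - 1" "excess (snd (hr x)) = excess (snd x) + 1"
    if "x \<in> twin_peak_triples n" for x
    using that by (auto simp: hl_def hr_def twin_peak_triples_def excess_def fin notin simp del: One_nat_def)
  have "(\<Sum>x\<in>peak_triples n. f (excess (snd x))) +
    (\<Sum>x\<in>twin_peak_triples n. f (excess (snd x) + 1) + f (excess (snd x) - 1))
    = (\<Sum>x\<in>h ` peak_triples n \<union> hl ` twin_peak_triples n \<union> hr ` twin_peak_triples n. f (excess (snd x)))"
    using disj by (simp add: sum.union_disjoint sum.reindex inj sum.distrib e e')
  also have "\<dots> \<le> (\<Sum>x\<in>peak_triples (Suc n). f (excess (snd x)))"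
    using f S by (intro sum_mono2) auto
  finally show ?thesis .
qed

section \<open>The function \<open>ln (1 + exp (- z))\<close> on a sector\<close>

text \<open>The logarithm of the factor of the distinct-partition product belonging to
  \<open>z = j * t\<close>, followed by its first three derivatives in closed form.
  \<open>softplus2\<close> has a second role: it is the coefficient through which the rank variable
  enters each factor in \<open>pair_gf_eq\<close>.\<close>

definition softplus :: "complex \<Rightarrow> complex" where "softplus z = ln (1 + exp (- z))"
definition softplus1 :: "complex \<Rightarrow> complex" where "softplus1 z = - (exp (- z) / (1 + exp (- z)))"
definition softplus2 :: "complex \<Rightarrow> complex" where "softplus2 z = exp (- z) / (1 + exp (- z)) ^ 2"
definition softplus3 :: "complex \<Rightarrow> complex" where
  "softplus3 z = - (exp (- z) * (1 - exp (- z)) / (1 + exp (- z)) ^ 3)"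

text \<open>On the closed sector the derivatives of \<open>softplus\<close> decay exponentially. The open convex
  neighbourhood \<open>wide_sector\<close> contains the vertex \<open>0\<close> and supports a primitive.\<close>

definition wide_sector :: "complex set" where "wide_sector = {z. \<bar>Im z\<bar> < Re z + 1}"
definition sector :: "complex set" where "sector = {z. \<bar>Im z\<bar> \<le> Re z}"

lemma sector_subset_wide_sector: "z \<in> sector \<Longrightarrow> z \<in> wide_sector"
  by (auto simp: sector_def wide_sector_def)

lemma wide_sector_eq: "wide_sector = {z. Im z - Re z < 1} \<inter> {z. - Im z - Re z < 1}"
  by (auto simp: wide_sector_def abs_if)

lemma open_wide_sector: "open wide_sector"
  unfolding wide_sector_eq by (intro open_Int open_Collect_less continuous_intros)

lemma convex_wide_sector: "convex wide_sector"
proof -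
  have *: "wide_sector = {z. inner (\<i> - 1) z < 1} \<inter> {z. inner (- \<i> - 1) z < 1}"
    by (auto simp: wide_sector_eq inner_complex_def)
  show ?thesis unfolding * by (intro convex_Int convex_halfspace_lt)
qed

lemma convex_sector: "convex sector"
proof -
  have *: "sector = {z. inner (\<i> - 1) z \<le> 0} \<inter> {z. inner (- \<i> - 1) z \<le> 0}"
    by (auto simp: sector_def inner_complex_def abs_if)
  show ?thesis unfolding * by (intro convex_Int convex_halfspace_le)
qed

text \<open>Keeps \<open>ln\<close> on its principal branch. Left of the imaginary axis the
  imaginary part is below \<open>1 < pi / 2\<close>, so the cosine is positive; right of it the
  exponential has modulus below 1.\<close>

lemma Re_one_plus_exp_pos:
  assumes "z \<in> wide_sector" shows "0 < Re (1 + exp (- z))"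
proof (cases "Re z \<le> 0")
  case True
  then have "\<bar>Im z\<bar> < 1" using assms by (auto simp: wide_sector_def)
  then have "0 < cos (Im z)" using pi_gt3 by (intro cos_gt_zero_pi) auto
  then show ?thesis by (simp add: Re_exp add_pos_pos)
next
  case False
  then have "cmod (exp (- z)) < 1" by simp
  then have "\<bar>Re (exp (- z))\<bar> < 1" using abs_Re_le_cmod[of "exp (- z)"] by linarith
  then show ?thesis by simp
qed

text \<open>Near the vertex the cosine is positive; farther out the exponential is at most
  \<open>exp (- 1) \<le> 1 / 2\<close>. The constants \<open>4 = 2\<^sup>2\<close> and
  \<open>16 = 2 * 2 ^ 3\<close> in the derivative bounds come from this
  \<open>1 / 2\<close>.\<close>

lemma norm_one_plus_exp_ge:
  assumes "z \<in> sector" shows "1 / 2 \<le> cmod (1 + exp (- z))"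
proof (cases "Re z \<le> 1")
  case True
  then have "\<bar>Im z\<bar> \<le> 1" using assms by (auto simp: sector_def)
  then have "0 < cos (Im z)" using pi_gt3 by (intro cos_gt_zero_pi) auto
  then have "1 \<le> Re (1 + exp (- z))" by (simp add: Re_exp)
  then show ?thesis using complex_Re_le_cmod[of "1 + exp (- z)"] by linarith
next
  case False
  then have "exp (- Re z) \<le> exp (-1)" by simp
  also have "exp (-1) \<le> (1/2 :: real)" using exp_ge_add_one_self[of "1::real"]
    by (simp add: exp_minus field_simps)
  finally have "cmod (exp (- z)) \<le> 1 / 2" by simp
  then show ?thesis using norm_diff_ineq[of 1 "exp (- z)"] by simp
qed

lemma one_plus_exp_neq_0: "z \<in> wide_sector \<Longrightarrow> 1 + exp (- z) \<noteq> 0"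
  using Re_one_plus_exp_pos[of z] by (metis less_irrefl zero_complex.sel(1))

lemma has_field_derivative_softplus:
  assumes "z \<in> wide_sector"
  shows "(softplus has_field_derivative softplus1 z) (at z)"
    and "(softplus1 has_field_derivative softplus2 z) (at z)"
    and "(softplus2 has_field_derivative softplus3 z) (at z)"
proof -
  note ne = one_plus_exp_neq_0[OF assms]
  have "1 + exp (- z) \<notin> \<real>\<^sub>\<le>\<^sub>0" using Re_one_plus_exp_pos[OF assms]
    by (metis complex_nonpos_Reals_iff not_less)
  then show "(softplus has_field_derivative softplus1 z) (at z)"
    unfolding softplus_def[abs_def] softplus1_def
    by (auto intro!: derivative_eq_intros simp: field_simps)
  \<comment> \<open>The quotient rule leaves a common factor \<open>1 + E\<close>, which has to be
    cancelled.\<close>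
  have alg: "(- E * (1 + E)\<^sup>2 - E * (2 * (1 + E) * (- E))) / ((1 + E)\<^sup>2 * (1 + E)\<^sup>2) = - (E * (1 - E) / (1 + E) ^ 3)"
    if "1 + E \<noteq> 0" for E :: complex
  proof -
    have "- E * (1 + E)\<^sup>2 - E * (2 * (1 + E) * (- E)) = - (E * (1 - E)) * (1 + E)"
      by (simp add: algebra_simps power2_eq_square)
    moreover have "(1 + E)\<^sup>2 * (1 + E)\<^sup>2 = (1 + E) ^ 3 * (1 + E)"
      by (simp add: eval_nat_numeral mult.assoc)
    ultimately show ?thesis using that by simp
  qed
  have "((\<lambda>z. exp (- z)) has_field_derivative - exp (- z)) (at z)"
    by (auto intro!: derivative_eq_intros)
  moreover have "((\<lambda>z. (1 + exp (- z))\<^sup>2) has_field_derivative 2 * (1 + exp (- z)) * (- exp (- z))) (at z)"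
    by (auto intro!: derivative_eq_intros)
  moreover have "((\<lambda>z. 1 + exp (- z)) has_field_derivative - exp (- z)) (at z)"
    by (auto intro!: derivative_eq_intros)
  ultimately have "((\<lambda>z. exp (- z) / (1 + exp (- z))) has_field_derivative
      (- exp (- z) * (1 + exp (- z)) - exp (- z) * (- exp (- z)))
      / ((1 + exp (- z)) * (1 + exp (- z)))) (at z)"
    and "((\<lambda>z. exp (- z) / (1 + exp (- z))\<^sup>2) has_field_derivative
      (- exp (- z) * (1 + exp (- z))\<^sup>2 - exp (- z) * (2 * (1 + exp (- z)) * (- exp (- z))))
      / ((1 + exp (- z))\<^sup>2 * (1 + exp (- z))\<^sup>2)) (at z)"
    using ne by (intro DERIV_divide; simp)+
  then show "(softplus1 has_field_derivative softplus2 z) (at z)"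
    and "(softplus2 has_field_derivative softplus3 z) (at z)"
    unfolding softplus1_def[abs_def] softplus2_def[abs_def] softplus3_def alg[OF ne]
    by (auto dest: DERIV_minus simp: algebra_simps power2_eq_square)
qed

lemma norm_softplus2_le: "z \<in> sector \<Longrightarrow> cmod (softplus2 z) \<le> 4 * exp (- Re z)"
proof -
  assume "z \<in> sector"
  then have "(1 / 2)\<^sup>2 \<le> (cmod (1 + exp (- z)))\<^sup>2" by (intro power_mono norm_one_plus_exp_ge) auto
  then have "exp (- Re z) / (cmod (1 + exp (- z)))\<^sup>2 \<le> exp (- Re z) / (1 / 2)\<^sup>2"
    by (intro divide_left_mono) (auto simp: power2_eq_square intro!: mult_pos_pos)
  then show ?thesis unfolding softplus2_def norm_divide norm_power by (simp add: power2_eq_square)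
qed

lemma norm_softplus3_le: "z \<in> sector \<Longrightarrow> cmod (softplus3 z) \<le> 16 * exp (- Re z)"
proof -
  assume z: "z \<in> sector"
  then have 1: "(1 / 2) ^ 3 \<le> (cmod (1 + exp (- z))) ^ 3" by (intro power_mono norm_one_plus_exp_ge) auto
  have "exp (- Re z) \<le> 1" using z by (auto simp: sector_def)
  then have "cmod (1 - exp (- z)) \<le> 2" using norm_triangle_ineq4[of 1 "exp (- z)"]
    unfolding norm_exp_eq_Re norm_one uminus_complex.sel by linarith
  then have "cmod (exp (- z) * (1 - exp (- z))) \<le> exp (- Re z) * 2"
    by (simp add: norm_mult)
  then have "cmod (exp (- z) * (1 - exp (- z))) / (cmod (1 + exp (- z))) ^ 3 \<le> (exp (- Re z) * 2) / (1 / 2) ^ 3"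
    using 1 by (intro frac_le) auto
  then show ?thesis by (simp add: softplus3_def norm_divide norm_power power3_eq_cube norm_mult)
qed

section \<open>A primitive of \<open>softplus\<close> and its value at the vertex\<close>

text \<open>Starting at 0 is possible because \<open>1 / 0 = 0\<close>; it lets the series be used
  as power series coefficients.\<close>

lemma inverse_squares_sums_from_0: "(\<lambda>n. 1 / (real n)\<^sup>2) sums (pi\<^sup>2 / 6)"
proof -
  have "(\<lambda>n. 1 / (real (Suc n))\<^sup>2) sums (pi\<^sup>2 / 6)"
    using inverse_squares_sums unfolding Suc_eq_plus1 of_nat_power .
  from sums_Suc[OF this] show ?thesis by simp
qed

text \<open>Twice the sum over even \<open>n\<close> minus the full sum, that is
  \<open>pi\<^sup>2 / 12 - pi\<^sup>2 / 6\<close>.\<close>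

lemma alternating_inverse_squares_sums: "(\<lambda>n. (-1) ^ n / (real n)\<^sup>2) sums (- (pi\<^sup>2 / 12))"
proof -
  note s = inverse_squares_sums_from_0
  have "(\<lambda>n. if even n then 2 * (1 / (2 * real (n div 2))\<^sup>2) else 0) sums (0 + 2 * (pi\<^sup>2 / 24))"
    using sums_if[OF sums_zero, of "\<lambda>n. 2 * (1 / (2 * real n)\<^sup>2)" "2 * (pi\<^sup>2 / 24)"]
      sums_mult[OF s, of "1 / 2"] by (simp add: power2_eq_square field_simps)
  from sums_diff[OF this s]
  have "(\<lambda>n. (if even n then 2 * (1 / (2 * real (n div 2))\<^sup>2) else 0) - 1 / (real n)\<^sup>2) sums (- (pi\<^sup>2 / 12))"
    by simp
  moreover have "(if even n then 2 * (1 / (2 * real (n div 2))\<^sup>2) else 0) - 1 / (real n)\<^sup>2 = (-1) ^ n / (real n)\<^sup>2" for n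
    by (cases "even n") (auto elim!: evenE)
  ultimately show ?thesis by simp
qed

text \<open>On the right half-plane the primitive is the dilogarithm series \<open>\<Sum>n. (-1) ^ n * exp (- n * z) / n\<^sup>2\<close>.\<close>

lemma softplus_primitive:
  obtains G where "\<And>z. z \<in> wide_sector \<Longrightarrow> (G has_field_derivative softplus z) (at z)"
    and "G 0 = - of_real (pi\<^sup>2 / 12)"
    and "\<And>z. z \<in> wide_sector \<Longrightarrow> 0 < Re z \<Longrightarrow> cmod (G z) \<le> 2 * exp (- Re z)"
proof -
  have hol: "softplus holomorphic_on wide_sector"
    using has_field_derivative_softplus(1) open_wide_sector
    by (auto simp: holomorphic_on_open)
  \<comment> \<open>The series lives only on \<open>0 < Re z\<close>, so a primitive that is
    differentiable at the vertex is obtained from convexity and matched with the series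
    afterwards.\<close>
  obtain G0 where G0: "(G0 has_field_derivative softplus z) (at z)" if "z \<in> wide_sector" for z
    using holomorphic_convex_primitive'[OF convex_wide_sector open_wide_sector hol]
    by (metis at_within_open open_wide_sector)
  define c :: "nat \<Rightarrow> complex" where "c n = (-1) ^ n / (of_nat n)\<^sup>2" for n
  define F where "F w = (\<Sum>n. c n * w ^ n)" for w
  have c_norm: "cmod (c n * w ^ n) \<le> 1 / (real n)\<^sup>2 * cmod w" if "cmod w \<le> 1" for n w
  proof (cases "n = 0")
    case False
    have "cmod w ^ n \<le> cmod w ^ 1" using that False by (intro power_decreasing) auto
    then show ?thesis by (simp add: c_def norm_mult norm_divide norm_power divide_right_mono)
  qed (simp add: c_def)
  note inv_sums = inverse_squares_sums_from_0
  have inv_summable: "summable (\<lambda>n. 1 / (real n)\<^sup>2 * r)" for r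
    using inv_sums by (intro summable_mult2 sums_summable)
  have c_summable: "summable (\<lambda>n. cmod (c n * w ^ n))" if w: "cmod w \<le> 1" for w
  proof (rule summable_comparison_test[OF _ inv_summable])
    show "\<exists>N. \<forall>n\<ge>N. norm (cmod (c n * w ^ n)) \<le> 1 / (real n)\<^sup>2 * cmod w"
      using c_norm[OF w] by auto
  qed
  have F_bound: "cmod (F w) \<le> 2 * cmod w" if "cmod w \<le> 1" for w
  proof -
    have "cmod (F w) \<le> (\<Sum>n. cmod (c n * w ^ n))"
      unfolding F_def by (rule summable_norm[OF c_summable[OF that]])
    also have "\<dots> \<le> (\<Sum>n. 1 / (real n)\<^sup>2 * cmod w)"
      by (rule suminf_le[OF c_norm[OF that] c_summable[OF that] inv_summable])
    also have "\<dots> = pi\<^sup>2 / 6 * cmod w"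
      by (rule sums_unique[symmetric, OF sums_mult2[OF inv_sums]])
    also have "\<dots> \<le> 2 * cmod w"
    proof (rule mult_right_mono)
      have "pi\<^sup>2 \<le> 3.2\<^sup>2" using pi_approx by (intro power_mono) auto
      then show "pi\<^sup>2 / 6 \<le> 2" by (simp add: power2_eq_square)
    qed auto
    finally show ?thesis .
  qed
  have F_deriv: "(F has_field_derivative (\<Sum>n. diffs c n * w ^ n)) (at w)" if "cmod w < 1" for w
    unfolding F_def using that by (intro termdiffs_strong[where K = 1] summable_norm_cancel[OF c_summable]) auto
  have F_deriv_eq: "w * (\<Sum>n. diffs c n * w ^ n) = - ln (1 + w)" if "cmod w < 1" for w
  proof -
    have "(\<lambda>n. - ((-w)^n) / of_nat n) sums ln (1 + w)" using that by (rule Ln_series')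
    then have "(\<lambda>n. - ((-w)^(Suc n)) / of_nat (Suc n)) sums ln (1 + w)"
      by (subst sums_Suc_iff) simp
    then have 1: "(\<lambda>n. (-w)^(Suc n) / of_nat (Suc n)) sums - ln (1 + w)"
      using sums_minus by fastforce
    have 2: "(-w)^(Suc n) / of_nat (Suc n) = w * (diffs c n * w ^ n)" for n
      by (simp add: diffs_def c_def power2_eq_square power_minus[of w] del: of_nat_Suc)
    have 3: "summable (\<lambda>n. diffs c n * w ^ n)"
      using that by (intro termdiff_converges[where K = 1] summable_norm_cancel[OF c_summable]) auto
    show ?thesis using 1 3 unfolding 2 by (metis sums_unique suminf_mult)
  qed
  let ?H = "{z. 0 < Re z} \<inter> wide_sector"
  have FE: "((\<lambda>z. F (exp (- z))) has_field_derivative softplus z) (at z)" if "z \<in> ?H" for z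
  proof -
    have n: "cmod (exp (- z)) < 1" using that by simp
    have "((\<lambda>z. F (exp (- z))) has_field_derivative ((\<Sum>n. diffs c n * exp (- z) ^ n) * (- exp (- z)))) (at z)"
      using F_deriv[OF n] by (intro DERIV_chain2[where f = F and g = "\<lambda>z. exp (- z)"]) (auto intro!: derivative_eq_intros)
    moreover have "(\<Sum>n. diffs c n * exp (- z) ^ n) * (- exp (- z)) = softplus z"
      using F_deriv_eq[OF n] by (simp add: softplus_def mult.commute)
    ultimately show ?thesis by simp
  qed
  \<comment> \<open>Both functions are primitives of \<open>softplus\<close> on the convex set
    \<open>?H\<close>, so they differ by a constant; subtracting it transfers the decay of the
    series.\<close>
  have "\<exists>C. \<forall>z\<in>?H. G0 z - F (exp (- z)) = C"
  proof (rule has_field_derivative_zero_constant)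
    show "convex ?H" by (intro convex_Int convex_wide_sector convex_halfspace_Re_gt)
    show "((\<lambda>z. G0 z - F (exp (- z))) has_field_derivative 0) (at z within ?H)" if "z \<in> ?H" for z
      using DERIV_diff[OF G0 FE[OF that]] that by (auto intro: has_field_derivative_at_within)
  qed
  then obtain C where C: "G0 z - F (exp (- z)) = C" if "z \<in> ?H" for z by blast
  have F1: "F 1 = - of_real (pi\<^sup>2 / 12)"
  proof -
    have "(\<lambda>n. of_real ((-1) ^ n / (real n)\<^sup>2)) sums (of_real (- (pi\<^sup>2 / 12)) :: complex)"
      using alternating_inverse_squares_sums by (rule sums_of_real)
    then show ?thesis unfolding F_def c_def by (simp add: sums_unique[symmetric])
  qed
  \<comment> \<open>The vertex corresponds to \<open>w = 1\<close> on the boundary of the disc of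
    convergence. The Weierstrass test gives continuity up to the boundary, which is enough to pass
    to the limit along \<open>x n\<close>.\<close>
  have contF: "continuous_on (cball 0 1) F"
    unfolding F_def
  proof (rule uniform_limit_theorem[OF _ Weierstrass_m_test])
    show "\<forall>\<^sub>F n in sequentially. continuous_on (cball 0 1) (\<lambda>w. \<Sum>i<n. c i * w ^ i)"
      by (intro always_eventually allI continuous_intros)
    show "cmod (c n * w ^ n) \<le> 1 / (real n)\<^sup>2" if "w \<in> cball 0 1" for n w
    proof -
      have "cmod (c n * w ^ n) \<le> 1 / (real n)\<^sup>2 * cmod w" using c_norm that by simp
      also have "\<dots> \<le> 1 / (real n)\<^sup>2 * 1" using that by (intro mult_left_mono) auto
      finally show ?thesis by simp
    qed
  qed (use inv_sums sums_summable in auto)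
  have G00: "G0 0 - C = F 1"
  proof -
    define x where "x n = inverse (real (Suc n))" for n
    have x: "x \<longlonglongrightarrow> 0" unfolding x_def by (rule LIMSEQ_inverse_real_of_nat)
    have xpos: "x n > 0" for n by (simp add: x_def)
    then have H: "complex_of_real (x n) \<in> ?H" for n by (auto simp: wide_sector_def intro: add_pos_pos)
    have z0: "0 \<in> wide_sector" by (simp add: wide_sector_def)
    have "isCont G0 0" using G0[OF z0] DERIV_isCont by blast
    then have 1: "(\<lambda>n. G0 (complex_of_real (x n))) \<longlonglongrightarrow> G0 0"
      using x by (intro isCont_tendsto_compose[where g = G0]) (auto intro: tendsto_eq_intros)
    have "(\<lambda>n. F (exp (- complex_of_real (x n)))) \<longlonglongrightarrow> F 1"
      using xpos x by (intro continuous_on_tendsto_compose[OF contF]) 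
         (auto intro!: tendsto_eq_intros less_imp_le always_eventually)
    from tendsto_diff[OF 1 this] have "(\<lambda>n. C) \<longlonglongrightarrow> G0 0 - F 1" using C[OF H] by simp
    then show ?thesis by (simp add: LIMSEQ_const_iff)
  qed
  show thesis
  proof (rule that[of "\<lambda>z. G0 z - C"])
    show "((\<lambda>z. G0 z - C) has_field_derivative softplus z) (at z)" if "z \<in> wide_sector" for z
      using G0[OF that] by (auto intro!: derivative_eq_intros)
    show "G0 0 - C = - of_real (pi\<^sup>2 / 12)" using G00 F1 by simp
    show "cmod (G0 z - C) \<le> 2 * exp (- Re z)" if "z \<in> wide_sector" "0 < Re z" for z
      using C[of z] that F_bound[of "exp (- z)"] by (auto simp: algebra_simps)
  qed
qed

section \<open>Comparing sums over multiples of a sector point with integrals\<close>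

lemma of_nat_mult_sector: "z \<in> sector \<Longrightarrow> of_nat j * z \<in> sector"
  by (auto simp: sector_def abs_mult mult_left_mono)

lemma norm_le_2_Re_sector: "z \<in> sector \<Longrightarrow> cmod z \<le> 2 * Re z"
  using cmod_le[of z] by (auto simp: sector_def)

text \<open>A step \<open>h\<close> inside the sector does not decrease the real part, so the
  exponential bound at \<open>a\<close> controls the whole segment.\<close>

lemma sector_segment_Taylor:
  fixes f :: "nat \<Rightarrow> complex \<Rightarrow> complex"
  assumes a: "a \<in> sector" and h: "h \<in> sector"
    and f: "\<And>i z. z \<in> sector \<Longrightarrow> i \<le> m \<Longrightarrow> (f i has_field_derivative f (Suc i) z) (at z)"
    and B: "\<And>z. z \<in> sector \<Longrightarrow> cmod (f (Suc m) z) \<le> B * exp (- Re z)" "0 \<le> B"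
  shows "cmod (f 0 (a + h) - (\<Sum>i\<le>m. f i a * h ^ i / fact i)) \<le> B * exp (- Re a) * cmod h ^ Suc m / fact m"
proof -
  have ah: "a + h \<in> sector" using a h by (auto simp: sector_def abs_le_iff)
  let ?S = "closed_segment a (a + h)"
  have sub: "?S \<subseteq> sector" by (intro closed_segment_subset a ah convex_sector)
  have Re: "Re a \<le> Re z" if "z \<in> ?S" for z
  proof -
    obtain v where "0 \<le> v" "z = (1 - v) *\<^sub>R a + v *\<^sub>R (a + h)" using \<open>z \<in> ?S\<close> by (auto simp: closed_segment_def)
    then have "Re z = Re a + v * Re h" by (simp add: algebra_simps)
    then show ?thesis using \<open>0 \<le> v\<close> h by (auto simp: sector_def)
  qed
  have "cmod (f 0 (a + h) - (\<Sum>i\<le>m. f i a * ((a + h) - a) ^ i / fact i))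
      \<le> (B * exp (- Re a)) * cmod ((a + h) - a) ^ Suc m / fact m"
  proof (rule complex_Taylor[where S = ?S])
    show "(f i has_field_derivative f (Suc i) z) (at z within ?S)" if "z \<in> ?S" "i \<le> m" for i z
      using f[of z i] that sub by (auto intro: has_field_derivative_at_within)
    show "cmod (f (Suc m) z) \<le> B * exp (- Re a)" if "z \<in> ?S" for z
    proof -
      have "cmod (f (Suc m) z) \<le> B * exp (- Re z)" using B(1)[of z] that sub by auto
      also have "\<dots> \<le> B * exp (- Re a)" using Re[OF that] B(2) by (intro mult_left_mono) auto
      finally show ?thesis .
    qed
  qed auto
  then show ?thesis by simp
qed

lemma exp_geometric_le: "exp (- t) / (1 - exp (- t)) \<le> 1 / t" if "0 < t" for t :: real
proof -
  have "exp (- t) * (1 + t) \<le> exp (- t) * exp t" by (intro mult_left_mono exp_ge_add_one_self) auto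
  then have "exp (- t) * (1 + t) \<le> 1" by (simp add: exp_minus)
  then show ?thesis using that by (simp add: field_simps)
qed

lemma sum_exp_le:
  fixes t :: real assumes "0 < t"
  shows "(\<Sum>j=1..n. exp (- (real j * t))) \<le> 1 / t"
proof -
  have e: "exp (- t) < 1" using assms by simp
  have "(\<Sum>j=1..n. exp (- (real j * t))) = (\<Sum>j<n. exp (- t) * exp (- t) ^ j)"
    by (rule sum.reindex_bij_witness[of _ Suc "\<lambda>j. j - 1"])
      (auto simp: exp_of_nat_mult[symmetric] exp_add[symmetric] algebra_simps)
  also have "\<dots> = exp (- t) * ((1 - exp (- t) ^ n) / (1 - exp (- t)))"
    using e by (simp only: sum_distrib_left[symmetric]) (simp add: sum_gp_strict)
  also have "\<dots> \<le> exp (- t) * (1 / (1 - exp (- t)))" using e by (intro mult_left_mono divide_right_mono) auto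
  also have "\<dots> \<le> 1 / t" using exp_geometric_le[OF assms] by simp
  finally show ?thesis .
qed

lemma sum_exp_lessThan_le:
  fixes t :: real assumes "0 < t"
  shows "(\<Sum>j<n. exp (- (real j * t))) \<le> (1 + t) / t"
proof -
  have "(\<Sum>j<n. exp (- (real j * t))) \<le> (\<Sum>j\<in>insert 0 {1..n}. exp (- (real j * t)))"
    by (intro sum_mono2) auto
  also have "\<dots> = 1 + (\<Sum>j=1..n. exp (- (real j * t)))" by (subst sum.insert) auto
  also have "\<dots> \<le> 1 + 1 / t" by (intro add_left_mono sum_exp_le assms)
  also have "\<dots> = (1 + t) / t" using assms by (simp add: field_simps)
  finally show ?thesis .
qed

text \<open>Splits the error of the trapezoidal rule, with step \<open>z\<close> and primitive
  values \<open>g\<close>, into its panels. The correction \<open>(s 0 - s n) / 2\<close> converts a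
  sum starting at 1 into one with half weights at both ends.\<close>

lemma trapezoid_telescope:
  fixes z :: complex
  shows "z * (\<Sum>j=1..n. s j) + z * (s 0 - s n) / 2 - (g n - g 0) =
    (\<Sum>j<n. z * (s j + s (Suc j)) / 2 - (g (Suc j) - g j))"
proof (induction n)
  case (Suc n)
  have "(\<Sum>j<Suc n. z * (s j + s (Suc j)) / 2 - (g (Suc j) - g j))
      = (z * (\<Sum>j=1..n. s j) + z * (s 0 - s n) / 2 - (g n - g 0)) + (z * (s n + s (Suc n)) / 2 - (g (Suc n) - g n))"
    unfolding Suc.IH by simp
  moreover have "(\<Sum>j=1..Suc n. s j) = (\<Sum>j=1..n. s j) + s (Suc n)" by simp
  ultimately show ?case by (simp only:) (simp add: field_simps)
qed simp

text \<open>Taylor expansion at the left end of a panel makes the polynomial parts cancel, leaving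
  \<open>z * R2 / 2 - R1\<close>, which is cubic in \<open>cmod z\<close>. The exponential decay
  then sums over the panels to \<open>(1 + Re z) / Re z\<close>, for a total of order
  \<open>(cmod z)\<^sup>2\<close>; this still vanishes after division by \<open>z\<close>.\<close>

lemma trapezoid_softplus:
  assumes z: "z \<in> sector" "0 < Re z"
    and G: "\<And>z. z \<in> wide_sector \<Longrightarrow> (G has_field_derivative softplus z) (at z)"
  shows "cmod (z * (\<Sum>j=1..n. softplus (of_nat j * z)) + z * (softplus 0 - softplus (of_nat n * z)) / 2
            - (G (of_nat n * z) - G 0)) \<le> 4 * cmod z ^ 3 * ((1 + Re z) / Re z)"
proof -
  define E where "E j = z * (softplus (of_nat j * z) + softplus (of_nat (Suc j) * z)) / 2
      - (G (of_nat (Suc j) * z) - G (of_nat j * z))" for j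
  define f where "f i = (case i of 0 \<Rightarrow> G | Suc 0 \<Rightarrow> softplus | Suc (Suc 0) \<Rightarrow> softplus1 | _ \<Rightarrow> softplus2)" for i :: nat
  have f: "f 0 = G" "f (Suc 0) = softplus" "f (Suc (Suc 0)) = softplus1" "f (Suc (Suc (Suc 0))) = softplus2"
    by (simp_all add: f_def)
  have df: "(f i has_field_derivative f (Suc i) z) (at z)" if "z \<in> sector" "i \<le> 2" for i z
  proof -
    have "i = 0 \<or> i = Suc 0 \<or> i = Suc (Suc 0)" using that by auto
    then show ?thesis using G has_field_derivative_softplus sector_subset_wide_sector that f by auto
  qed
  have E: "cmod (E j) \<le> 4 * cmod z ^ 3 * exp (- (real j * Re z))" for j
  proof -
    let ?a = "of_nat j * z"
    have a: "?a \<in> sector" using z by (simp add: of_nat_mult_sector)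
    have 1: "cmod (f 0 (?a + z) - (\<Sum>i\<le>2. f i ?a * z ^ i / fact i)) \<le> 4 * exp (- Re ?a) * cmod z ^ Suc 2 / fact 2"
      using df norm_softplus2_le f
      by (intro sector_segment_Taylor[OF a z(1)]) (auto simp: numeral_2_eq_2)
    have 2: "cmod (f (Suc 0) (?a + z) - (\<Sum>i\<le>1. f (Suc i) ?a * z ^ i / fact i)) \<le> 4 * exp (- Re ?a) * cmod z ^ Suc 1 / fact 1"
      using df norm_softplus2_le f
      by (intro sector_segment_Taylor[OF a z(1), where f = "\<lambda>i. f (Suc i)"]) (auto simp: numeral_2_eq_2)
    define R1 where "R1 = f 0 (?a + z) - (\<Sum>i\<le>2. f i ?a * z ^ i / fact i)"
    define R2 where "R2 = f (Suc 0) (?a + z) - (\<Sum>i\<le>1. f (Suc i) ?a * z ^ i / fact i)"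
    define e r where "e = exp (- (real j * Re z))" and "r = cmod z"
    have R1: "cmod R1 \<le> 2 * e * r ^ 3" using 1 unfolding R1_def[symmetric] e_def r_def by (simp add: power3_eq_cube numeral_2_eq_2 mult_ac)
    have R2: "cmod R2 \<le> 4 * e * r\<^sup>2" using 2 unfolding R2_def[symmetric] e_def r_def by (simp add: power2_eq_square mult_ac)
    have "E j = z * R2 / 2 - R1"
      by (simp add: R1_def R2_def E_def f numeral_2_eq_2 field_simps)
    then have "cmod (E j) \<le> cmod (z * R2 / 2) + cmod R1" by (simp only: norm_triangle_ineq4)
    also have "cmod (z * R2 / 2) = r * cmod R2 / 2" by (simp add: norm_mult r_def)
    also have "r * cmod R2 / 2 + cmod R1 \<le> r * (4 * e * r\<^sup>2) / 2 + 2 * e * r ^ 3"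
      by (intro add_mono divide_right_mono mult_left_mono R1 R2) (auto simp: r_def)
    also have "\<dots> = 4 * r ^ 3 * e" by (simp add: power2_eq_square power3_eq_cube)
    finally show ?thesis by (simp only: e_def r_def)
  qed
  have "z * (\<Sum>j=1..n. softplus (of_nat j * z)) + z * (softplus 0 - softplus (of_nat n * z)) / 2
            - (G (of_nat n * z) - G 0) = (\<Sum>j<n. E j)"
    using trapezoid_telescope[of z "\<lambda>j. softplus (of_nat j * z)" n "\<lambda>j. G (of_nat j * z)"]
    by (simp only: E_def of_nat_0 mult_zero_left)
  also have "cmod \<dots> \<le> (\<Sum>j<n. 4 * cmod z ^ 3 * exp (- (real j * Re z)))" 
    using E by (rule sum_norm_le)
  also have "\<dots> = 4 * cmod z ^ 3 * (\<Sum>j<n. exp (- (real j * Re z)))" by (simp add: sum_distrib_left)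
  also have "\<dots> \<le> 4 * cmod z ^ 3 * ((1 + Re z) / Re z)"
    using sum_exp_lessThan_le[OF z(2)] by (intro mult_left_mono) auto
  finally show ?thesis .
qed

text \<open>Here only the limit of \<open>z\<close> times the sum is wanted, so left endpoints and
  first-order Taylor expansion are accurate enough.\<close>

lemma rectangle_softplus2:
  assumes z: "z \<in> sector" "0 < Re z"
  shows "cmod (z * (\<Sum>j<n. softplus2 (of_nat j * z)) - (softplus1 (of_nat n * z) - softplus1 0))
    \<le> 16 * cmod z ^ 2 * ((1 + Re z) / Re z)"
proof -
  define E where "E j = z * softplus2 (of_nat j * z) - (softplus1 (of_nat (Suc j) * z) - softplus1 (of_nat j * z))" for j
  define f where "f i = (case i of 0 \<Rightarrow> softplus1 | Suc 0 \<Rightarrow> softplus2 | _ \<Rightarrow> softplus3)" for i :: nat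
  have f: "f 0 = softplus1" "f (Suc 0) = softplus2" "f (Suc (Suc 0)) = softplus3"
    by (simp_all add: f_def)
  have E: "cmod (E j) \<le> 16 * cmod z ^ 2 * exp (- (real j * Re z))" for j
  proof -
    let ?a = "of_nat j * z"
    have a: "?a \<in> sector" using z by (simp add: of_nat_mult_sector)
    have df: "(f i has_field_derivative f (Suc i) z) (at z)" if "z \<in> sector" "i \<le> 1" for i z
    proof -
      have "i = 0 \<or> i = Suc 0" using that by auto
      then show ?thesis using has_field_derivative_softplus sector_subset_wide_sector that f by auto
    qed
    have "cmod (f 0 (?a + z) - (\<Sum>i\<le>1. f i ?a * z ^ i / fact i)) \<le> 16 * exp (- Re ?a) * cmod z ^ Suc 1 / fact 1"
      using df norm_softplus3_le f
      by (intro sector_segment_Taylor[OF a z(1)]) auto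
    moreover have "E j = - (f 0 (?a + z) - (\<Sum>i\<le>1. f i ?a * z ^ i / fact i))"
      by (simp add: E_def f field_simps)
    ultimately show ?thesis by (simp only: norm_minus_cancel) (simp add: mult_ac numeral_2_eq_2)
  qed
  have "z * (\<Sum>j<n. softplus2 (of_nat j * z)) - (softplus1 (of_nat n * z) - softplus1 0) = (\<Sum>j<n. E j)"
    by (induction n) (auto simp: E_def field_simps)
  also have "cmod \<dots> \<le> (\<Sum>j<n. 16 * cmod z ^ 2 * exp (- (real j * Re z)))" 
    using E by (rule sum_norm_le)
  also have "\<dots> = 16 * cmod z ^ 2 * (\<Sum>j<n. exp (- (real j * Re z)))" by (simp add: sum_distrib_left)
  also have "\<dots> \<le> 16 * cmod z ^ 2 * ((1 + Re z) / Re z)"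
    using sum_exp_lessThan_le[OF z(2)] by (intro mult_left_mono) auto
  finally show ?thesis .
qed

text \<open>Used for the real saddle point and for points \<open>saddle n - \<i> * \<theta>\<close>
  close to it. The assumption \<open>tail\<close> says that the sum is already long at
  \<open>j = n\<close>: what is left at the far end is negligible even after division by
  \<open>T n\<close>.\<close>

context
  fixes T :: "nat \<Rightarrow> complex"
  assumes sector: "eventually (\<lambda>n. T n \<in> sector \<and> 0 < Re (T n)) sequentially"
    and T0: "T \<longlonglongrightarrow> 0"
    and tail: "(\<lambda>n. exp (- (real n * Re (T n))) / Re (T n)) \<longlonglongrightarrow> 0"
begin

lemma tail_exp: "(\<lambda>n. exp (- (of_nat n * T n))) \<longlonglongrightarrow> 0"
proof -
  have "(\<lambda>n. Re (T n)) \<longlonglongrightarrow> 0" using tendsto_Re[OF T0] by simp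
  from tendsto_mult[OF tail this] have "(\<lambda>n. exp (- (real n * Re (T n))) / Re (T n) * Re (T n)) \<longlonglongrightarrow> 0" by simp
  moreover have "eventually (\<lambda>n. exp (- (real n * Re (T n))) / Re (T n) * Re (T n) = cmod (exp (- (of_nat n * T n)))) sequentially"
    using sector by eventually_elim simp
  ultimately have "(\<lambda>n. cmod (exp (- (of_nat n * T n)))) \<longlonglongrightarrow> 0" by (rule Lim_transform_eventually)
  then show ?thesis by (rule tendsto_norm_zero_cancel)
qed

lemma defect_tendsto: "(\<lambda>n. C * cmod (T n) * (1 + Re (T n))) \<longlonglongrightarrow> 0"
proof -
  have "(\<lambda>n. C * cmod (T n) * (1 + Re (T n))) \<longlonglongrightarrow> C * cmod 0 * (1 + Re 0)"
    by (intro tendsto_intros T0)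
  then show ?thesis by simp
qed

text \<open>The main term is \<open>- G 0 / T n\<close>, the integral from 0 to infinity; the
  constant \<open>- ln 2 / 2\<close> is the endpoint correction
  \<open>- softplus 0 / 2\<close>.\<close>

lemma sum_softplus_asymptotics:
  "(\<lambda>n. (\<Sum>j=1..n. softplus (of_nat j * T n)) - of_real (pi\<^sup>2 / 12) / T n) \<longlonglongrightarrow> - of_real (ln 2 / 2)"
proof -
  obtain G where G: "\<And>z. z \<in> wide_sector \<Longrightarrow> (G has_field_derivative softplus z) (at z)"
    "G 0 = - of_real (pi\<^sup>2 / 12)" "\<And>z. z \<in> wide_sector \<Longrightarrow> 0 < Re z \<Longrightarrow> cmod (G z) \<le> 2 * exp (- Re z)"
    using softplus_primitive by blast
  define S where "S n = (\<Sum>j=1..n. softplus (of_nat j * T n))" for n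
  have s0: "softplus 0 = of_real (ln 2)" using Ln_of_real[of 2] by (simp add: softplus_def)
  define X where "X n = S n + (softplus 0 - softplus (of_nat n * T n)) / 2 - (G (of_nat n * T n) - G 0) / T n" for n
  have X: "X \<longlonglongrightarrow> 0"
  proof (rule Lim_null_comparison[OF _ defect_tendsto[of 8]])
    show "eventually (\<lambda>n. cmod (X n) \<le> 8 * cmod (T n) * (1 + Re (T n))) sequentially"
      using sector
    proof eventually_elim
      case (elim n)
      then have z: "T n \<in> sector" "0 < Re (T n)" by auto
      then have nz: "T n \<noteq> 0" by auto
      have "cmod (T n) * cmod (X n) = cmod (T n * X n)" by (simp add: norm_mult)
      also have "T n * X n = T n * S n + T n * (softplus 0 - softplus (of_nat n * T n)) / 2
            - (G (of_nat n * T n) - G 0)" using nz by (simp add: X_def field_simps)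
      also have "cmod \<dots> \<le> 4 * cmod (T n) ^ 3 * ((1 + Re (T n)) / Re (T n))"
        unfolding S_def using G(1) by (rule trapezoid_softplus[OF z])
      also have "\<dots> = cmod (T n) * (4 * cmod (T n) * (1 + Re (T n)) * (cmod (T n) / Re (T n)))"
        by (simp add: power3_eq_cube)
      also have "\<dots> \<le> cmod (T n) * (4 * cmod (T n) * (1 + Re (T n)) * 2)"
        using norm_le_2_Re_sector[OF z(1)] z(2) by (intro mult_left_mono) (auto simp: field_simps)
      finally have "cmod (T n) * cmod (X n) \<le> cmod (T n) * (8 * cmod (T n) * (1 + Re (T n)))"
        by (simp add: algebra_simps)
      then show ?case by (rule mult_left_le_imp_le) (use nz in simp)
    qed
  qed
  have c: "isCont (\<lambda>w. ln (1 + w)) (0 :: complex)" by simp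
  have 1: "(\<lambda>n. softplus (of_nat n * T n)) \<longlonglongrightarrow> 0"
    using isCont_tendsto_compose[OF c tail_exp] by (simp add: softplus_def)
  have 2: "(\<lambda>n. G (of_nat n * T n) / T n) \<longlonglongrightarrow> 0"
  proof (rule Lim_null_comparison)
    show "(\<lambda>n. 2 * (exp (- (real n * Re (T n))) / Re (T n))) \<longlonglongrightarrow> 0"
      using tendsto_mult_left[OF tail, of 2] by simp
    show "eventually (\<lambda>n. cmod (G (of_nat n * T n) / T n) \<le> 2 * (exp (- (real n * Re (T n))) / Re (T n))) sequentially"
      using sector eventually_gt_at_top[of 0]
    proof eventually_elim
      case (elim n)
      then have z: "T n \<in> sector" "0 < Re (T n)" and n: "0 < n" by auto
      have "cmod (G (of_nat n * T n)) \<le> 2 * exp (- Re (of_nat n * T n))"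
        using n z by (intro G(3) sector_subset_wide_sector of_nat_mult_sector) auto
      then show ?case using complex_Re_le_cmod[of "T n"] z
        by (simp add: norm_divide) (intro frac_le; simp)
    qed
  qed
  have lim: "(\<lambda>n. X n - (softplus 0 - softplus (of_nat n * T n)) / 2 + G (of_nat n * T n) / T n)
      \<longlonglongrightarrow> 0 - (softplus 0 - 0) / 2 + 0"
    by (intro tendsto_intros X 1 2) auto
  have eq: "X n - (softplus 0 - softplus (of_nat n * T n)) / 2 + G (of_nat n * T n) / T n
      = S n - of_real (pi\<^sup>2 / 12) / T n" for n
    unfolding X_def G(2) diff_divide_distrib by simp
  have l: "0 - (softplus 0 - 0) / 2 + 0 = - of_real (ln 2 / 2)" by (simp add: s0)
  show ?thesis using lim unfolding eq l unfolding S_def .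
qed

text \<open>A Riemann sum for the integral of \<open>softplus2\<close>, which is
  \<open>- softplus1 0 = 1 / 2\<close>. Shifting the index range from \<open>{..<n}\<close> to
  \<open>{1..n}\<close> costs one term, and the factor \<open>T n\<close> kills it.\<close>

lemma sum_softplus2_asymptotics:
  "(\<lambda>n. T n * (\<Sum>j=1..n. softplus2 (of_nat j * T n))) \<longlonglongrightarrow> 1 / 2"
proof -
  define X where "X n = T n * (\<Sum>j<n. softplus2 (of_nat j * T n)) - (softplus1 (of_nat n * T n) - softplus1 0)" for n
  have X: "X \<longlonglongrightarrow> 0"
  proof (rule Lim_null_comparison[OF _ defect_tendsto[of 32]])
    show "eventually (\<lambda>n. cmod (X n) \<le> 32 * cmod (T n) * (1 + Re (T n))) sequentially"
      using sector
    proof eventually_elim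
      case (elim n)
      then have z: "T n \<in> sector" "0 < Re (T n)" by auto
      have "cmod (X n) \<le> 16 * cmod (T n) ^ 2 * ((1 + Re (T n)) / Re (T n))"
        unfolding X_def by (rule rectangle_softplus2[OF z])
      also have "\<dots> = 16 * cmod (T n) * (1 + Re (T n)) * (cmod (T n) / Re (T n))"
        by (simp add: power2_eq_square)
      also have "\<dots> \<le> 16 * cmod (T n) * (1 + Re (T n)) * 2"
        using norm_le_2_Re_sector[OF z(1)] z(2) by (intro mult_left_mono) (auto simp: field_simps)
      finally show ?case by (simp add: algebra_simps)
    qed
  qed
  have c: "isCont (\<lambda>w. - (w / (1 + w))) (0 :: complex)" "isCont (\<lambda>w. w / (1 + w) ^ 2) (0 :: complex)"
    by (auto intro!: continuous_intros)
  have 1: "(\<lambda>n. softplus1 (of_nat n * T n)) \<longlonglongrightarrow> 0" "(\<lambda>n. softplus2 (of_nat n * T n)) \<longlonglongrightarrow> 0"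
    using isCont_tendsto_compose[OF c(1) tail_exp] isCont_tendsto_compose[OF c(2) tail_exp]
    by (simp_all add: softplus1_def softplus2_def)
  have "(\<lambda>n. X n + (softplus1 (of_nat n * T n) - softplus1 0) + T n * (softplus2 (of_nat n * T n) - softplus2 0))
      \<longlonglongrightarrow> 0 + (0 - softplus1 0) + 0 * (0 - softplus2 0)"
    by (intro tendsto_intros X 1 T0)
  moreover have "X n + (softplus1 (of_nat n * T n) - softplus1 0) + T n * (softplus2 (of_nat n * T n) - softplus2 0)
    = T n * (\<Sum>j=1..n. softplus2 (of_nat j * T n))" for n
  proof -
    have "(\<Sum>j=1..m. softplus2 (of_nat j * z)) + softplus2 0 = (\<Sum>j<m. softplus2 (of_nat j * z)) + softplus2 (of_nat m * z)" for m z
      by (induction m) (auto simp: algebra_simps)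
    from this[where m = n and z = "T n"]
    have "(\<Sum>j=1..n. softplus2 (of_nat j * T n)) = (\<Sum>j<n. softplus2 (of_nat j * T n)) + softplus2 (of_nat n * T n) - softplus2 0"
      by (simp only: eq_diff_eq)
    note eq = this
    have "x * b - y + y + x * (c - d) = x * (b + c - d)" for x y b c d :: complex
      by (simp add: ring_distribs)
    then show ?thesis unfolding X_def eq .
  qed
  ultimately show ?thesis by (simp add: softplus1_def)
qed

text \<open>Serves to show that the quadratic error in the logarithm of the product in
  \<open>pair_gf_eq\<close> vanishes.\<close>

lemma sum_norm_softplus2_bounded:
  "\<exists>C. eventually (\<lambda>n. cmod (T n) * (\<Sum>j=1..n. cmod (softplus2 (of_nat j * T n))) \<le> C) sequentially"
proof -
  have "eventually (\<lambda>n. dist (T n) 0 < 1) sequentially" using T0 by (rule tendstoD) simp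
  then have "eventually (\<lambda>n. cmod (T n) * (\<Sum>j=1..n. cmod (softplus2 (of_nat j * T n))) \<le> 16) sequentially"
    using sector
  proof eventually_elim
    case (elim n)
    then have z: "T n \<in> sector" "0 < Re (T n)" and "cmod (T n) < 1" by auto
    then have R1: "Re (T n) < 1" using complex_Re_le_cmod[of "T n"] by linarith
    have "(\<Sum>j=1..n. cmod (softplus2 (of_nat j * T n))) \<le> (\<Sum>j=1..n. 4 * exp (- (real j * Re (T n))))"
      using norm_softplus2_le[OF of_nat_mult_sector[OF z(1)]] by (intro sum_mono) simp
    also have "\<dots> \<le> (\<Sum>j<Suc n. 4 * exp (- (real j * Re (T n))))"
      by (intro sum_mono2) auto
    also have "\<dots> \<le> 4 * ((1 + Re (T n)) / Re (T n))"
      using sum_exp_lessThan_le[OF z(2), of "Suc n"] by (simp only: sum_distrib_left[symmetric])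
    finally have "cmod (T n) * (\<Sum>j=1..n. cmod (softplus2 (of_nat j * T n))) \<le> cmod (T n) * (4 * ((1 + Re (T n)) / Re (T n)))"
      by (intro mult_left_mono) auto
    also have "\<dots> \<le> (2 * Re (T n)) * (4 * ((1 + Re (T n)) / Re (T n)))"
      using norm_le_2_Re_sector[OF z(1)] z by (intro mult_right_mono) auto
    also have "\<dots> = 8 * (1 + Re (T n))" using z by simp
    also have "\<dots> \<le> 16" using R1 by simp
    finally show ?case .
  qed
  then show ?thesis by blast
qed

end

section \<open>The generating function of pairs of distinct partitions\<close>

text \<open>Parts above \<open>n\<close> cannot occur in a pair of total \<open>n\<close>, so a
  finite product suffices for that coefficient. Logarithmic variables are used: \<open>v\<close>
  stands for \<open>ln w\<close> and \<open>z\<close> for \<open>- ln q\<close>.\<close>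

definition pair_gf :: "nat \<Rightarrow> complex \<Rightarrow> complex \<Rightarrow> complex" where
  "pair_gf n v z = (\<Prod>j=1..n. (1 + exp (v - of_nat j * z)) * (1 + exp (- v - of_nat j * z)))"

lemma pair_gf_expand:
  "pair_gf n v z = (\<Sum>p\<in>Pow {1..n} \<times> Pow {1..n}.
     exp (v * of_int (excess p)) * exp (- (of_nat (\<Sum>(fst p) + \<Sum>(snd p)) * z)))"
proof -
  have one: "(\<Prod>j\<in>J. 1 + exp (w - of_nat j * z)) = (\<Sum>A\<in>Pow J. exp (w * of_nat (card A)) * exp (- (of_nat (\<Sum>A) * z)))"
    if J: "finite J" for J :: "nat set" and w
  proof -
    have "(\<Prod>j\<in>J. exp (w - of_nat j * z) + 1) = (\<Sum>A\<in>Pow J. (\<Prod>j\<in>A. exp (w - of_nat j * z)) * (\<Prod>j\<in>J - A. 1))"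
      by (rule prod_add[OF J])
    also have "\<dots> = (\<Sum>A\<in>Pow J. exp (w * of_nat (card A)) * exp (- (of_nat (\<Sum>A) * z)))"
    proof (rule sum.cong[OF refl])
      fix A assume "A \<in> Pow J"
      then have "finite A" using J finite_subset by auto
      then have "(\<Prod>j\<in>A. exp (w - of_nat j * z)) = exp (\<Sum>j\<in>A. w - of_nat j * z)" by (rule exp_sum[symmetric])
      also have "(\<Sum>j\<in>A. w - of_nat j * z) = w * of_nat (card A) + - (of_nat (\<Sum>A) * z)"
        by (simp add: sum_subtractf sum_distrib_left[symmetric] mult.commute)
      finally show "(\<Prod>j\<in>A. exp (w - of_nat j * z)) * (\<Prod>j\<in>J - A. 1) = exp (w * of_nat (card A)) * exp (- (of_nat (\<Sum>A) * z))"
        by (simp only: exp_add prod.neutral_const mult_1_right)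
    qed
    finally show ?thesis by (simp add: add.commute)
  qed
  have "pair_gf n v z = (\<Prod>j\<in>{1..n}. 1 + exp (- v - of_nat j * z)) * (\<Prod>j\<in>{1..n}. 1 + exp (v - of_nat j * z))"
    unfolding pair_gf_def by (simp add: prod.distrib mult.commute)
  also have "\<dots> = (\<Sum>A\<in>Pow {1..n}. \<Sum>B\<in>Pow {1..n}. (exp (- v * of_nat (card A)) * exp (- (of_nat (\<Sum>A) * z)))
      * (exp (v * of_nat (card B)) * exp (- (of_nat (\<Sum>B) * z))))"
    unfolding one[OF finite_atLeastAtMost] by (rule sum_product)
  also have "\<dots> = (\<Sum>A\<in>Pow {1..n}. \<Sum>B\<in>Pow {1..n}.
     exp (v * of_int (excess (A, B))) * exp (- (of_nat (\<Sum>A + \<Sum>B) * z)))"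
    unfolding excess_def by (intro sum.cong refl) (simp add: algebra_simps flip: exp_add)
  finally show ?thesis by (simp add: sum.cartesian_product case_prod_unfold)
qed

section \<open>Coefficients as Fourier integrals\<close>

text \<open>The angle is stretched by \<open>K\<close> so that, with \<open>K = 1 / width n\<close>,
  the peak keeps a fixed width. For \<open>r \<noteq> 0\<close> the endpoint exponents differ by a
  multiple of \<open>2 * pi * \<i>\<close>.\<close>

lemma Fourier_integral:
  fixes r :: int and K :: real
  assumes K: "0 < K"
  shows "has_bochner_integral lborel (\<lambda>x. indicator {- (pi * K)..pi * K} x *\<^sub>R exp (\<i> * of_int r * of_real (x / K)))
    (if r = 0 then of_real (2 * pi * K) else 0)"
proof (cases "r = 0")
  case True
  have "has_bochner_integral lborel (\<lambda>x. indicator {- (pi * K)..pi * K} x *\<^sub>R (1 :: complex))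
     (of_real (pi * K) - of_real (- (pi * K)))"
    using K by (intro has_bochner_integral_FTC_Icc) (auto intro!: derivative_eq_intros continuous_intros)
  then show ?thesis using True by (simp add: mult_ac)
next
  case False
  define c where "c = \<i> * of_int r / of_real K"
  have c0: "c \<noteq> 0" using False K by (auto simp: c_def)
  have "has_bochner_integral lborel (\<lambda>x. indicator {- (pi * K)..pi * K} x *\<^sub>R exp (c * of_real x))
     (exp (c * of_real (pi * K)) / c - exp (c * of_real (- (pi * K))) / c)"
  proof (rule has_bochner_integral_FTC_Icc)
    fix x :: real
    have "((\<lambda>x. exp (c * x) / c) has_field_derivative exp (c * of_real x)) (at (of_real x))"
      using c0 by (auto intro!: derivative_eq_intros)
    from has_vector_derivative_real_field[OF this]
    show "((\<lambda>x. exp (c * of_real x) / c) has_vector_derivative exp (c * of_real x)) (at x within {- (pi * K)..pi * K})"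
      by (rule has_vector_derivative_at_within)
  qed (use K in \<open>auto intro!: continuous_intros\<close>)
  moreover have "exp (c * of_real (pi * K)) = exp (c * of_real (- (pi * K)))"
  proof -
    have "c * of_real (pi * K) = c * of_real (- (pi * K)) + of_int (2 * r) * (of_real pi * \<i>)"
      using K by (simp add: c_def field_simps)
    moreover have "exp (of_int (2 * r) * (of_real pi * \<i>)) = 1"
      using exp_integer_2pi[of "of_int r"] by (simp add: mult_ac)
    ultimately show ?thesis by (simp only: exp_add mult_1_right)
  qed
  ultimately show ?thesis using False K by (simp add: c_def mult_ac)
qed

lemma Fourier_pair_gf:
  fixes t K :: real and v :: complex
  assumes K: "0 < K"
  shows "has_bochner_integral lborel (\<lambda>x. indicator {- (pi * K)..pi * K} x *\<^sub>R
      (pair_gf n v (of_real t - \<i> * of_real (x / K)) * exp (- (\<i> * of_nat n * of_real (x / K)))))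
    (of_real (2 * pi * K * exp (- (real n * t))) * (\<Sum>p\<in>distinct_pairs n. exp (v * of_int (excess p))))"
proof -
  let ?P = "Pow {1..n} \<times> Pow {1..n} :: (nat set \<times> nat set) set"
  let ?s = "\<lambda>p :: nat set \<times> nat set. \<Sum>(fst p) + \<Sum>(snd p)"
  define a where "a p = exp (v * of_int (excess p)) * of_real (exp (- (real (?s p) * t)))" for p
  have "has_bochner_integral lborel (\<lambda>x. \<Sum>p\<in>?P. a p * (indicator {- (pi * K)..pi * K} x *\<^sub>R
      exp (\<i> * of_int (int (?s p) - int n) * of_real (x / K))))
      (\<Sum>p\<in>?P. a p * (if int (?s p) - int n = 0 then of_real (2 * pi * K) else 0))"
    by (intro has_bochner_integral_sum has_bochner_integral_mult_right Fourier_integral K)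
  also have "(\<Sum>p\<in>?P. a p * (if int (?s p) - int n = 0 then of_real (2 * pi * K) else 0))
     = (\<Sum>p\<in>{p \<in> ?P. ?s p = n}. a p * of_real (2 * pi * K))"
    unfolding right_minus_eq of_nat_eq_iff by (intro sum.mono_neutral_cong_right) auto
  also have "{p \<in> ?P. ?s p = n} = distinct_pairs n" by (auto simp: distinct_pairs_def)
  also have "(\<Sum>p\<in>distinct_pairs n. a p * of_real (2 * pi * K))
     = of_real (2 * pi * K * exp (- (real n * t))) * (\<Sum>p\<in>distinct_pairs n. exp (v * of_int (excess p)))"
    unfolding sum_distrib_left
  proof (rule sum.cong[OF refl])
    fix p assume "p \<in> distinct_pairs n"
    then have "?s p = n" by (auto simp: distinct_pairs_def)
    then show "a p * of_real (2 * pi * K) = of_real (2 * pi * K * exp (- (real n * t))) * exp (v * of_int (excess p))"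
      unfolding a_def by simp
  qed
  also have "(\<lambda>x. \<Sum>p\<in>?P. a p * (indicator {- (pi * K)..pi * K} x *\<^sub>R
      exp (\<i> * of_int (int (?s p) - int n) * of_real (x / K)))) =
    (\<lambda>x. indicator {- (pi * K)..pi * K} x *\<^sub>R
      (pair_gf n v (of_real t - \<i> * of_real (x / K)) * exp (- (\<i> * of_nat n * of_real (x / K)))))"
  proof (rule ext)
    fix x :: real
    let ?i = "indicator {- (pi * K)..pi * K} x :: real"
    have "?i *\<^sub>R (pair_gf n v (of_real t - \<i> * of_real (x / K)) * exp (- (\<i> * of_nat n * of_real (x / K))))
       = (\<Sum>p\<in>?P. ?i *\<^sub>R (exp (v * of_int (excess p)) * exp (- (of_nat (?s p) * (of_real t - \<i> * of_real (x / K))))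
          * exp (- (\<i> * of_nat n * of_real (x / K)))))"
      unfolding pair_gf_expand sum_distrib_right scaleR_sum_right ..
    also have "\<dots> = (\<Sum>p\<in>?P. a p * (?i *\<^sub>R exp (\<i> * of_int (int (?s p) - int n) * of_real (x / K))))"
    proof (rule sum.cong[OF refl])
      fix p
      have "exp (- (of_nat (?s p) * (of_real t - \<i> * of_real (x / K)))) * exp (- (\<i> * of_nat n * of_real (x / K)))
         = of_real (exp (- (real (?s p) * t))) * exp (\<i> * of_int (int (?s p) - int n) * of_real (x / K))"
        unfolding exp_of_real[symmetric] exp_add[symmetric]
        by (rule arg_cong[where f = exp]) (simp add: algebra_simps)
      then show "?i *\<^sub>R (exp (v * of_int (excess p)) * exp (- (of_nat (?s p) * (of_real t - \<i> * of_real (x / K))))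
          * exp (- (\<i> * of_nat n * of_real (x / K))))
          = a p * (?i *\<^sub>R exp (\<i> * of_int (int (?s p) - int n) * of_real (x / K)))"
        unfolding a_def by (simp only: mult.assoc mult_scaleR_right)
    qed
    finally show "(\<Sum>p\<in>?P. a p * (?i *\<^sub>R exp (\<i> * of_int (int (?s p) - int n) * of_real (x / K)))) =
      ?i *\<^sub>R (pair_gf n v (of_real t - \<i> * of_real (x / K)) * exp (- (\<i> * of_nat n * of_real (x / K))))" by (rule sym)
  qed
  finally show ?thesis .
qed

section \<open>Bounds for the generating function on the whole circle\<close>

text \<open>The parameter \<open>v\<close> enters only through \<open>exp v + exp (- v) - 2\<close>, which is of order \<open>v\<^sup>2\<close>.\<close>

lemma pair_gf_factor:
  "(1 + exp (v - w)) * (1 + exp (- v - w)) = (1 + exp (- w))\<^sup>2 + (exp v + exp (- v) - 2) * exp (- w)" for v w :: complex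
proof -
  have "exp (v - w) = exp v * exp (- w)" "exp (- v - w) = exp (- v) * exp (- w)" "exp v * exp (- v) = 1"
    by (simp_all flip: exp_add)
  then show ?thesis by (simp add: algebra_simps power2_eq_square)
qed

text \<open>The value of \<open>pair_gf\<close> at \<open>v = 0\<close> and angle 0, by which the
  integrand will be normalised.\<close>

definition pair_gf_real :: "nat \<Rightarrow> real \<Rightarrow> real" where
  "pair_gf_real n t = (\<Prod>j=1..n. (1 + exp (- (real j * t)))\<^sup>2)"

lemma pair_gf_real_pos: "0 < pair_gf_real n t"
  unfolding pair_gf_real_def by (intro prod_pos zero_less_power add_pos_pos) auto

text \<open>For each factor, \<open>cmod (1 + \<rho> * cis \<phi>)\<close> squared equals
  \<open>(1 + \<rho>)\<^sup>2 - 2 * \<rho> * (1 - cos \<phi>)\<close>. Since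
  \<open>(1 + \<rho>)\<^sup>2\<close> lies between 1 and 4, factoring it out leaves at least a
  quarter of the saving and at most all of the perturbation; then
  \<open>1 + a \<le> exp a\<close>.\<close>

lemma norm_pair_gf_le:
  assumes t: "0 \<le> t"
  shows "cmod (pair_gf n v (of_real t - \<i> * of_real \<theta>)) \<le> pair_gf_real n t *
    exp (cmod (exp v + exp (- v) - 2) * (\<Sum>j=1..n. exp (- (real j * t)))
      - (\<Sum>j=1..n. exp (- (real j * t)) * (1 - cos (real j * \<theta>))) / 2)"
proof -
  define y where "y = exp v + exp (- v) - 2"
  have fac: "cmod ((1 + exp (v - w)) * (1 + exp (- v - w))) \<le> (1 + \<rho>)\<^sup>2 * exp (cmod y * \<rho> - \<rho> * (1 - c) / 2)"
    if w: "exp (- w) = of_real \<rho> * cis \<phi>" and \<rho>: "0 < \<rho>" "\<rho> \<le> 1" and c: "c = cos \<phi>" for w \<rho> \<phi> c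
  proof -
    have "(cmod (1 + exp (- w)))\<^sup>2 = (1 + \<rho> * cos \<phi>)\<^sup>2 + (\<rho> * sin \<phi>)\<^sup>2"
      by (simp add: w cmod_power2)
    also have "\<dots> = 1 + 2 * \<rho> * cos \<phi> + \<rho>\<^sup>2 * ((sin \<phi>)\<^sup>2 + (cos \<phi>)\<^sup>2)"
      by algebra
    also have "\<dots> = (1 + \<rho>)\<^sup>2 - 2 * \<rho> * (1 - c)"
      unfolding sin_cos_squared_add c by (simp add: algebra_simps power2_eq_square)
    finally have 1: "(cmod (1 + exp (- w)))\<^sup>2 = (1 + \<rho>)\<^sup>2 - 2 * \<rho> * (1 - c)" .
    have "cmod ((1 + exp (v - w)) * (1 + exp (- v - w))) \<le> (cmod (1 + exp (- w)))\<^sup>2 + cmod y * \<rho>"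
      unfolding pair_gf_factor y_def[symmetric]
      using norm_triangle_ineq[of "(1 + exp (- w))\<^sup>2" "y * exp (- w)"] \<rho>(1)
      by (simp add: w norm_mult norm_power)
    also have "\<dots> \<le> (1 + \<rho>)\<^sup>2 * (1 + (cmod y * \<rho> - \<rho> * (1 - c) / 2))"
    proof -
      have s: "1 \<le> (1 + \<rho>)\<^sup>2" "(1 + \<rho>)\<^sup>2 \<le> 4"
        using \<rho> power_mono[of "1 + \<rho>" 2 2] by (auto simp: power2_eq_square algebra_simps)
      have c1: "0 \<le> 1 - c" using c by simp
      have "1 * (cmod y * \<rho>) \<le> (1 + \<rho>)\<^sup>2 * (cmod y * \<rho>)" using s \<rho> by (intro mult_right_mono) auto
      moreover have "(1 + \<rho>)\<^sup>2 * (\<rho> * (1 - c) / 2) \<le> 4 * (\<rho> * (1 - c) / 2)" using s \<rho> c1 by (intro mult_right_mono) auto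
      moreover have "(1 + \<rho>)\<^sup>2 * (1 + (cmod y * \<rho> - \<rho> * (1 - c) / 2)) = (1 + \<rho>)\<^sup>2
          + (1 + \<rho>)\<^sup>2 * (cmod y * \<rho>) - (1 + \<rho>)\<^sup>2 * (\<rho> * (1 - c) / 2)"
        by (simp only: distrib_left right_diff_distrib mult_1_right add_diff_eq)
      moreover have "2 * \<rho> * (1 - c) = 4 * (\<rho> * (1 - c) / 2)" by simp
      ultimately show ?thesis unfolding 1 by linarith
    qed
    also have "\<dots> \<le> (1 + \<rho>)\<^sup>2 * exp (cmod y * \<rho> - \<rho> * (1 - c) / 2)"
      by (intro mult_left_mono exp_ge_add_one_self) auto
    finally show ?thesis .
  qed
  have "cmod (pair_gf n v (of_real t - \<i> * of_real \<theta>)) \<le> (\<Prod>j=1..n. (1 + exp (- (real j * t)))\<^sup>2 *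
     exp (cmod y * exp (- (real j * t)) - exp (- (real j * t)) * (1 - cos (real j * \<theta>)) / 2))"
    unfolding pair_gf_def prod_norm[symmetric]
  proof (intro prod_mono conjI norm_ge_zero)
    fix j
    have "exp (- (of_nat j * (of_real t - \<i> * of_real \<theta>))) = of_real (exp (- (real j * t))) * cis (real j * \<theta>)"
      unfolding exp_of_real[symmetric] cis_conv_exp exp_add[symmetric]
      by (rule arg_cong[where f = exp]) (simp add: algebra_simps)
    then show "cmod ((1 + exp (v - of_nat j * (of_real t - \<i> * of_real \<theta>))) * (1 + exp (- v - of_nat j * (of_real t - \<i> * of_real \<theta>))))
      \<le> (1 + exp (- (real j * t)))\<^sup>2 * exp (cmod y * exp (- (real j * t)) - exp (- (real j * t)) * (1 - cos (real j * \<theta>)) / 2)"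
      using t by (intro fac) auto
  qed
  also have "\<dots> = pair_gf_real n t * (\<Prod>j=1..n. exp (cmod y * exp (- (real j * t)) - exp (- (real j * t)) * (1 - cos (real j * \<theta>)) / 2))"
    unfolding pair_gf_real_def by (rule prod.distrib)
  also have "(\<Prod>j=1..n. exp (cmod y * exp (- (real j * t)) - exp (- (real j * t)) * (1 - cos (real j * \<theta>)) / 2))
    = exp (\<Sum>j=1..n. cmod y * exp (- (real j * t)) - exp (- (real j * t)) * (1 - cos (real j * \<theta>)) / 2)"
    by (rule exp_sum[symmetric]) simp
  also have "(\<Sum>j=1..n. cmod y * exp (- (real j * t)) - exp (- (real j * t)) * (1 - cos (real j * \<theta>)) / 2)
    = cmod y * (\<Sum>j=1..n. exp (- (real j * t))) - (\<Sum>j=1..n. exp (- (real j * t)) * (1 - cos (real j * \<theta>))) / 2"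
    by (simp only: sum_subtractf sum_distrib_left sum_divide_distrib)
  finally show ?thesis by (simp only: y_def)
qed

text \<open>Fourth-order Taylor: \<open>x\<^sup>2 / 2 - x ^ 4 / 24\<close> with
  \<open>x\<^sup>2 \<le> pi\<^sup>2 \<le> 10\<close> leaves
  \<open>(1 / 2 - 10 / 24) * x\<^sup>2\<close>.\<close>

lemma one_minus_cos_ge:
  fixes x :: real assumes "\<bar>x\<bar> \<le> pi" shows "x\<^sup>2 / 12 \<le> 1 - cos x"
proof -
  obtain s where "cos x = (\<Sum>m<4. cos_coeff m * x ^ m) + (cos (s + 1 / 2 * real 4 * pi) / fact 4) * x ^ 4"
    using Maclaurin_cos_expansion[of x 4] by blast
  moreover have "(\<Sum>m<4. cos_coeff m * x ^ m) = 1 - x\<^sup>2 / 2"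
    by (simp add: cos_coeff_def lessThan_nat_numeral lessThan_Suc)
  moreover have "(cos (s + 1 / 2 * real 4 * pi) / fact 4) * x ^ 4 \<le> 1 / fact 4 * x ^ 4"
    by (intro mult_right_mono divide_right_mono) auto
  moreover have "x ^ 4 \<le> 10 * x\<^sup>2"
  proof -
    have "x\<^sup>2 \<le> pi\<^sup>2" using assms abs_le_square_iff[of x pi] by simp
    also have "pi\<^sup>2 \<le> 3.15\<^sup>2" using pi_approx by (intro power_mono) auto
    finally have "x\<^sup>2 \<le> 10" by (simp add: power2_eq_square)
    then have "x\<^sup>2 * x\<^sup>2 \<le> 10 * x\<^sup>2" by (intro mult_right_mono) auto
    then show ?thesis by (simp add: eval_nat_numeral)
  qed
  ultimately show ?thesis by (simp add: fact_numeral)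
qed

text \<open>The infinite sum is a difference of two geometric series with an explicit value, and the
  terms beyond \<open>n\<close> cost at most \<open>2 * exp (- n * t) / t\<close>. The constant
  \<open>72\<close> is \<open>6 * 12\<close>, from \<open>1 / 6 \<le> \<rho>\<close> and
  \<open>one_minus_cos_ge\<close>.\<close>

lemma sum_exp_one_minus_cos_ge:
  fixes t \<theta> :: real
  assumes t: "0 < t" "t \<le> 3 / 2" and \<theta>: "\<bar>\<theta>\<bar> \<le> pi"
  shows "\<theta>\<^sup>2 / (72 * t * (t\<^sup>2 + \<theta>\<^sup>2)) - 2 * exp (- (real n * t)) / t
    \<le> (\<Sum>j=1..n. exp (- (real j * t)) * (1 - cos (real j * \<theta>)))"
proof -
  define \<rho> u where "\<rho> = exp (- t)" and "u = 1 - cos \<theta>"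
  have \<rho>: "0 < \<rho>" "\<rho> < 1" using t by (auto simp: \<rho>_def)
  have u0: "0 \<le> u" by (simp add: u_def)
  define z where "z = of_real \<rho> * cis \<theta>"
  have z: "cmod z < 1" using \<rho> by (simp add: z_def norm_mult)
  define g where "g j = \<rho> ^ j * (1 - cos (real j * \<theta>))" for j
  have g2: "g j \<le> 2 * \<rho> ^ j" for j
  proof -
    have "1 - cos (real j * \<theta>) \<le> 2" using cos_ge_minus_one[of "real j * \<theta>"] by linarith
    then show ?thesis using \<rho> mult_left_mono[of _ 2 "\<rho> ^ j"] by (simp add: g_def mult.commute)
  qed
  have Rez: "Re (z ^ j) = \<rho> ^ j * cos (real j * \<theta>)" for j
    by (simp add: z_def power_mult_distrib Complex.DeMoivre flip: of_real_power)
  \<comment> \<open>This is the squared modulus of \<open>1 - z\<close>.\<close>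
  define D where "D = (1 - \<rho>)\<^sup>2 + 2 * \<rho> * u"
  have D: "0 < D" using \<rho> u0 by (auto simp: D_def intro!: add_pos_nonneg)
  have "(\<lambda>j. \<rho> ^ j - Re (z ^ j)) sums (1 / (1 - \<rho>) - Re (1 / (1 - z)))"
    using \<rho> z by (intro sums_diff sums_Re geometric_sums) auto
  also have "(\<lambda>j. \<rho> ^ j - Re (z ^ j)) = g" by (auto simp: g_def Rez algebra_simps)
  also have "1 / (1 - \<rho>) - Re (1 / (1 - z)) = \<rho> * (1 + \<rho>) * u / ((1 - \<rho>) * D)"
  proof -
    have "(Re (1 - z))\<^sup>2 + (Im (1 - z))\<^sup>2 = (1 - \<rho> * cos \<theta>)\<^sup>2 + (\<rho> * sin \<theta>)\<^sup>2"
      by (simp add: z_def)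
    also have "\<dots> = 1 - 2 * \<rho> * cos \<theta> + \<rho>\<^sup>2 * ((sin \<theta>)\<^sup>2 + (cos \<theta>)\<^sup>2)"
      by algebra
    also have "\<dots> = D" unfolding sin_cos_squared_add D_def u_def by (simp add: algebra_simps power2_eq_square)
    finally have "Re (1 / (1 - z)) = (1 - \<rho> * cos \<theta>) / D" by (simp add: Re_divide z_def)
    also have "1 / (1 - \<rho>) - (1 - \<rho> * cos \<theta>) / D = (D - (1 - \<rho>) * (1 - \<rho> * cos \<theta>)) / ((1 - \<rho>) * D)"
      using D \<rho> by (simp add: field_simps)
    also have "D - (1 - \<rho>) * (1 - \<rho> * cos \<theta>) = \<rho> * (1 + \<rho>) * u"
      unfolding D_def u_def by (simp add: algebra_simps power2_eq_square)
    finally show ?thesis .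
  qed
  finally have gs: "g sums (\<rho> * (1 + \<rho>) * u / ((1 - \<rho>) * D))" .
  have tail: "(\<Sum>j. g (j + Suc n)) \<le> 2 * exp (- (real n * t)) / t"
  proof -
    have s2: "(\<lambda>j. 2 * \<rho> ^ Suc n * \<rho> ^ j) sums (2 * \<rho> ^ Suc n * (1 / (1 - \<rho>)))"
      using \<rho> by (intro sums_mult geometric_sums) auto
    have "(\<Sum>j. g (j + Suc n)) \<le> 2 * \<rho> ^ Suc n * (1 / (1 - \<rho>))"
      unfolding sums_unique[OF s2]
    proof (rule suminf_le)
      show "g (j + Suc n) \<le> 2 * \<rho> ^ Suc n * \<rho> ^ j" for j
        using g2[of "j + Suc n"] by (simp add: power_add mult_ac)
      show "summable (\<lambda>j. g (j + Suc n))"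
        using sums_summable[OF gs] by (rule summable_ignore_initial_segment)
    qed (use s2 in \<open>rule sums_summable\<close>)
    also have "\<dots> = 2 * \<rho> ^ n * (\<rho> / (1 - \<rho>))" by simp
    also have "\<dots> \<le> 2 * \<rho> ^ n * (1 / t)"
      unfolding \<rho>_def by (intro mult_left_mono exp_geometric_le t) auto
    also have "\<rho> ^ n = exp (- (real n * t))" unfolding \<rho>_def by (simp flip: exp_of_nat_mult)
    finally show ?thesis by simp
  qed
  have "(\<Sum>j=1..n. exp (- (real j * t)) * (1 - cos (real j * \<theta>))) = (\<Sum>j<Suc n. g j)"
  proof -
    have "(\<Sum>j<Suc n. g j) = (\<Sum>j\<in>{1..n}. g j)"
      by (intro sum.mono_neutral_right) (auto simp: g_def Suc_le_eq)
    then show ?thesis by (simp add: g_def \<rho>_def flip: exp_of_nat_mult)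
  qed
  also have "\<dots> = \<rho> * (1 + \<rho>) * u / ((1 - \<rho>) * D) - (\<Sum>j. g (j + Suc n))"
    using suminf_split_initial_segment[OF sums_summable[OF gs], of "Suc n"] sums_unique[OF gs] by simp
  finally have 1: "(\<Sum>j=1..n. exp (- (real j * t)) * (1 - cos (real j * \<theta>))) \<ge>
     \<rho> * (1 + \<rho>) * u / ((1 - \<rho>) * D) - 2 * exp (- (real n * t)) / t" using tail by simp
  have "\<theta>\<^sup>2 / (72 * t * (t\<^sup>2 + \<theta>\<^sup>2)) \<le> \<rho> * (1 + \<rho>) * u / ((1 - \<rho>) * D)"
  proof (cases "\<theta> = 0")
    case False
    have \<rho>6: "1 / 6 \<le> \<rho>"
    proof -
      have "exp (3 / 2 :: real) = exp (1 / 2) ^ 3" by (simp flip: exp_of_nat_mult)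
      also have "\<dots> \<le> (7 / 4) ^ 3"
      proof (intro power_mono)
        have "exp (1 / 2 :: real) \<le> 1 + 1/2 + (1/2)\<^sup>2" by (rule exp_bound) auto
        then show "exp (1 / 2 :: real) \<le> 7 / 4" by (simp add: power2_eq_square)
      qed auto
      finally have "exp (3 / 2 :: real) \<le> 6" by (simp add: power3_eq_cube)
      moreover have "exp t \<le> exp (3 / 2)" using t by simp
      ultimately have "exp t \<le> 6" by linarith
      then show ?thesis by (simp add: \<rho>_def exp_minus field_simps)
    qed
    have \<rho>t: "1 - \<rho> \<le> t" using exp_ge_add_one_self[of "- t"] by (simp add: \<rho>_def)
    have u12: "\<theta>\<^sup>2 / 12 \<le> u" unfolding u_def by (rule one_minus_cos_ge[OF \<theta>])
    have \<theta>0: "0 < \<theta>\<^sup>2" using False by simp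
    have upos: "0 < u" using u12 \<theta>0 by linarith
    have "D \<le> t\<^sup>2 + 2 * u"
    proof -
      have "(1 - \<rho>)\<^sup>2 \<le> t\<^sup>2" using \<rho> \<rho>t by (intro power_mono) auto
      moreover have "2 * \<rho> * u \<le> 2 * u" using \<rho> u0 by (simp add: mult_left_le_one_le)
      ultimately show ?thesis by (simp add: D_def)
    qed
    then have "(1 - \<rho>) * D \<le> t * (t\<^sup>2 + 2 * u)" using \<rho> \<rho>t D t by (intro mult_mono) auto
    moreover have "1 / 6 * u \<le> \<rho> * (1 + \<rho>) * u"
    proof (intro mult_right_mono u0)
      have "1 / 6 * 1 \<le> \<rho> * (1 + \<rho>)" using \<rho>6 \<rho> by (intro mult_mono) auto
      then show "1 / 6 \<le> \<rho> * (1 + \<rho>)" by simp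
    qed
    ultimately have "(1 / 6 * u) / (t * (t\<^sup>2 + 2 * u)) \<le> \<rho> * (1 + \<rho>) * u / ((1 - \<rho>) * D)"
      using \<rho> D u0 by (intro frac_le) auto
    \<comment> \<open>The right side increases with \<open>u\<close>, and \<open>u\<close> is at
      least \<open>\<theta>\<^sup>2 / 12\<close>.\<close>
    moreover have "\<theta>\<^sup>2 / 12 / (t\<^sup>2 + \<theta>\<^sup>2) \<le> u / (t\<^sup>2 + 2 * u)"
    proof -
      have "\<theta>\<^sup>2 / 12 * (t\<^sup>2 + 2 * u) \<le> u * (t\<^sup>2 + \<theta>\<^sup>2)"
      proof -
        have "\<theta>\<^sup>2 / 12 * t\<^sup>2 \<le> u * t\<^sup>2" using u12 by (intro mult_right_mono) auto
        moreover have "\<theta>\<^sup>2 / 12 * (2 * u) \<le> u * \<theta>\<^sup>2" using u0 by (simp add: field_simps)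
        ultimately show ?thesis by (simp add: ring_distribs)
      qed
      moreover have "0 < t\<^sup>2 + \<theta>\<^sup>2" "0 < t\<^sup>2 + 2 * u" using t upos \<theta>0 by (simp_all add: add_pos_pos)
      ultimately show ?thesis by (simp only: frac_le_eq) (simp add: divide_nonpos_pos mult_pos_pos)
    qed
    then have "1 / (6 * t) * (\<theta>\<^sup>2 / 12 / (t\<^sup>2 + \<theta>\<^sup>2)) \<le> 1 / (6 * t) * (u / (t\<^sup>2 + 2 * u))"
      using t by (intro mult_left_mono) auto
    ultimately show ?thesis by (simp add: mult_ac)
  qed (use \<rho> D u0 in simp)
  then show ?thesis using 1 by linarith
qed

section \<open>The saddle point\<close>

text \<open>The exponent \<open>n * t + pi\<^sup>2 / (6 * t)\<close> is minimal at \<open>t = saddle n\<close>; the Gaussian peak of the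
  Fourier integrand has width of order \<open>width n\<close>.\<close>

definition saddle :: "nat \<Rightarrow> real" where "saddle n = pi / sqrt (6 * real n)"
definition width :: "nat \<Rightarrow> real" where "width n = saddle n * sqrt (saddle n)"

text \<open>Dividing by \<open>1 / width n\<close> instead of multiplying keeps the literal shape of
  \<open>Fourier_pair_gf\<close> at \<open>K = 1 / width n\<close>.\<close>

definition pair_integrand :: "nat \<Rightarrow> complex \<Rightarrow> real \<Rightarrow> complex" where
  "pair_integrand n s x = indicator {- (pi * (1 / width n))..pi * (1 / width n)} x *\<^sub>R
     (pair_gf n (s * of_real (sqrt (saddle n))) (of_real (saddle n) - \<i> * of_real (x / (1 / width n)))
        * exp (- (\<i> * of_nat n * of_real (x / (1 / width n))))) / of_real (pair_gf_real n (saddle n))"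

lemma saddle_pos: "0 < n \<Longrightarrow> 0 < saddle n"
  by (simp add: saddle_def)

lemma width_pos: "0 < n \<Longrightarrow> 0 < width n"
  by (simp add: width_def saddle_pos)

lemma n_saddle_sq: "0 < n \<Longrightarrow> real n * (saddle n)\<^sup>2 = pi\<^sup>2 / 6"
  by (simp add: saddle_def power_divide)

lemma saddle_le: "0 < n \<Longrightarrow> saddle n \<le> 3 / 2"
proof -
  assume n: "0 < n"
  have "1 * (saddle n)\<^sup>2 \<le> real n * (saddle n)\<^sup>2" using n by (intro mult_right_mono) auto
  also have "\<dots> \<le> 3.15\<^sup>2 / 6" unfolding n_saddle_sq[OF n] using pi_approx by (intro divide_right_mono power_mono) auto
  also have "\<dots> \<le> (3 / 2)\<^sup>2" by (simp add: power2_eq_square)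
  finally show ?thesis by (simp add: abs_le_square_iff[symmetric])
qed

lemma saddle_tendsto_0: "saddle \<longlonglongrightarrow> 0"
  unfolding saddle_def[abs_def] by real_asymp

lemma saddle_tail: "(\<lambda>n. exp (- (real n * saddle n)) / saddle n) \<longlonglongrightarrow> 0"
  unfolding saddle_def[abs_def] by real_asymp

section \<open>An integrable majorant for the normalised integrand\<close>

lemma norm_exp_minus_1_le: "cmod (exp v - 1) \<le> cmod v * exp (cmod v)"
proof -
  have "cmod (exp v - exp 0) \<le> exp (cmod v) * cmod (v - 0)"
  proof (rule field_differentiable_bound[where S = "cball 0 (cmod v)" and f' = exp])
    show "cmod (exp z) \<le> exp (cmod v)" if "z \<in> cball 0 (cmod v)" for z
      using that complex_Re_le_cmod[of z] by simp
  qed (auto intro!: derivative_eq_intros)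
  then show ?thesis by (simp add: mult.commute)
qed

text \<open>Exhibits the double zero at \<open>v = 0\<close>.\<close>

lemma exp_second_difference: "exp v + exp (- v) - 2 = exp (- v) * (exp v - 1)\<^sup>2" for v :: complex
proof -
  have "exp v * exp (- v) = 1" by (simp flip: exp_add)
  then show ?thesis by algebra
qed

lemma norm_exp_second_difference_le: "cmod (exp v + exp (- v) - 2) \<le> (cmod v)\<^sup>2 * exp (3 * cmod v)"
proof -
  have "cmod (exp (- v)) \<le> exp (cmod v)" using abs_Re_le_cmod[of v] by simp
  then have "cmod (exp (- v) * (exp v - 1)\<^sup>2) \<le> exp (cmod v) * (cmod v * exp (cmod v))\<^sup>2"
    unfolding norm_mult norm_power by (intro mult_mono power_mono norm_exp_minus_1_le) auto
  also have "\<dots> = (cmod v)\<^sup>2 * exp (cmod v + (cmod v + cmod v))"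
    unfolding exp_add by (simp add: power2_eq_square)
  finally show ?thesis by (simp add: exp_second_difference)
qed

text \<open>The exponent is Gaussian while \<open>x\<^sup>2 * t \<le> 1\<close> and then saturates
  at about \<open>1 / t\<close>. In the second regime \<open>exp (- w) \<le> 27 / w ^ 3\<close>
  supplies a factor \<open>t ^ 3\<close>, and \<open>x\<^sup>2 * t ^ 3 \<le> 10\<close>, which
  expresses \<open>\<bar>\<theta>\<bar> \<le> pi\<close>, trades it for
  \<open>1 / x\<^sup>2\<close>. The constant \<open>675\<close> is \<open>27 * 25\<close>.\<close>

lemma exp_neg_ratio_bound:
  fixes x t :: real
  assumes t: "0 < t" "t \<le> 3 / 2" and x: "x\<^sup>2 * t ^ 3 \<le> 10"
  shows "exp (- (x\<^sup>2 / (144 * (1 + x\<^sup>2 * t)))) \<le> (675 * 288 ^ 3) / (1 + x\<^sup>2)"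
proof (cases "x\<^sup>2 * t \<le> 1")
  case True
  have "(1 + x\<^sup>2) / 288 \<le> 1 + x\<^sup>2 / 288" by simp
  also have "x\<^sup>2 / 288 \<le> x\<^sup>2 / (144 * (1 + x\<^sup>2 * t))"
    using True t by (intro divide_left_mono) (auto intro!: mult_pos_pos add_pos_nonneg)
  also have "1 + x\<^sup>2 / (144 * (1 + x\<^sup>2 * t)) \<le> exp (x\<^sup>2 / (144 * (1 + x\<^sup>2 * t)))" by (rule exp_ge_add_one_self)
  finally have le: "(1 + x\<^sup>2) / 288 \<le> exp (x\<^sup>2 / (144 * (1 + x\<^sup>2 * t)))" by simp
  have p: "0 < (1 + x\<^sup>2) / 288" by (simp add: add_pos_nonneg)
  have "exp (- (x\<^sup>2 / (144 * (1 + x\<^sup>2 * t)))) \<le> 288 / (1 + x\<^sup>2)"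
    using le_imp_inverse_le[OF le p] by (simp add: exp_minus)
  also have "\<dots> \<le> (675 * 288 ^ 3) / (1 + x\<^sup>2)" by (intro divide_right_mono) auto
  finally show ?thesis .
next
  case False
  have xt: "1 < x\<^sup>2 * t" using False by simp
  then have x0: "0 < x\<^sup>2" using t by (cases "x = 0") auto
  define w where "w = 1 / (288 * t)"
  have w0: "0 < w" using t by (simp add: w_def)
  have "w \<le> x\<^sup>2 / (144 * (1 + x\<^sup>2 * t))"
  proof -
    have "x\<^sup>2 / (144 * (x\<^sup>2 * t + x\<^sup>2 * t)) \<le> x\<^sup>2 / (144 * (1 + x\<^sup>2 * t))"
      using xt x0 t by (intro divide_left_mono) (auto simp: mult.commute intro!: mult_pos_pos add_pos_pos)
    moreover have "x\<^sup>2 / (144 * (x\<^sup>2 * t + x\<^sup>2 * t)) = w" using x0 by (simp add: w_def field_simps)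
    ultimately show ?thesis by simp
  qed
  then have "exp (- (x\<^sup>2 / (144 * (1 + x\<^sup>2 * t)))) \<le> exp (- w)" by simp
  also have "\<dots> \<le> 27 / w ^ 3"
  proof -
    have "w / 3 \<le> exp (w / 3)" using exp_ge_add_one_self[of "w / 3"] by linarith
    then have "(w / 3) ^ 3 \<le> exp (w / 3) ^ 3" using w0 by (intro power_mono) auto
    also have "\<dots> = exp w" by (simp flip: exp_of_nat_mult)
    finally have le: "w ^ 3 / 27 \<le> exp w" by (simp add: power_divide)
    show ?thesis using le_imp_inverse_le[OF le] w0 by (simp add: exp_minus)
  qed
  also have "\<dots> = 27 * 288 ^ 3 * t ^ 3" using t by (simp add: w_def power_divide power_mult_distrib)
  also have "\<dots> \<le> 27 * 288 ^ 3 * (10 / x\<^sup>2)"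
    using x x0 by (intro mult_left_mono) (simp_all add: field_simps)
  \<comment> \<open>\<open>x\<^sup>2 * t > 1\<close> and \<open>t \<le> 3 / 2\<close> force
    \<open>x\<^sup>2 > 2 / 3\<close>.\<close>
  also have "10 / x\<^sup>2 \<le> 25 / (1 + x\<^sup>2)"
  proof -
    have "x\<^sup>2 * t \<le> x\<^sup>2 * (3 / 2)" using t x0 by (intro mult_left_mono) auto
    then have "10 * (1 + x\<^sup>2) \<le> 25 * x\<^sup>2" using xt by simp
    then show ?thesis using x0 by (simp add: field_simps)
  qed
  finally show ?thesis by simp
qed

text \<open>With \<open>v\<close> of size \<open>sqrt t\<close> the perturbation \<open>y\<close> is
  at most \<open>t * exp 6\<close>, while the sum it multiplies is at most \<open>1 / t\<close>:
  this is the \<open>exp 6\<close> in the constant. The added 1 pays for the truncation of the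
  cosine sum at \<open>n\<close>.\<close>

lemma norm_pair_integrand_le:
  assumes n: "0 < n" and s: "cmod s \<le> 1"
  shows "cmod (pair_integrand n s x) \<le> exp (exp 6 + 1) * (675 * 288 ^ 3) * inverse (1 + x\<^sup>2)"
proof (cases "\<bar>x\<bar> * width n \<le> pi")
  case False
  then have "x \<notin> {- (pi * (1 / width n))..pi * (1 / width n)}"
    using width_pos[OF n] by (auto simp: field_simps abs_if split: if_splits)
  then show ?thesis by (simp add: pair_integrand_def)
next
  case True
  define t \<theta> where "t = saddle n" and "\<theta> = x * width n"
  define v where "v = s * of_real (sqrt t)"
  note t = saddle_pos[OF n, folded t_def] saddle_le[OF n, folded t_def]
  have \<theta>: "\<bar>\<theta>\<bar> \<le> pi" using True width_pos[OF n] by (simp add: \<theta>_def abs_mult)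
  have \<theta>2: "\<theta>\<^sup>2 = x\<^sup>2 * t ^ 3" using t by (simp add: \<theta>_def width_def t_def power_mult_distrib power3_eq_cube power2_eq_square)
  have x3: "x\<^sup>2 * t ^ 3 \<le> 10"
  proof -
    have "\<theta>\<^sup>2 \<le> pi\<^sup>2" using \<theta> abs_le_square_iff[of \<theta> pi] by simp
    also have "pi\<^sup>2 \<le> 3.15\<^sup>2" using pi_approx by (intro power_mono) auto
    finally show ?thesis unfolding \<theta>2 by (simp add: power2_eq_square)
  qed
  define y where "y = exp v + exp (- v) - 2"
  have y: "cmod y \<le> t * exp 6"
  proof -
    have sv: "cmod v \<le> sqrt t" using s t by (simp add: v_def norm_mult mult_left_le_one_le)
    have "sqrt t \<le> sqrt 4" using t by (intro real_sqrt_le_mono) auto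
    then have "cmod v \<le> 2" using sv by simp
    then have "(cmod v)\<^sup>2 * exp (3 * cmod v) \<le> (sqrt t)\<^sup>2 * exp 6"
      using sv t by (intro mult_mono power_mono) auto
    then show ?thesis using norm_exp_second_difference_le[of v] t by (simp add: y_def)
  qed
  have yS: "cmod y * (\<Sum>j=1..n. exp (- (real j * t))) \<le> exp 6"
  proof -
    have "cmod y * (\<Sum>j=1..n. exp (- (real j * t))) \<le> (t * exp 6) * (1 / t)"
      using y sum_exp_le[OF t(1)] t by (intro mult_mono sum_nonneg) auto
    then show ?thesis using t by simp
  qed
  have tail: "exp (- (real n * t)) / t \<le> 1"
  proof -
    \<comment> \<open>The saddle equation makes \<open>n * t\<close> at least \<open>1 / t\<close>,
      so the exponential absorbs the division by \<open>t\<close>.\<close>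
    have "real n * t = pi\<^sup>2 / 6 / t" using n_saddle_sq[OF n] t by (simp add: t_def field_simps power2_eq_square)
    moreover have "1 \<le> pi\<^sup>2 / 6"
    proof -
      have "3\<^sup>2 \<le> pi\<^sup>2" using pi_approx by (intro power_mono) auto
      then show ?thesis by simp
    qed
    ultimately have "1 / t \<le> real n * t" using t divide_right_mono[of 1 "pi\<^sup>2 / 6" t] by simp
    also have "\<dots> \<le> exp (real n * t)" using exp_ge_add_one_self[of "real n * t"] by linarith
    finally show ?thesis using t by (simp add: exp_minus field_simps)
  qed
  have "x / (1 / width n) = \<theta>" by (simp add: \<theta>_def)
  then have "cmod (pair_integrand n s x) \<le> cmod (pair_gf n v (of_real t - \<i> * of_real \<theta>)) / pair_gf_real n t"
    using pair_gf_real_pos[of n t]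
    by (auto simp: pair_integrand_def norm_mult norm_divide t_def v_def indicator_def)
  also have "\<dots> \<le> exp (cmod y * (\<Sum>j=1..n. exp (- (real j * t)))
      - (\<Sum>j=1..n. exp (- (real j * t)) * (1 - cos (real j * \<theta>))) / 2)"
    using norm_pair_gf_le[of t n v \<theta>] t pair_gf_real_pos[of n t] by (simp add: y_def divide_le_eq mult.commute)
  also have "\<dots> \<le> exp ((exp 6 + 1) + - (x\<^sup>2 / (144 * (1 + x\<^sup>2 * t))))"
  proof -
    have "\<theta>\<^sup>2 / (72 * t * (t\<^sup>2 + \<theta>\<^sup>2)) = 2 * (x\<^sup>2 / (144 * (1 + x\<^sup>2 * t)))"
    proof -
      have "72 * t * (t\<^sup>2 + \<theta>\<^sup>2) = t ^ 3 * (72 * (1 + x\<^sup>2 * t))"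
        unfolding \<theta>2 by (simp add: algebra_simps power3_eq_cube power2_eq_square)
      moreover have "x\<^sup>2 * t ^ 3 / (t ^ 3 * (72 * q)) = 2 * (x\<^sup>2 / (144 * q))" for q
        using t by simp
      ultimately show ?thesis unfolding \<theta>2 by (simp only:)
    qed
    then show ?thesis using yS tail sum_exp_one_minus_cos_ge[OF t \<theta>, of n] by simp
  qed
  also have "\<dots> = exp (exp 6 + 1) * exp (- (x\<^sup>2 / (144 * (1 + x\<^sup>2 * t))))" by (rule exp_add)
  also have "\<dots> \<le> exp (exp 6 + 1) * ((675 * 288 ^ 3) / (1 + x\<^sup>2))"
    by (intro mult_left_mono exp_neg_ratio_bound t x3) auto
  finally show ?thesis by (simp add: divide_inverse mult.assoc)
qed

section \<open>The pointwise limit of the integrand\<close>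

text \<open>\<open>ln (1 + z)\<close> differs from \<open>z\<close> by at most
  \<open>2 * (cmod z)\<^sup>2\<close> for \<open>cmod z \<le> 1 / 2\<close>, and these squares sum
  to something vanishing.\<close>

lemma prod_one_plus_tendsto_exp:
  fixes z :: "nat \<Rightarrow> nat \<Rightarrow> complex"
  assumes S: "(\<lambda>n. \<Sum>j\<in>J n. z n j) \<longlonglongrightarrow> L"
    and Q: "(\<lambda>n. \<Sum>j\<in>J n. (cmod (z n j))\<^sup>2) \<longlonglongrightarrow> 0"
    and small: "eventually (\<lambda>n. \<forall>j\<in>J n. cmod (z n j) \<le> 1 / 2) sequentially"
    and fin: "\<And>n. finite (J n)"
  shows "(\<lambda>n. \<Prod>j\<in>J n. 1 + z n j) \<longlonglongrightarrow> exp L"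
proof -
  have "(\<lambda>n. (\<Sum>j\<in>J n. ln (1 + z n j)) - (\<Sum>j\<in>J n. z n j)) \<longlonglongrightarrow> 0"
  proof (rule Lim_null_comparison)
    show "(\<lambda>n. 2 * (\<Sum>j\<in>J n. (cmod (z n j))\<^sup>2)) \<longlonglongrightarrow> 0" using tendsto_mult_left[OF Q, of 2] by simp
    show "eventually (\<lambda>n. cmod ((\<Sum>j\<in>J n. ln (1 + z n j)) - (\<Sum>j\<in>J n. z n j)) \<le> 2 * (\<Sum>j\<in>J n. (cmod (z n j))\<^sup>2)) sequentially"
      using small
    proof eventually_elim
      case (elim n)
      have "cmod (\<Sum>j\<in>J n. ln (1 + z n j) - z n j) \<le> (\<Sum>j\<in>J n. 2 * (cmod (z n j))\<^sup>2)"
      proof (rule sum_norm_le)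
        fix j assume j: "j \<in> J n"
        have "cmod (ln (1 + z n j) - z n j) \<le> (cmod (z n j))\<^sup>2 / (1 - cmod (z n j))"
          using elim j by (intro Ln_approx_linear) force
        also have "\<dots> \<le> (cmod (z n j))\<^sup>2 / (1 / 2)" using elim j by (intro divide_left_mono) (force intro!: mult_pos_pos)+
        finally show "cmod (ln (1 + z n j) - z n j) \<le> 2 * (cmod (z n j))\<^sup>2" by simp
      qed
      then show ?case by (simp add: sum_subtractf sum_distrib_left)
    qed
  qed
  from tendsto_exp[OF tendsto_add[OF this S]]
  have "(\<lambda>n. exp (\<Sum>j\<in>J n. ln (1 + z n j))) \<longlonglongrightarrow> exp L" by simp
  moreover have "eventually (\<lambda>n. exp (\<Sum>j\<in>J n. ln (1 + z n j)) = (\<Prod>j\<in>J n. 1 + z n j)) sequentially"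
    using small
  proof eventually_elim
    case (elim n)
    have "1 + z n j \<noteq> 0" if "j \<in> J n" for j
    proof
      assume "1 + z n j = 0"
      then have "z n j = - 1" by (simp add: add_eq_0_iff)
      then show False using elim that by force
    qed
    then show ?case using fin by (simp add: exp_sum)
  qed
  ultimately show ?thesis by (rule Lim_transform_eventually)
qed

lemma prod_eq_exp_softplus:
  assumes z: "z \<in> sector"
  shows "(\<Prod>j=1..n. (1 + exp (- (of_nat j * z)))\<^sup>2) = exp (2 * (\<Sum>j=1..n. softplus (of_nat j * z)))"
proof -
  have "(1 + exp (- (of_nat j * z)))\<^sup>2 = exp (2 * softplus (of_nat j * z))" for j
  proof -
    have "1 + exp (- (of_nat j * z)) \<noteq> 0"
      using z by (intro one_plus_exp_neq_0 sector_subset_wide_sector of_nat_mult_sector)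
    then show ?thesis by (simp add: softplus_def exp_double)
  qed
  then show ?thesis by (simp only: sum_distrib_left exp_sum finite_atLeastAtMost)
qed

lemma pair_gf_eq:
  assumes z: "z \<in> sector"
  shows "pair_gf n v z = exp (2 * (\<Sum>j=1..n. softplus (of_nat j * z))) *
    (\<Prod>j=1..n. 1 + (exp v + exp (- v) - 2) * softplus2 (of_nat j * z))"
proof -
  have "pair_gf n v z = (\<Prod>j=1..n. (1 + exp (- (of_nat j * z)))\<^sup>2 * (1 + (exp v + exp (- v) - 2) * softplus2 (of_nat j * z)))"
    unfolding pair_gf_def
  proof (rule prod.cong[OF refl])
    fix j
    have "1 + exp (- (of_nat j * z)) \<noteq> 0"
      using z by (intro one_plus_exp_neq_0 sector_subset_wide_sector of_nat_mult_sector)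
    then show "(1 + exp (v - of_nat j * z)) * (1 + exp (- v - of_nat j * z)) =
      (1 + exp (- (of_nat j * z)))\<^sup>2 * (1 + (exp v + exp (- v) - 2) * softplus2 (of_nat j * z))"
      unfolding pair_gf_factor softplus2_def by (simp add: distrib_left)
  qed
  then show ?thesis by (simp only: prod.distrib prod_eq_exp_softplus[OF z])
qed

lemma pair_gf_real_eq:
  assumes t: "0 \<le> t"
  shows "of_real (pair_gf_real n t) = exp (2 * (\<Sum>j=1..n. softplus (of_nat j * of_real t)))"
proof -
  have "of_real (pair_gf_real n t) = (\<Prod>j=1..n. (1 + exp (- (of_nat j * of_real t :: complex)))\<^sup>2)"
    by (simp add: pair_gf_real_def flip: exp_of_real)
  also have "\<dots> = exp (2 * (\<Sum>j=1..n. softplus (of_nat j * of_real t)))"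
    using t by (intro prod_eq_exp_softplus) (simp add: sector_def)
  finally show ?thesis .
qed

lemma saddle_sector: "eventually (\<lambda>n. of_real (saddle n) \<in> sector \<and> 0 < Re (of_real (saddle n))) sequentially"
  using eventually_gt_at_top[of 0] by eventually_elim (auto simp: sector_def saddle_pos less_imp_le)

lemma sum_softplus_saddle:
  "(\<lambda>n. (\<Sum>j=1..n. softplus (of_nat j * of_real (saddle n))) - of_real (pi\<^sup>2 / 12) / of_real (saddle n))
    \<longlonglongrightarrow> - of_real (ln 2 / 2)"
proof (rule sum_softplus_asymptotics[OF saddle_sector])
  show "(\<lambda>n. complex_of_real (saddle n)) \<longlonglongrightarrow> 0" using tendsto_of_real[OF saddle_tendsto_0] by simp
qed (use saddle_tail in simp)

lemma exp_second_difference_tendsto: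
  fixes s :: complex
  assumes r: "r \<longlonglongrightarrow> 0" "eventually (\<lambda>n. r n \<noteq> 0) sequentially"
  shows "(\<lambda>n. (exp (s * r n) + exp (- (s * r n)) - 2) / (r n)\<^sup>2) \<longlonglongrightarrow> s\<^sup>2"
proof -
  have "((\<lambda>h. exp (s * h)) has_field_derivative s) (at 0)"
    by (auto intro!: derivative_eq_intros)
  then have "(\<lambda>h. (exp (s * h) - 1) / h) \<midarrow>0\<rightarrow> s" by (simp add: DERIV_def)
  then have 1: "(\<lambda>n. (exp (s * r n) - 1) / r n) \<longlonglongrightarrow> s"
    by (rule filterlim_compose) (use r in \<open>simp add: filterlim_at\<close>)
  have "(\<lambda>n. exp (- (s * r n)) * ((exp (s * r n) - 1) / r n)\<^sup>2) \<longlonglongrightarrow> exp (- (s * 0)) * s\<^sup>2"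
    by (intro tendsto_intros 1 r)
  then show ?thesis by (simp add: exp_second_difference power_divide)
qed

text \<open>Put \<open>w = 1 - \<i> * x * sqrt t\<close> and \<open>a = pi\<^sup>2 / 12\<close>.
  Relative to the centre, the exponent is \<open>2 * a * (1 / w - 1 - (1 - w)) / t\<close>: the
  linear term cancels because \<open>n * t\<^sup>2 = 2 * a\<close>, and
  \<open>2 * a * (1 - w)\<^sup>2 / (t * w) = - 2 * a * x\<^sup>2 / w\<close> remains, tending to
  \<open>- pi\<^sup>2 * x\<^sup>2 / 6\<close>. The constants \<open>ln 2\<close> cancel. The
  dependence on \<open>s\<close> separates into the product \<open>P\<close>.\<close>

lemma pair_integrand_tendsto:
  fixes s :: complex and x :: real
  shows "(\<lambda>n. pair_integrand n s x) \<longlonglongrightarrow> exp (s\<^sup>2 / 2) * of_real (exp (- (pi\<^sup>2 * x\<^sup>2 / 6)))"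
proof -
  define t where "t = saddle"
  define r where "r n = complex_of_real (sqrt (t n))" for n
  define T where "T n = of_real (t n) * (1 - \<i> * of_real x * r n)" for n
  define y where "y n = exp (s * r n) + exp (- (s * r n)) - 2" for n
  have ev: "eventually (\<lambda>n :: nat. 0 < n) sequentially" by (rule eventually_gt_at_top)
  have t0: "t \<longlonglongrightarrow> 0" unfolding t_def by (rule saddle_tendsto_0)
  have sq0: "(\<lambda>n. sqrt (t n)) \<longlonglongrightarrow> 0" using tendsto_real_sqrt[OF t0] by simp
  have r0: "r \<longlonglongrightarrow> 0" unfolding r_def using tendsto_of_real[OF sq0] by simp
  have rn0: "eventually (\<lambda>n. r n \<noteq> 0) sequentially"
    using ev by eventually_elim (metis r_def t_def saddle_pos of_real_eq_0_iff real_sqrt_eq_zero_cancel_iff less_irrefl)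
  have r2: "(r n)\<^sup>2 = of_real (t n)" if "0 < n" for n
    using saddle_pos[OF that] by (simp add: r_def t_def flip: of_real_power)
  have ReT: "Re (T n) = t n" and ImT: "Im (T n) = - (x * (t n * sqrt (t n)))" for n
    by (simp_all add: T_def r_def)
  have T0: "T \<longlonglongrightarrow> 0"
  proof -
    have "T \<longlonglongrightarrow> of_real 0 * (1 - \<i> * of_real x * 0)" unfolding T_def by (intro tendsto_intros t0 r0)
    then show ?thesis by simp
  qed
  have xsq: "eventually (\<lambda>n. \<bar>x * sqrt (t n)\<bar> < 1) sequentially"
  proof -
    have "(\<lambda>n. x * sqrt (t n)) \<longlonglongrightarrow> 0" using tendsto_mult_left[OF sq0, of x] by simp
    from tendstoD[OF this, of 1] show ?thesis by (simp add: dist_real_def)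
  qed
  have t1: "eventually (\<lambda>n. dist (t n) 0 < 1) sequentially" using t0 by (rule tendstoD) simp
  have sec: "eventually (\<lambda>n. T n \<in> sector \<and> 0 < Re (T n)) sequentially"
    using ev xsq
  proof eventually_elim
    case (elim n)
    then have t: "0 < t n" by (simp add: t_def saddle_pos)
    have "\<bar>Im (T n)\<bar> = \<bar>x * sqrt (t n)\<bar> * t n" using t by (simp add: ImT abs_mult)
    also have "\<dots> \<le> 1 * t n" using elim t by (intro mult_right_mono) auto
    finally show ?case using t by (simp add: sector_def ReT)
  qed
  have tail: "(\<lambda>n. exp (- (real n * Re (T n))) / Re (T n)) \<longlonglongrightarrow> 0"
    unfolding ReT t_def by (rule saddle_tail)
  have Tn0: "eventually (\<lambda>n. T n \<noteq> 0) sequentially" using sec by eventually_elim auto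
  define S S' where "S n = (\<Sum>j=1..n. softplus (of_nat j * T n))" 
    and "S' n = (\<Sum>j=1..n. softplus (of_nat j * of_real (t n)))" for n
  define P where "P n = (\<Prod>j=1..n. 1 + y n * softplus2 (of_nat j * T n))" for n
  define a where "a = complex_of_real (pi\<^sup>2 / 12)"
  have w1: "(\<lambda>n. 1 - \<i> * of_real x * r n) \<longlonglongrightarrow> 1"
  proof -
    have "(\<lambda>n. 1 - \<i> * of_real x * r n) \<longlonglongrightarrow> 1 - \<i> * of_real x * 0" by (intro tendsto_intros r0)
    then show ?thesis by simp
  qed
  have main: "(\<lambda>n. 2 * S n - 2 * S' n - \<i> * of_nat n * of_real (x * width n)) \<longlonglongrightarrow> - of_real (pi\<^sup>2 * x\<^sup>2 / 6)"
  proof -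
    have 1: "(\<lambda>n. S n - a / T n) \<longlonglongrightarrow> - of_real (ln 2 / 2)"
      unfolding S_def a_def by (rule sum_softplus_asymptotics[OF sec T0 tail])
    have 2: "(\<lambda>n. S' n - a / of_real (t n)) \<longlonglongrightarrow> - of_real (ln 2 / 2)"
      unfolding S'_def a_def t_def by (rule sum_softplus_saddle)
    have 3: "(\<lambda>n. - 2 * a * of_real (x\<^sup>2) / (1 - \<i> * of_real x * r n)) \<longlonglongrightarrow> - 2 * a * of_real (x\<^sup>2) / 1"
      by (intro tendsto_intros w1) auto
    have lim: "(\<lambda>n. 2 * (S n - a / T n) - 2 * (S' n - a / of_real (t n)) + - 2 * a * of_real (x\<^sup>2) / (1 - \<i> * of_real x * r n))
       \<longlonglongrightarrow> 2 * (- of_real (ln 2 / 2)) - 2 * (- of_real (ln 2 / 2)) + - 2 * a * of_real (x\<^sup>2) / 1"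
      by (intro tendsto_add tendsto_diff tendsto_mult tendsto_const 1 2 3)
    have val: "2 * (- of_real (ln 2 / 2)) - 2 * (- of_real (ln 2 / 2)) + - 2 * a * of_real (x\<^sup>2) / 1 = - of_real (pi\<^sup>2 * x\<^sup>2 / 6)"
      by (simp add: a_def)
    have eq: "eventually (\<lambda>n. 2 * (S n - a / T n) - 2 * (S' n - a / of_real (t n)) + - 2 * a * of_real (x\<^sup>2) / (1 - \<i> * of_real x * r n)
        = 2 * S n - 2 * S' n - \<i> * of_nat n * of_real (x * width n)) sequentially"
      using ev Tn0
    proof eventually_elim
      case (elim n)
      define c w where "c = complex_of_real (t n)" and "w = 1 - \<i> * of_real x * r n"
      have c0: "c \<noteq> 0" using saddle_pos[OF elim(1)] by (simp add: c_def t_def)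
      have w0: "w \<noteq> 0" using elim by (auto simp: T_def w_def)
      have T: "T n = c * w" by (simp add: T_def c_def w_def)
      have nc: "of_nat n * c\<^sup>2 = 2 * a"
        using arg_cong[OF n_saddle_sq[OF elim(1)], of complex_of_real] by (simp add: c_def a_def t_def)
      have wid: "of_real (width n) = c * r n" by (simp add: width_def c_def r_def t_def)
      have rr: "r n * r n = c" using r2[OF elim(1)] by (simp add: c_def power2_eq_square)
      have wr: "\<i> * of_real x * r n = 1 - w" by (simp add: w_def)
      have ww: "(1 - w)\<^sup>2 = - (of_real x)\<^sup>2 * c"
        unfolding wr[symmetric] power_mult_distrib power2_eq_square[of "r n"] rr by simp
      have "\<i> * of_nat n * of_real (x * width n) = of_nat n * c * (1 - w)"
        unfolding wr[symmetric] of_real_mult wid by (simp add: mult_ac)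
      also have "\<dots> = 2 * a * (1 - w) / c"
        using c0 by (simp add: nc[symmetric] power2_eq_square)
      finally have e1: "\<i> * of_nat n * of_real (x * width n) = 2 * a * (1 - w) / c" .
      \<comment> \<open>Inverses become variables with polynomial relations, which brings the
        identity within reach of \<open>algebra\<close>.\<close>
      define p q X where "p = inverse c" and "q = inverse w" and "X = (complex_of_real x)\<^sup>2"
      have pc: "p * c = 1" and qw: "q * w = 1" using c0 w0 by (simp_all add: p_def q_def)
      have Xc: "(1 - w)\<^sup>2 = - X * c" using ww by (simp only: X_def)
      have "2 * (S n - a * (p * q)) - 2 * (S' n - a * p) + - 2 * a * X * q = 2 * S n - 2 * S' n - 2 * a * (1 - w) * p"
        using pc qw Xc by algebra
      moreover have "a / T n = a * (p * q)" "a / complex_of_real (t n) = a * p"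
        "- 2 * a * of_real (x\<^sup>2) / (1 - \<i> * of_real x * r n) = - 2 * a * X * q"
        "2 * a * (1 - w) / c = 2 * a * (1 - w) * p"
        unfolding T w_def[symmetric] c_def[symmetric] of_real_power X_def[symmetric]
        by (simp_all add: p_def q_def divide_inverse)
      ultimately show ?case unfolding e1 by (simp only:)
    qed
    show ?thesis by (rule Lim_transform_eventually[OF lim[unfolded val] eq])
  qed
  have yT: "(\<lambda>n. y n / T n) \<longlonglongrightarrow> s\<^sup>2"
  proof -
    have "(\<lambda>n. y n / (r n)\<^sup>2 / (1 - \<i> * of_real x * r n)) \<longlonglongrightarrow> s\<^sup>2 / 1"
      unfolding y_def by (intro tendsto_divide exp_second_difference_tendsto r0 rn0 w1) auto
    moreover have "eventually (\<lambda>n. y n / (r n)\<^sup>2 / (1 - \<i> * of_real x * r n) = y n / T n) sequentially"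
      using ev by eventually_elim (simp add: r2 T_def)
    ultimately show ?thesis by (simp add: Lim_transform_eventually)
  qed
  have y0: "y \<longlonglongrightarrow> 0"
  proof -
    have "(\<lambda>n. y n / T n * T n) \<longlonglongrightarrow> s\<^sup>2 * 0" by (intro tendsto_mult yT T0)
    moreover have "eventually (\<lambda>n. y n / T n * T n = y n) sequentially" using Tn0 by eventually_elim simp
    ultimately show ?thesis by (simp add: Lim_transform_eventually)
  qed
  obtain C where C: "eventually (\<lambda>n. cmod (T n) * (\<Sum>j=1..n. cmod (softplus2 (of_nat j * T n))) \<le> C) sequentially"
    using sum_norm_softplus2_bounded[OF sec T0 tail] by blast
  have f4: "eventually (\<lambda>n. \<forall>j. cmod (softplus2 (of_nat j * T n)) \<le> 4) sequentially"
    using sec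
  proof eventually_elim
    case (elim n)
    show ?case
    proof
      fix j
      have "cmod (softplus2 (of_nat j * T n)) \<le> 4 * exp (- Re (of_nat j * T n))"
        using elim by (intro norm_softplus2_le of_nat_mult_sector) auto
      also have "\<dots> \<le> 4 * 1" using elim by (intro mult_left_mono) auto
      finally show "cmod (softplus2 (of_nat j * T n)) \<le> 4" by simp
    qed
  qed
  \<comment> \<open>The linear sum is \<open>y / T\<close> times
    \<open>T * (\<Sum> softplus2)\<close>, with limits \<open>s\<^sup>2\<close> and
    \<open>1 / 2\<close>. The sum of squares is bounded by a constant times
    \<open>cmod y * cmod (y / T)\<close>, and \<open>y\<close> tends to 0.\<close>
  have P: "P \<longlonglongrightarrow> exp (s\<^sup>2 / 2)"
    unfolding P_def
  proof (rule prod_one_plus_tendsto_exp)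
    have "(\<lambda>n. y n / T n * (T n * (\<Sum>j=1..n. softplus2 (of_nat j * T n)))) \<longlonglongrightarrow> s\<^sup>2 * (1 / 2)"
      by (intro tendsto_mult yT sum_softplus2_asymptotics[OF sec T0 tail])
    moreover have "eventually (\<lambda>n. y n / T n * (T n * (\<Sum>j=1..n. softplus2 (of_nat j * T n)))
        = (\<Sum>j=1..n. y n * softplus2 (of_nat j * T n))) sequentially"
      using Tn0 by eventually_elim (simp add: sum_distrib_left)
    ultimately show "(\<lambda>n. \<Sum>j=1..n. y n * softplus2 (of_nat j * T n)) \<longlonglongrightarrow> s\<^sup>2 / 2"
      by (simp add: Lim_transform_eventually)
    have lim0: "(\<lambda>n. 4 * C * (cmod (y n) * cmod (y n / T n))) \<longlonglongrightarrow> 0"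
    proof -
      have "(\<lambda>n. 4 * C * (cmod (y n) * cmod (y n / T n))) \<longlonglongrightarrow> 4 * C * (cmod 0 * cmod (s\<^sup>2))"
        by (intro tendsto_mult tendsto_const tendsto_norm y0 yT)
      then show ?thesis by simp
    qed
    show "(\<lambda>n. \<Sum>j=1..n. (cmod (y n * softplus2 (of_nat j * T n)))\<^sup>2) \<longlonglongrightarrow> 0"
    proof (rule Lim_null_comparison[OF _ lim0])
      show "eventually (\<lambda>n. norm (\<Sum>j=1..n. (cmod (y n * softplus2 (of_nat j * T n)))\<^sup>2) \<le> 4 * C * (cmod (y n) * cmod (y n / T n))) sequentially"
        using C f4 Tn0
      proof eventually_elim
        case (elim n)
        define f where "f j = cmod (softplus2 (of_nat j * T n))" for j
        have "norm (\<Sum>j=1..n. (cmod (y n * softplus2 (of_nat j * T n)))\<^sup>2) = (\<Sum>j=1..n. (cmod (y n))\<^sup>2 * (f j * f j))"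
          by (simp add: f_def norm_mult power_mult_distrib power2_eq_square sum_nonneg mult_ac)
        also have "\<dots> \<le> (\<Sum>j=1..n. (cmod (y n))\<^sup>2 * (4 * f j))"
          using elim(2) by (intro sum_mono mult_left_mono mult_right_mono) (auto simp: f_def)
        also have "\<dots> = 4 * (cmod (y n) * cmod (y n)) * (\<Sum>j=1..n. f j)"
          by (simp add: sum_distrib_left power2_eq_square mult_ac)
        also have "\<dots> = 4 * (cmod (y n) * cmod (y n / T n)) * (cmod (T n) * (\<Sum>j=1..n. f j))"
          using elim(3) by (simp add: norm_divide)
        also have "\<dots> \<le> 4 * (cmod (y n) * cmod (y n / T n)) * C"
          using elim(1) unfolding f_def by (intro mult_left_mono) auto
        finally show ?case by (simp add: mult_ac)
      qed
    qed
    have "eventually (\<lambda>n. cmod (y n) < 1 / 8) sequentially"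
      using tendstoD[OF y0, of "1 / 8"] by simp
    then show "eventually (\<lambda>n. \<forall>j\<in>{1..n}. cmod (y n * softplus2 (of_nat j * T n)) \<le> 1 / 2) sequentially"
      using f4
    proof eventually_elim
      case (elim n)
      show ?case
      proof
        fix j
        have "cmod (y n * softplus2 (of_nat j * T n)) \<le> 1 / 8 * 4"
          unfolding norm_mult using elim by (intro mult_mono) auto
        then show "cmod (y n * softplus2 (of_nat j * T n)) \<le> 1 / 2" by simp
      qed
    qed
  qed auto
  have "(\<lambda>n. P n * exp (2 * S n - 2 * S' n - \<i> * of_nat n * of_real (x * width n)))
      \<longlonglongrightarrow> exp (s\<^sup>2 / 2) * exp (- of_real (pi\<^sup>2 * x\<^sup>2 / 6))"
    by (intro tendsto_mult P tendsto_exp main)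
  moreover have "eventually (\<lambda>n. P n * exp (2 * S n - 2 * S' n - \<i> * of_nat n * of_real (x * width n))
      = pair_integrand n s x) sequentially"
    using ev sec xsq t1
  proof eventually_elim
    case (elim n)
    then have tpos: "0 < t n" by (simp add: t_def saddle_pos)
    have "\<bar>x * width n\<bar> = \<bar>x * sqrt (t n)\<bar> * t n" using tpos by (simp add: width_def t_def abs_mult)
    also have "\<dots> \<le> 1 * 1" using elim tpos by (intro mult_mono) (auto simp: dist_real_def)
    finally have "\<bar>x * width n\<bar> \<le> pi" using pi_gt3 by linarith
    then have ind: "x \<in> {- (pi * (1 / width n))..pi * (1 / width n)}"
      using width_pos[OF elim(1)] by (auto simp: field_simps abs_le_iff)
    have TT: "of_real (saddle n) - \<i> * of_real (x / (1 / width n)) = T n"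
      by (simp add: T_def r_def t_def width_def algebra_simps)
    have R: "of_real (pair_gf_real n (saddle n)) = exp (2 * S' n)"
      using tpos unfolding S'_def t_def by (intro pair_gf_real_eq) simp
    have Q: "pair_gf n (s * of_real (sqrt (saddle n))) (T n) = exp (2 * S n) * P n"
      using elim(2) unfolding S_def P_def y_def r_def t_def by (intro pair_gf_eq) simp
    show ?case
      unfolding pair_integrand_def TT R Q using ind by (simp add: exp_diff exp_minus exp_add field_simps)
  qed
  ultimately have "(\<lambda>n. pair_integrand n s x) \<longlonglongrightarrow> exp (s\<^sup>2 / 2) * exp (- of_real (pi\<^sup>2 * x\<^sup>2 / 6))"
    by (rule Lim_transform_eventually)
  then show ?thesis by (simp flip: exp_of_real)
qed

section \<open>Limit and uniform bound of the rescaled moment generating function\<close>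

definition pair_sum :: "nat \<Rightarrow> complex \<Rightarrow> complex" where
  "pair_sum n s = (\<Sum>p\<in>distinct_pairs n. exp (of_real (sqrt (saddle n) * of_int (excess p)) * s))"

text \<open>The asymptotic number of pairs, twice the claimed asymptotics for sequences at
  \<open>k = 0\<close>.\<close>

definition growth :: "nat \<Rightarrow> real" where
  "growth n = exp (pi * sqrt (2 * real n / 3)) / (4 * 6 powr (1 / 4) * real n powr (3 / 4))"

lemma growth_pos: "0 < n \<Longrightarrow> 0 < growth n"
  by (simp add: growth_def)

lemma has_bochner_integral_pair_integrand:
  assumes n: "0 < n"
  shows "has_bochner_integral lborel (pair_integrand n s)
    (of_real (2 * pi * (1 / width n) * exp (- (real n * saddle n))) * pair_sum n s / of_real (pair_gf_real n (saddle n)))"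
proof -
  have "pair_sum n s = (\<Sum>p\<in>distinct_pairs n. exp (s * of_real (sqrt (saddle n)) * of_int (excess p)))"
    unfolding pair_sum_def by (intro sum.cong refl) (simp add: mult_ac)
  moreover have "0 < 1 / width n" using width_pos[OF n] by simp
  ultimately show ?thesis
    unfolding pair_integrand_def[abs_def]
    by (simp only:) (rule has_bochner_integral_divide_zero[OF Fourier_pair_gf])
qed

lemma integrable_inverse_one_plus_square: "integrable lborel (\<lambda>x :: real. inverse (1 + x\<^sup>2))"
  using integrable_inverse_1_plus_square by (simp add: set_integrable_def)

lemma has_bochner_integral_Gaussian:
  "has_bochner_integral lborel (\<lambda>x. exp (- (pi\<^sup>2 * x\<^sup>2 / 6))) (sqrt (6 / pi))"
proof -
  \<comment> \<open>Chosen so that \<open>2 * \<sigma>\<^sup>2 = 6 / pi\<^sup>2\<close> matches the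
    exponent.\<close>
  define \<sigma> where "\<sigma> = sqrt 3 / pi"
  have \<sigma>: "0 < \<sigma>" "\<sigma>\<^sup>2 = 3 / pi\<^sup>2" by (simp_all add: \<sigma>_def power_divide)
  have sq: "sqrt (2 * pi * \<sigma>\<^sup>2) = sqrt (6 / pi)" unfolding \<sigma> by (simp add: power2_eq_square)
  have "has_bochner_integral lborel (normal_density 0 \<sigma>) 1"
    using integrable_normal_density[OF \<sigma>(1)] integral_normal_density[OF \<sigma>(1)] by (simp add: has_bochner_integral_iff)
  then have "has_bochner_integral lborel (\<lambda>x. sqrt (6 / pi) * normal_density 0 \<sigma> x) (sqrt (6 / pi) * 1)"
    by (rule has_bochner_integral_mult_right)
  moreover have "sqrt (6 / pi) * normal_density 0 \<sigma> x = exp (- (pi\<^sup>2 * x\<^sup>2 / 6))" for x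
    unfolding normal_density_def sq by (simp add: \<sigma>(2))
  ultimately show ?thesis by simp
qed

lemma integral_pair_integrand_tendsto:
  assumes s: "cmod s \<le> 1"
  shows "(\<lambda>n. \<integral>x. pair_integrand n s x \<partial>lborel) \<longlonglongrightarrow> exp (s\<^sup>2 / 2) * of_real (sqrt (6 / pi))"
proof -
  let ?C = "exp (exp 6 + 1) * (675 * 288 ^ 3) :: real"
  have gauss: "has_bochner_integral lborel (\<lambda>x. exp (s\<^sup>2 / 2) * complex_of_real (exp (- (pi\<^sup>2 * x\<^sup>2 / 6))))
      (exp (s\<^sup>2 / 2) * of_real (sqrt (6 / pi)))"
    by (intro has_bochner_integral_mult_right has_bochner_integral_of_real has_bochner_integral_Gaussian)
  \<comment> \<open>The index is shifted because the majorant is only established for positive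
    \<open>n\<close>.\<close>
  have "(\<lambda>n. \<integral>x. pair_integrand (Suc n) s x \<partial>lborel)
      \<longlonglongrightarrow> (\<integral>x. exp (s\<^sup>2 / 2) * complex_of_real (exp (- (pi\<^sup>2 * x\<^sup>2 / 6))) \<partial>lborel)"
  proof (rule integral_dominated_convergence)
    show "integrable lborel (\<lambda>x. ?C * inverse (1 + x\<^sup>2))"
      by (intro integrable_mult_right integrable_inverse_one_plus_square)
    show "AE x in lborel. (\<lambda>n. pair_integrand (Suc n) s x) \<longlonglongrightarrow> exp (s\<^sup>2 / 2) * complex_of_real (exp (- (pi\<^sup>2 * x\<^sup>2 / 6)))"
      by (intro always_eventually allI LIMSEQ_Suc pair_integrand_tendsto)
    show "AE x in lborel. cmod (pair_integrand (Suc n) s x) \<le> ?C * inverse (1 + x\<^sup>2)" for n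
      by (intro always_eventually allI norm_pair_integrand_le s) simp
    show "(\<lambda>x. pair_integrand (Suc n) s x) \<in> borel_measurable lborel" for n
      using has_bochner_integral_pair_integrand[of "Suc n" s] by (auto simp: has_bochner_integral_iff)
    show "(\<lambda>x. exp (s\<^sup>2 / 2) * complex_of_real (exp (- (pi\<^sup>2 * x\<^sup>2 / 6)))) \<in> borel_measurable lborel"
      using gauss by (auto simp: has_bochner_integral_iff)
  qed
  then show ?thesis unfolding has_bochner_integral_integral_eq[OF gauss] by (rule LIMSEQ_imp_Suc)
qed

lemma norm_integral_pair_integrand_le:
  assumes n: "0 < n" and s: "cmod s \<le> 1"
  shows "cmod (\<integral>x. pair_integrand n s x \<partial>lborel)
    \<le> (\<integral>x. exp (exp 6 + 1) * (675 * 288 ^ 3) * inverse (1 + x\<^sup>2) \<partial>lborel)"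
proof -
  have int: "integrable lborel (pair_integrand n s)"
    using has_bochner_integral_pair_integrand[OF n, of s] by (auto simp: has_bochner_integral_iff)
  have "cmod (\<integral>x. pair_integrand n s x \<partial>lborel) \<le> (\<integral>x. cmod (pair_integrand n s x) \<partial>lborel)"
    by (rule integral_norm_bound)
  also have "\<dots> \<le> (\<integral>x. exp (exp 6 + 1) * (675 * 288 ^ 3) * inverse (1 + x\<^sup>2) \<partial>lborel)"
    by (intro integral_mono integrable_norm int integrable_mult_right integrable_inverse_one_plus_square
        norm_pair_integrand_le[OF n s])
  finally show ?thesis .
qed

text \<open>The logarithm is twice the sum in \<open>sum_softplus_saddle\<close>, so the constant is
  \<open>exp (- ln 2)\<close>.\<close>

lemma pair_gf_real_asymptotics:
  "(\<lambda>n. pair_gf_real n (saddle n) * exp (- (pi\<^sup>2 / (6 * saddle n)))) \<longlonglongrightarrow> 1 / 2"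
proof -
  have lim: "(\<lambda>n. exp (2 * ((\<Sum>j=1..n. softplus (of_nat j * of_real (saddle n))) - of_real (pi\<^sup>2 / 12) / of_real (saddle n))))
    \<longlonglongrightarrow> exp (2 * - of_real (ln 2 / 2))"
    by (intro tendsto_exp tendsto_mult_left sum_softplus_saddle)
  have val: "exp (2 * - of_real (ln 2 / 2)) = complex_of_real (1 / 2)"
  proof -
    have "exp (2 * - of_real (ln 2 / 2)) = complex_of_real (exp (- ln 2))" by (simp flip: exp_of_real)
    then show ?thesis by (simp add: exp_minus)
  qed
  have ev: "eventually (\<lambda>n. exp (2 * ((\<Sum>j=1..n. softplus (of_nat j * of_real (saddle n))) - of_real (pi\<^sup>2 / 12) / of_real (saddle n)))
     = complex_of_real (pair_gf_real n (saddle n) * exp (- (pi\<^sup>2 / (6 * saddle n))))) sequentially"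
    using eventually_gt_at_top[of 0]
  proof eventually_elim
    case (elim n)
    have "2 * ((\<Sum>j=1..n. softplus (of_nat j * of_real (saddle n))) - of_real (pi\<^sup>2 / 12) / of_real (saddle n))
      = 2 * (\<Sum>j=1..n. softplus (of_nat j * of_real (saddle n))) + complex_of_real (- (pi\<^sup>2 / (6 * saddle n)))"
      by (simp add: algebra_simps)
    then show ?case
      using saddle_pos[OF elim] by (simp only: exp_add exp_of_real of_real_mult pair_gf_real_eq less_imp_le)
  qed
  have "(\<lambda>n. complex_of_real (pair_gf_real n (saddle n) * exp (- (pi\<^sup>2 / (6 * saddle n))))) \<longlonglongrightarrow> of_real (1 / 2)"
    by (rule Lim_transform_eventually[OF lim[unfolded val] ev])
  then show ?thesis by (simp only: tendsto_of_real_iff)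
qed

text \<open>At the saddle both exponents equal \<open>n * t\<close>, and
  \<open>width n = t powr (3 / 2)\<close> produces the power \<open>3 / 4\<close> of
  \<open>n\<close>. The factor \<open>2 * sqrt (pi / 6)\<close> is the reciprocal of the Gaussian
  mass \<open>sqrt (6 / pi)\<close> times the \<open>1 / 2\<close> of
  \<open>pair_gf_real_asymptotics\<close>.\<close>

lemma growth_eq:
  assumes n: "0 < n"
  shows "growth n * (2 * sqrt (pi / 6)) = exp (real n * saddle n + pi\<^sup>2 / (6 * saddle n)) * width n / (2 * pi)"
proof -
  define t where "t = saddle n"
  have t: "0 < t" "real n * t\<^sup>2 = pi\<^sup>2 / 6" using saddle_pos[OF n] n_saddle_sq[OF n] by (simp_all add: t_def)
  have e: "real n * t + pi\<^sup>2 / (6 * t) = pi * sqrt (2 * real n / 3)"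
  proof -
    have "pi\<^sup>2 / (6 * t) = real n * t" using t by (simp add: field_simps power2_eq_square)
    then have "real n * t + pi\<^sup>2 / (6 * t) = 2 * real n * t" by simp
    also have "\<dots> = pi * (2 * real n / sqrt (6 * real n))" by (simp add: t_def saddle_def)
    also have "2 * real n / sqrt (6 * real n) = sqrt ((2 * real n)\<^sup>2 / (6 * real n))"
      by (simp only: real_sqrt_divide real_sqrt_abs abs_of_nonneg of_nat_0_le_iff mult_nonneg_nonneg zero_le_numeral)
    also have "(2 * real n)\<^sup>2 / (6 * real n) = 2 * real n / 3" using n by (simp add: power2_eq_square)
    finally show ?thesis .
  qed
  have w: "width n = pi powr (3 / 2) / (6 powr (3 / 4) * real n powr (3 / 4))"
  proof -
    have "width n = t powr (1 + 1 / 2)" unfolding powr_add using t by (simp add: width_def t_def powr_half_sqrt)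
    also have "t = pi / (6 * real n) powr (1 / 2)" using n by (simp add: t_def saddle_def powr_half_sqrt)
    also have "(pi / (6 * real n) powr (1 / 2)) powr (1 + 1 / 2) = pi powr (3 / 2) / (6 * real n) powr (3 / 4)"
      using n by (simp add: powr_divide powr_powr)
    also have "(6 * real n) powr (3 / 4) = 6 powr (3 / 4) * real n powr (3 / 4)" by (simp add: powr_mult)
    finally show ?thesis .
  qed
  have s: "sqrt (pi / 6) = pi powr (1 / 2) / 6 powr (1 / 2)"
    by (simp add: real_sqrt_divide powr_half_sqrt)
  have p: "pi powr (3 / 2) = pi * pi powr (1 / 2)" using powr_add[of pi 1 "1 / 2"] by simp
  have q: "(6 :: real) powr (3 / 4) = 6 powr (1 / 4) * 6 powr (1 / 2)" using powr_add[of 6 "1 / 4" "1 / 2 :: real"] by simp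
  show ?thesis
    unfolding e[unfolded t_def] growth_def w s p q by (simp add: field_simps)
qed

lemma pair_sum_eq:
  assumes n: "0 < n"
  shows "pair_sum n s / of_real (growth n) = (\<integral>x. pair_integrand n s x \<partial>lborel) *
    of_real (pair_gf_real n (saddle n) * exp (- (pi\<^sup>2 / (6 * saddle n))) * (2 * sqrt (pi / 6)))"
proof -
  define E R w m where "E = exp (real n * saddle n)" and "R = pair_gf_real n (saddle n)" and "w = width n"
    and "m = exp (pi\<^sup>2 / (6 * saddle n))"
  have pos: "0 < E" "0 < R" "0 < w" "0 < m" "0 < growth n"
    using pair_gf_real_pos width_pos[OF n] growth_pos[OF n] by (simp_all add: E_def R_def w_def m_def)
  have I: "(\<integral>x. pair_integrand n s x \<partial>lborel) = of_real (2 * pi * (1 / w) * (1 / E)) * pair_sum n s / of_real R"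
    unfolding has_bochner_integral_integral_eq[OF has_bochner_integral_pair_integrand[OF n]]
    by (simp add: E_def R_def w_def exp_minus divide_inverse)
  have g: "2 * sqrt (pi / 6) = E * m * w / (2 * pi) / growth n"
    using growth_eq[OF n] pos unfolding exp_add by (simp add: E_def m_def w_def field_simps)
  have "2 * pi * (1 / w) * (1 / E) / R * (R * (1 / m) * (2 * sqrt (pi / 6))) = 1 / growth n"
    unfolding g using pos by (simp add: field_simps)
  then have "pair_sum n s * of_real (2 * pi * (1 / w) * (1 / E) / R * (R * (1 / m) * (2 * sqrt (pi / 6)))) = pair_sum n s * of_real (1 / growth n)"
    by (simp only:)
  moreover have "exp (- (pi\<^sup>2 / (6 * saddle n))) = 1 / m"
    unfolding m_def exp_minus by (rule inverse_eq_divide)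
  moreover have "of_real A * z / of_real R * of_real B = z * of_real (A / R * B)" for A B and z :: complex
    by simp
  moreover have "z / of_real (growth n) = z * of_real (1 / growth n)" for z :: complex
    by simp
  ultimately show ?thesis unfolding I R_def[symmetric] by (simp only:)
qed

lemma pair_sum_tendsto:
  assumes s: "cmod s \<le> 1"
  shows "(\<lambda>n. pair_sum n s / of_real (growth n)) \<longlonglongrightarrow> exp (s\<^sup>2 / 2)"
proof -
  have lim: "(\<lambda>n. (\<integral>x. pair_integrand n s x \<partial>lborel) *
    of_real (pair_gf_real n (saddle n) * exp (- (pi\<^sup>2 / (6 * saddle n))) * (2 * sqrt (pi / 6))))
    \<longlonglongrightarrow> exp (s\<^sup>2 / 2) * of_real (sqrt (6 / pi)) * of_real (1 / 2 * (2 * sqrt (pi / 6)))"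
    by (intro tendsto_mult tendsto_of_real integral_pair_integrand_tendsto[OF s] pair_gf_real_asymptotics tendsto_const)
  have val: "exp (s\<^sup>2 / 2) * of_real (sqrt (6 / pi)) * of_real (1 / 2 * (2 * sqrt (pi / 6))) = exp (s\<^sup>2 / 2)"
  proof -
    have "sqrt (6 / pi) * (1 / 2 * (2 * sqrt (pi / 6))) = 1" by (simp flip: real_sqrt_mult)
    then show ?thesis unfolding mult.assoc of_real_mult[symmetric] by simp
  qed
  have ev: "eventually (\<lambda>n. (\<integral>x. pair_integrand n s x \<partial>lborel) *
    of_real (pair_gf_real n (saddle n) * exp (- (pi\<^sup>2 / (6 * saddle n))) * (2 * sqrt (pi / 6))) = pair_sum n s / of_real (growth n)) sequentially"
    using eventually_gt_at_top[of 0] by eventually_elim (rule pair_sum_eq[symmetric])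
  show ?thesis by (rule Lim_transform_eventually[OF lim[unfolded val] ev])
qed

lemma pair_sum_bounded: "\<exists>C. \<forall>n>0. \<forall>s. cmod s \<le> 1 \<longrightarrow> cmod (pair_sum n s / of_real (growth n)) \<le> C"
proof -
  define I :: real where "I = (\<integral>x. exp (exp 6 + 1) * (675 * 288 ^ 3) * inverse (1 + x\<^sup>2) \<partial>lborel)"
  have "Bseq (\<lambda>n. pair_gf_real n (saddle n) * exp (- (pi\<^sup>2 / (6 * saddle n))) * (2 * sqrt (pi / 6)))"
    by (rule convergent_imp_Bseq, rule convergentI, rule tendsto_mult_right, rule pair_gf_real_asymptotics)
  then obtain B where B: "0 < B" "\<And>n. \<bar>pair_gf_real n (saddle n) * exp (- (pi\<^sup>2 / (6 * saddle n))) * (2 * sqrt (pi / 6))\<bar> \<le> B"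
    by (auto elim!: BseqE)
  have "cmod (pair_sum n s / of_real (growth n)) \<le> I * B" if "0 < n" "cmod s \<le> 1" for n s
    unfolding pair_sum_eq[OF that(1)] norm_mult norm_of_real I_def
    by (rule mult_mono[OF norm_integral_pair_integrand_le[OF that] B(2)])
      (use that norm_integral_pair_integrand_le[of n s] order_trans[OF norm_ge_zero] in auto)
  then show ?thesis by blast
qed

section \<open>Moments as derivatives at the origin\<close>

text \<open>Dominated convergence in Cauchy's formula over the unit circle: a uniform bound and
  pointwise convergence suffice, without proving uniform convergence.\<close>

lemma higher_deriv_tendsto:
  fixes f :: "nat \<Rightarrow> complex \<Rightarrow> complex"
  assumes f: "\<And>n. f n holomorphic_on UNIV" and g: "g holomorphic_on UNIV"
    and bound: "\<And>n z. cmod z \<le> 1 \<Longrightarrow> cmod (f n z) \<le> C"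
    and lim: "\<And>z. cmod z \<le> 1 \<Longrightarrow> (\<lambda>n. f n z) \<longlonglongrightarrow> g z"
  shows "(\<lambda>n. (deriv ^^ m) (f n) 0) \<longlonglongrightarrow> (deriv ^^ m) g 0"
proof -
  let ?\<gamma> = "circlepath 0 1" and ?c = "(2 * pi * \<i>) / fact m :: complex"
  let ?h = "\<lambda>f x. f (?\<gamma> x) / (?\<gamma> x - 0) ^ Suc m * vector_derivative ?\<gamma> (at x within {0..1})"
  have int: "(?h f has_integral ?c * (deriv ^^ m) f 0) {0..1}" if "f holomorphic_on UNIV" for f
    using that Cauchy_has_contour_integral_higher_derivative_circlepath[of 0 1 f 0 m]
    unfolding has_contour_integral_def
    by (auto intro: holomorphic_on_imp_continuous_on holomorphic_on_subset)
  have \<gamma>: "cmod (?\<gamma> x) = 1" for x by (simp add: circlepath norm_mult)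
  have "(\<lambda>n. integral {0..1} (?h (f n))) \<longlonglongrightarrow> integral {0..1} (?h g)"
  proof (rule dominated_convergence(2))
    show "?h (f n) integrable_on {0..1}" for n using int[OF f] by blast
    show "(\<lambda>x. C * (2 * pi)) integrable_on {0..1::real}" by (rule integrable_const_ivl)
    show "cmod (?h (f n) x) \<le> C * (2 * pi)" if "x \<in> {0..1}" for n x
    proof -
      have "cmod (vector_derivative ?\<gamma> (at x within {0..1})) = 2 * pi"
        using that by (simp add: vector_derivative_circlepath01 norm_mult)
      then show ?thesis using bound[of "?\<gamma> x" n] \<gamma> by (simp add: norm_mult norm_divide norm_power)
    qed
    show "(\<lambda>n. ?h (f n) x) \<longlonglongrightarrow> ?h g x" if "x \<in> {0..1}" for x
    proof -
      have "?\<gamma> x \<noteq> 0" using \<gamma>[of x] by auto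
      then show ?thesis using \<gamma> by (intro tendsto_mult tendsto_divide tendsto_const lim) auto
    qed
  qed
  then have "(\<lambda>n. ?c * (deriv ^^ m) (f n) 0) \<longlonglongrightarrow> ?c * (deriv ^^ m) g 0"
    unfolding integral_unique[OF int[OF f]] integral_unique[OF int[OF g]] .
  then have "(\<lambda>n. inverse ?c * (?c * (deriv ^^ m) (f n) 0)) \<longlonglongrightarrow> inverse ?c * (?c * (deriv ^^ m) g 0)"
    by (rule tendsto_mult_left)
  moreover have "inverse ?c * (?c * z) = z" for z by simp
  ultimately show ?thesis by (simp only:)
qed

lemma higher_deriv_sum_exp:
  fixes a :: "'a \<Rightarrow> complex"
  shows "(deriv ^^ m) (\<lambda>s. (\<Sum>p\<in>D. exp (a p * s)) / c) = (\<lambda>s. (\<Sum>p\<in>D. a p ^ m * exp (a p * s)) / c)"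
proof (induction m)
  case (Suc m)
  have "((\<lambda>s. (\<Sum>p\<in>D. a p ^ m * exp (a p * s)) / c) has_field_derivative (\<Sum>p\<in>D. a p ^ Suc m * exp (a p * s)) / c) (at s)" for s
    by (intro DERIV_cdivide DERIV_sum) (auto intro!: derivative_eq_intros)
  then show ?case by (auto simp: Suc.IH intro!: DERIV_imp_deriv)
qed simp

text \<open>The function satisfies \<open>f' = s * f\<close>. In the Leibniz expansion at 0 only the
  term differentiating \<open>s\<close> once survives, so two more derivatives multiply the value by
  \<open>m + 1\<close>.\<close>

lemma higher_deriv_exp_half_square:
  "(deriv ^^ (2 * k)) (\<lambda>s. exp (s\<^sup>2 / 2)) 0 = (of_nat (odd_double_fact k) :: complex)"
proof -
  let ?f = "\<lambda>s :: complex. exp (s\<^sup>2 / 2)"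
  have hol: "?f holomorphic_on UNIV" by (intro holomorphic_intros) auto
  have d: "deriv ?f = (\<lambda>s. s * ?f s)"
    by (auto intro!: DERIV_imp_deriv derivative_eq_intros)
  have rec: "(deriv ^^ Suc (Suc m)) ?f 0 = of_nat (Suc m) * (deriv ^^ m) ?f 0" for m
  proof -
    have "(deriv ^^ Suc (Suc m)) ?f 0 = (deriv ^^ Suc m) (\<lambda>s. s * ?f s) 0"
      by (subst funpow_Suc_right) (simp add: d del: funpow.simps)
    also have "\<dots> = (\<Sum>i=0..Suc m. of_nat (Suc m choose i) * (deriv ^^ i) (\<lambda>s. s) 0 * (deriv ^^ (Suc m - i)) ?f 0)"
      using hol by (intro higher_deriv_mult[where S = UNIV]) (auto intro: holomorphic_intros)
    also have "\<dots> = (\<Sum>i\<in>{1}. of_nat (Suc m choose i) * (deriv ^^ i) (\<lambda>s. s) 0 * (deriv ^^ (Suc m - i)) ?f 0)"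
      by (rule sum.mono_neutral_right) auto
    finally show ?thesis by simp
  qed
  show ?thesis
  proof (induction k)
    case 0
    then show ?case by (simp add: odd_double_fact_def)
  next
    case (Suc k)
    have "(deriv ^^ (2 * Suc k)) ?f 0 = (deriv ^^ Suc (Suc (2 * k))) ?f 0" by simp
    also have "\<dots> = of_nat (Suc (2 * k)) * of_nat (odd_double_fact k)" unfolding rec Suc.IH ..
    also have "\<dots> = of_nat (odd_double_fact (Suc k))"
      by (simp only: of_nat_mult[symmetric]) (simp add: odd_double_fact_def)
    finally show ?case .
  qed
qed

definition pair_moment :: "nat \<Rightarrow> nat \<Rightarrow> real" where
  "pair_moment r n = (\<Sum>p\<in>distinct_pairs n. real_of_int (excess p) ^ r)"

lemma pair_moment_tendsto:
  "(\<lambda>n. pair_moment (2 * k) n * saddle n ^ k / growth n) \<longlonglongrightarrow> real (odd_double_fact k)"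
proof -
  obtain C where C: "\<And>n s. 0 < n \<Longrightarrow> cmod s \<le> 1 \<Longrightarrow> cmod (pair_sum n s / of_real (growth n)) \<le> C"
    using pair_sum_bounded by blast
  have "(\<lambda>n. (deriv ^^ (2 * k)) (\<lambda>s. pair_sum (Suc n) s / of_real (growth (Suc n))) 0)
      \<longlonglongrightarrow> (deriv ^^ (2 * k)) (\<lambda>s. exp (s\<^sup>2 / 2)) 0"
  proof (rule higher_deriv_tendsto)
    show "(\<lambda>s. pair_sum (Suc n) s / of_real (growth (Suc n))) holomorphic_on UNIV" for n
      unfolding pair_sum_def using growth_pos[of "Suc n"] by (intro holomorphic_intros) auto
    show "(\<lambda>s. exp (s\<^sup>2 / 2) :: complex) holomorphic_on UNIV" by (intro holomorphic_intros) auto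
    show "cmod (pair_sum (Suc n) z / of_real (growth (Suc n))) \<le> C" if "cmod z \<le> 1" for n z
      using C that by simp
    show "(\<lambda>n. pair_sum (Suc n) z / of_real (growth (Suc n))) \<longlonglongrightarrow> exp (z\<^sup>2 / 2)" if "cmod z \<le> 1" for z
      using pair_sum_tendsto[OF that] by (rule LIMSEQ_Suc)
  qed
  moreover have "(deriv ^^ (2 * k)) (\<lambda>s. pair_sum (Suc n) s / of_real (growth (Suc n))) 0
     = of_real (pair_moment (2 * k) (Suc n) * saddle (Suc n) ^ k / growth (Suc n))" for n
  proof -
    have "sqrt (saddle (Suc n)) ^ (2 * k) = saddle (Suc n) ^ k"
      using saddle_pos[of "Suc n"] by (simp add: power_mult)
    then have "(\<Sum>p\<in>distinct_pairs (Suc n). (sqrt (saddle (Suc n)) * of_int (excess p)) ^ (2 * k))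
      = pair_moment (2 * k) (Suc n) * saddle (Suc n) ^ k"
      unfolding pair_moment_def power_mult_distrib by (simp only: mult.commute[of _ "saddle (Suc n) ^ k"] sum_distrib_left)
    moreover have "(deriv ^^ (2 * k)) (\<lambda>s. pair_sum (Suc n) s / of_real (growth (Suc n))) 0
      = of_real ((\<Sum>p\<in>distinct_pairs (Suc n). (sqrt (saddle (Suc n)) * of_int (excess p)) ^ (2 * k)) / growth (Suc n))"
      unfolding pair_sum_def[abs_def] higher_deriv_sum_exp by simp
    ultimately show ?thesis by (simp only:)
  qed
  ultimately have "(\<lambda>n. complex_of_real (pair_moment (2 * k) (Suc n) * saddle (Suc n) ^ k / growth (Suc n)))
      \<longlonglongrightarrow> of_real (real (odd_double_fact k))"
    by (simp only: higher_deriv_exp_half_square of_real_of_nat_eq)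
  then have "(\<lambda>n. pair_moment (2 * k) (Suc n) * saddle (Suc n) ^ k / growth (Suc n)) \<longlonglongrightarrow> real (odd_double_fact k)"
    by (simp only: tendsto_of_real_iff)
  then show ?thesis by (rule LIMSEQ_imp_Suc)
qed

section \<open>From pairs to unimodal sequences\<close>

text \<open>Midpoint convexity of an even power. The induction uses that \<open>a - b\<close> and
  \<open>a ^ k - b ^ k\<close> have the same sign for nonnegative \<open>a\<close> and
  \<open>b\<close>.\<close>

lemma two_power_le_shifted:
  fixes x :: real shows "2 * x ^ (2 * k) \<le> (x + 1) ^ (2 * k) + (x - 1) ^ (2 * k)"
proof (induction k)
  case (Suc k)
  define a b where "a = (x + 1)\<^sup>2" and "b = (x - 1)\<^sup>2"
  have ab: "0 \<le> a" "0 \<le> b" by (simp_all add: a_def b_def)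
  have "0 \<le> (a - b) * (a ^ k - b ^ k)"
    using ab power_mono[of a b k] power_mono[of b a k]
    by (cases "a \<le> b") (auto intro: mult_nonneg_nonneg mult_nonpos_nonpos)
  then have "(a + b) / 2 * (a ^ k + b ^ k) \<le> a ^ Suc k + b ^ Suc k" by (simp add: algebra_simps)
  moreover have "x\<^sup>2 \<le> (a + b) / 2" by (simp add: a_def b_def power2_eq_square algebra_simps)
  moreover have IH: "2 * (x\<^sup>2) ^ k \<le> a ^ k + b ^ k" using Suc by (simp add: a_def b_def power_mult)
  ultimately have "x\<^sup>2 * (2 * (x\<^sup>2) ^ k) \<le> a ^ Suc k + b ^ Suc k"
    using mult_mono[of "x\<^sup>2" "(a + b) / 2" "2 * (x\<^sup>2) ^ k" "a ^ k + b ^ k"] ab by (simp add: order_trans)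
  then show ?case unfolding power_mult a_def b_def by simp
qed simp

text \<open>Odd powers of \<open>x\<close> cancel between the two binomial expansions; each even
  power below the top is at most \<open>1 + x ^ (2 * (k - 1))\<close>, and the binomial coefficients
  sum to \<open>4 ^ k\<close>.\<close>

lemma shifted_powers_le:
  fixes x :: real
  assumes k: "0 < k"
  shows "(x + 1) ^ (2 * k) + (x - 1) ^ (2 * k) \<le> 2 * x ^ (2 * k) + 2 * 4 ^ k * (1 + x ^ (2 * (k - 1)))"
proof -
  let ?m = "2 * k" and ?B = "1 + x ^ (2 * (k - 1))"
  have B: "x ^ i \<le> ?B" if "even i" "i \<le> 2 * (k - 1)" for i
  proof (cases "\<bar>x\<bar> \<le> 1")
    case True
    then have "\<bar>x\<bar> ^ i \<le> 1" by (simp add: power_le_one)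
    then have "x ^ i \<le> 1" using that(1) by (simp add: power_even_abs)
    then show ?thesis by (simp add: add_increasing2)
  next
    case False
    then have "\<bar>x\<bar> ^ i \<le> \<bar>x\<bar> ^ (2 * (k - 1))" using that by (intro power_increasing) auto
    then show ?thesis using that(1) by (simp add: power_even_abs)
  qed
  have B0: "0 \<le> ?B" by simp
  have s: "{..?m} = insert ?m {..<?m}" by auto
  have "(x + 1) ^ ?m + (x - 1) ^ ?m = (\<Sum>i\<le>?m. of_nat (?m choose i) * x ^ i * (1 + (-1) ^ (?m - i)))"
    using binomial_ring[of x 1 ?m] binomial_ring[of x "-1" ?m]
    by (simp add: sum.distrib[symmetric] algebra_simps)
  also have "\<dots> = 2 * x ^ ?m + (\<Sum>i<?m. of_nat (?m choose i) * x ^ i * (1 + (-1) ^ (?m - i)))"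
    unfolding s by simp
  also have "(\<Sum>i<?m. of_nat (?m choose i) * x ^ i * (1 + (-1) ^ (?m - i))) \<le> (\<Sum>i<?m. of_nat (?m choose i) * (2 * ?B))"
  proof (rule sum_mono)
    fix i assume "i \<in> {..<?m}"
    then have i: "i < ?m" by simp
    have "x ^ i * (1 + (-1) ^ (?m - i)) \<le> 2 * ?B"
    proof (cases "even i")
      case True
      then have "x ^ i \<le> ?B" using i by (intro B) (auto elim!: evenE)
      moreover have "even (?m - i)" using True by simp
      ultimately show ?thesis by simp
    next
      case False
      then have "odd (?m - i)" using i by simp
      then show ?thesis using B0 by simp
    qed
    then show "of_nat (?m choose i) * x ^ i * (1 + (-1) ^ (?m - i)) \<le> of_nat (?m choose i) * (2 * ?B)"
      by (simp only: mult.assoc) (intro mult_left_mono; simp)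
  qed
  also have "\<dots> \<le> (\<Sum>i\<le>?m. of_nat (?m choose i) * (2 * ?B))"
    by (rule sum_mono2) (use B0 in auto)
  also have "\<dots> = 2 ^ ?m * (2 * ?B)"
    by (simp only: sum_distrib_right[symmetric] of_nat_sum[symmetric] choose_row_sum of_nat_power) simp
  finally have "(x + 1) ^ ?m + (x - 1) ^ ?m \<le> 2 * x ^ ?m + 2 ^ ?m * (2 * ?B)" by simp
  moreover have "(2 :: real) ^ ?m = 4 ^ k" by (simp add: power_mult)
  ultimately show ?thesis by (simp only: mult_ac)
qed

definition twin_moment :: "nat \<Rightarrow> nat \<Rightarrow> real" where
  "twin_moment r n = (\<Sum>x\<in>twin_peak_triples n. real_of_int (excess (snd x)) ^ r)"

lemma pair_moment_decompose:
  assumes "0 < n"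
  shows "pair_moment r n = (\<Sum>x\<in>peak_triples n. (real_of_int (excess (snd x)) + 1) ^ r
      + (real_of_int (excess (snd x)) - 1) ^ r) + twin_moment r n"
  using sum_distinct_pairs[OF assms, of "\<lambda>m. real_of_int m ^ r"]
  by (simp add: pair_moment_def twin_moment_def)

lemma twin_moment_nonneg: "0 \<le> twin_moment (2 * k) n"
  unfolding twin_moment_def by (intro sum_nonneg) (simp add: zero_le_even_power)

lemma two_u_moment_le:
  assumes "0 < n" shows "2 * u_moment (2 * k) n \<le> pair_moment (2 * k) n"
proof -
  have "2 * u_moment (2 * k) n = (\<Sum>x\<in>peak_triples n. 2 * real_of_int (excess (snd x)) ^ (2 * k))"
    by (simp add: u_moment_eq sum_distrib_left)
  also have "\<dots> \<le> (\<Sum>x\<in>peak_triples n. (real_of_int (excess (snd x)) + 1) ^ (2 * k) + (real_of_int (excess (snd x)) - 1) ^ (2 * k))"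
    by (intro sum_mono two_power_le_shifted)
  finally show ?thesis using pair_moment_decompose[OF assms, of "2 * k"] twin_moment_nonneg[of k n] by linarith
qed

lemma u_moment_Suc_ge: "u_moment (2 * k) n + 2 * twin_moment (2 * k) n \<le> u_moment (2 * k) (Suc n)"
proof -
  have "2 * twin_moment (2 * k) n = (\<Sum>x\<in>twin_peak_triples n. 2 * real_of_int (excess (snd x)) ^ (2 * k))"
    by (simp add: twin_moment_def sum_distrib_left)
  also have "\<dots> \<le> (\<Sum>x\<in>twin_peak_triples n. (real_of_int (excess (snd x)) + 1) ^ (2 * k) + (real_of_int (excess (snd x)) - 1) ^ (2 * k))"
    by (intro sum_mono two_power_le_shifted)
  finally show ?thesis
    using sum_peak_triples_Suc_ge[of "\<lambda>m. real_of_int m ^ (2 * k)" n]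
    by (simp add: u_moment_eq zero_le_even_power)
qed

text \<open>The price of the rank shift by one. It vanishes at \<open>k = 0\<close>, where the
  shifted powers are constant.\<close>

definition lower_moments :: "nat \<Rightarrow> nat \<Rightarrow> real" where
  "lower_moments k n = (if k = 0 then 0 else 4 ^ k * (pair_moment (2 * 0) n + pair_moment (2 * (k - 1)) n))"

lemma pair_moment_le:
  assumes n: "0 < n"
  shows "pair_moment (2 * k) n \<le> 2 * u_moment (2 * k) n + lower_moments k n + twin_moment (2 * k) n"
proof (cases "k = 0")
  case True
  then show ?thesis using pair_moment_decompose[OF n, of 0]
    by (simp add: lower_moments_def u_moment_eq)
next
  case False
  let ?e = "\<lambda>x. real_of_int (excess (snd x))"
  have "(\<Sum>x\<in>peak_triples n. (?e x + 1) ^ (2 * k) + (?e x - 1) ^ (2 * k))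
     \<le> (\<Sum>x\<in>peak_triples n. 2 * ?e x ^ (2 * k) + 2 * 4 ^ k * (?e x ^ (2 * 0) + ?e x ^ (2 * (k - 1))))"
    using shifted_powers_le[of k] False by (intro sum_mono) simp
  also have "\<dots> = 2 * u_moment (2 * k) n + 4 ^ k * (2 * u_moment (2 * 0) n + 2 * u_moment (2 * (k - 1)) n)"
    unfolding u_moment_eq by (simp only: sum.distrib sum_distrib_left[symmetric]) (simp add: algebra_simps)
  also have "\<dots> \<le> 2 * u_moment (2 * k) n + 4 ^ k * (pair_moment (2 * 0) n + pair_moment (2 * (k - 1)) n)"
    by (intro add_left_mono mult_left_mono add_mono two_u_moment_le n) simp
  finally show ?thesis using pair_moment_decompose[OF n, of "2 * k"] False by (simp add: lower_moments_def)
qed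

text \<open>The twin-peak moment is at most half the increment of \<open>u_moment\<close>, and the incremented moment
  is in turn controlled by \<open>two_u_moment_le\<close>.\<close>

lemma u_moment_ge:
  assumes n: "0 < n"
  shows "2 / 3 * (pair_moment (2 * k) n - pair_moment (2 * k) (Suc n) / 4 - lower_moments k n) \<le> u_moment (2 * k) n"
  \<comment> \<open>Write \<open>P\<close>, \<open>P'\<close> for the pair moments at
    \<open>n\<close> and \<open>Suc n\<close>, \<open>U\<close> for the sequence moment and
    \<open>L\<close> for the lower moments. The twin moment is at most
    \<open>(P' / 2 - U) / 2\<close>, so \<open>P \<le> 3 / 2 * U + L + P' / 4\<close>.\<close>
  using pair_moment_le[OF n, of k] u_moment_Suc_ge[of k n] two_u_moment_le[of "Suc n" k] by simp

section \<open>Normalised limits and the final sandwich\<close>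

definition weight :: "nat \<Rightarrow> nat \<Rightarrow> real" where "weight k n = saddle n ^ k / growth n"

lemma weight_pos: "0 < n \<Longrightarrow> 0 < weight k n"
  by (simp add: weight_def saddle_pos growth_pos)

lemma pair_moment_weight: "(\<lambda>n. pair_moment (2 * k) n * weight k n) \<longlonglongrightarrow> real (odd_double_fact k)"
  using pair_moment_tendsto[of k] by (simp add: weight_def)

text \<open>Growth is subexponential, so passing from \<open>n\<close> to \<open>Suc n\<close> does
  not change the leading term; this makes the bound through the increment effective.\<close>

lemma weight_ratio: "(\<lambda>n. weight k n / weight k (Suc n)) \<longlonglongrightarrow> 1"
proof -
  have 1: "(\<lambda>n. saddle n / saddle (Suc n)) \<longlonglongrightarrow> 1"
  proof -
    have "saddle n / saddle (Suc n) = sqrt (real (Suc n) / real n)" for n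
      by (simp add: saddle_def real_sqrt_mult real_sqrt_divide del: of_nat_Suc)
    moreover have "(\<lambda>n. sqrt (real (Suc n) / real n)) \<longlonglongrightarrow> 1" by real_asymp
    ultimately show ?thesis by simp
  qed
  have 2: "(\<lambda>n. growth (Suc n) / growth n) \<longlonglongrightarrow> 1"
    unfolding growth_def by real_asymp
  have "(\<lambda>n. (saddle n / saddle (Suc n)) ^ k * (growth (Suc n) / growth n)) \<longlonglongrightarrow> 1 ^ k * 1"
    by (intro tendsto_intros 1 2)
  moreover have "(saddle n / saddle (Suc n)) ^ k * (growth (Suc n) / growth n) = weight k n / weight k (Suc n)" for n
    by (simp add: weight_def power_divide)
  ultimately show ?thesis by simp
qed

lemma pair_moment_Suc_weight: "(\<lambda>n. pair_moment (2 * k) (Suc n) * weight k n) \<longlonglongrightarrow> real (odd_double_fact k)"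
proof -
  have "(\<lambda>n. pair_moment (2 * k) (Suc n) * weight k (Suc n) * (weight k n / weight k (Suc n))) \<longlonglongrightarrow> real (odd_double_fact k) * 1"
    by (intro tendsto_mult weight_ratio LIMSEQ_Suc[OF pair_moment_weight])
  moreover have "pair_moment (2 * k) (Suc n) * weight k (Suc n) * (weight k n / weight k (Suc n)) = pair_moment (2 * k) (Suc n) * weight k n" for n
    using weight_pos[of "Suc n" k] by simp
  ultimately show ?thesis by simp
qed

text \<open>The normalisations of orders \<open>j\<close> and \<open>k\<close> differ by
  \<open>saddle n ^ (k - j)\<close>, which tends to 0.\<close>

lemma pair_moment_lower_weight:
  assumes "j < k" shows "(\<lambda>n. pair_moment (2 * j) n * weight k n) \<longlonglongrightarrow> 0"
proof -
  have "(\<lambda>n. pair_moment (2 * j) n * weight j n * saddle n ^ (k - j)) \<longlonglongrightarrow> real (odd_double_fact j) * 0 ^ (k - j)"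
    by (intro tendsto_mult tendsto_power pair_moment_weight saddle_tendsto_0)
  moreover have "weight j n * saddle n ^ (k - j) = weight k n" for n
    using assms by (simp add: weight_def flip: power_add)
  ultimately show ?thesis using assms by (simp add: mult.assoc power_0_left)
qed

lemma lower_moments_weight: "(\<lambda>n. lower_moments k n * weight k n) \<longlonglongrightarrow> 0"
proof (cases "k = 0")
  case False
  have "(\<lambda>n. 4 ^ k * (pair_moment (2 * 0) n * weight k n + pair_moment (2 * (k - 1)) n * weight k n)) \<longlonglongrightarrow> 4 ^ k * (0 + 0)"
    using False by (intro tendsto_mult tendsto_add tendsto_const pair_moment_lower_weight) auto
  then show ?thesis using False by (simp add: lower_moments_def algebra_simps)
qed (simp add: lower_moments_def)

lemma u_moment_weight: "(\<lambda>n. u_moment (2 * k) n * weight k n) \<longlonglongrightarrow> real (odd_double_fact k) / 2"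
proof (rule tendsto_sandwich)
  show "eventually (\<lambda>n. 2 / 3 * (pair_moment (2 * k) n * weight k n - pair_moment (2 * k) (Suc n) * weight k n / 4 - lower_moments k n * weight k n)
      \<le> u_moment (2 * k) n * weight k n) sequentially"
    using eventually_gt_at_top[of 0]
  proof eventually_elim
    case (elim n)
    from mult_right_mono[OF u_moment_ge[OF elim, of k] less_imp_le[OF weight_pos[OF elim, of k]]]
    show ?case by (simp add: algebra_simps)
  qed
  show "eventually (\<lambda>n. u_moment (2 * k) n * weight k n \<le> pair_moment (2 * k) n * weight k n / 2) sequentially"
    using eventually_gt_at_top[of 0]
  proof eventually_elim
    case (elim n)
    from mult_right_mono[OF two_u_moment_le[OF elim, of k] less_imp_le[OF weight_pos[OF elim, of k]]]
    show ?case by simp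
  qed
  let ?c = "real (odd_double_fact k)"
  show "(\<lambda>n. pair_moment (2 * k) n * weight k n / 2) \<longlonglongrightarrow> ?c / 2"
    by (intro tendsto_divide pair_moment_weight tendsto_const) simp
  \<comment> \<open>\<open>2 / 3 * (1 - 1 / 4) = 1 / 2\<close>: the lower bound loses nothing in the
    limit and meets the upper one.\<close>
  have "(\<lambda>n. 2 / 3 * (pair_moment (2 * k) n * weight k n - pair_moment (2 * k) (Suc n) * weight k n / 4 - lower_moments k n * weight k n))
      \<longlonglongrightarrow> 2 / 3 * (?c - ?c / 4 - 0)"
    by (intro tendsto_mult tendsto_diff tendsto_divide tendsto_const pair_moment_weight pair_moment_Suc_weight lower_moments_weight) simp
  then show "(\<lambda>n. 2 / 3 * (pair_moment (2 * k) n * weight k n - pair_moment (2 * k) (Suc n) * weight k n / 4 - lower_moments k n * weight k n))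
      \<longlonglongrightarrow> ?c / 2" by simp
qed

theorem theorem1p6:
  fixes k :: nat
  shows "(\<lambda>n. u_moment (2 * k) n) \<sim>[sequentially]
    (\<lambda>n. exp (pi * sqrt (2 * real n / 3)) / (8 * 6 powr (1 / 4) * real n powr (3 / 4))
          * real (odd_double_fact k) * (6 * real n / pi\<^sup>2) powr (real k / 2))"
proof (rule asymp_equivI')
  let ?g = "\<lambda>n. exp (pi * sqrt (2 * real n / 3)) / (8 * 6 powr (1 / 4) * real n powr (3 / 4))
          * real (odd_double_fact k) * (6 * real n / pi\<^sup>2) powr (real k / 2)"
  let ?c = "real (odd_double_fact k)"
  have c: "0 < ?c" unfolding odd_double_fact_def of_nat_prod by (intro prod_pos) auto
  have "(\<lambda>n. u_moment (2 * k) n * weight k n / (?c / 2)) \<longlonglongrightarrow> (?c / 2) / (?c / 2)"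
    using c by (intro tendsto_divide u_moment_weight tendsto_const) auto
  then have lim: "(\<lambda>n. u_moment (2 * k) n * weight k n / (?c / 2)) \<longlonglongrightarrow> 1" using c by simp
  have "eventually (\<lambda>n. u_moment (2 * k) n * weight k n / (?c / 2) = u_moment (2 * k) n / ?g n) sequentially"
    using eventually_gt_at_top[of 0]
  proof eventually_elim
    case (elim n)
    define t where "t = saddle n"
    have t: "0 < t" using saddle_pos[OF elim] by (simp add: t_def)
    \<comment> \<open>The power of \<open>n\<close> in the claim is the \<open>k\<close>-th inverse
      power of the saddle point.\<close>
    have "6 * real n / pi\<^sup>2 = inverse (t\<^sup>2)" using elim by (simp add: t_def saddle_def power_divide)
    also have "\<dots> = t powr (- 2)" using t by (simp add: powr_minus powr_numeral)
    finally have "(6 * real n / pi\<^sup>2) powr (real k / 2) = t powr (- real k)" by (simp add: powr_powr)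
    also have "\<dots> = inverse (t ^ k)" using t by (simp add: powr_minus powr_realpow)
    finally have p: "(6 * real n / pi\<^sup>2) powr (real k / 2) = inverse (t ^ k)" .
    have "exp (pi * sqrt (2 * real n / 3)) / (8 * 6 powr (1 / 4) * real n powr (3 / 4)) = growth n / 2"
      by (simp add: growth_def)
    then have g: "?g n = growth n / 2 * ?c * inverse (t ^ k)" unfolding p by (simp only:)
    show ?case unfolding g weight_def t_def[symmetric] by (simp add: divide_simps)
  qed
  with lim show "(\<lambda>n. u_moment (2 * k) n / ?g n) \<longlonglongrightarrow> 1" by (rule Lim_transform_eventually)
qed

end
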